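(* Let $\mathcal{H}$ be a separable complex Hilbert space and let $S: D_S\to\mathcal{H}$ be a closed linear operator densely defined in $\mathcal{H}$ such that $S\in\mathfrak{C}_0(\mathcal{H})$, i.e. there exists an orthonormal sequence $\{e_n\}_{n=1}^\infty\subset D_{S^*}$ with $\lim_{n\to\infty}\Vert S^*e_n\Vert=0$. Then there exists a unitary operator $U_\infty:\mathcal{H}\to L_2(\mathbb{R})$ such that the operator $T=U_\infty S U_\infty^{-1}$, with domain $D_T=U_\infty D_S$, is a Carleman operator having an $SK^\infty$-kernel; that is, there is an $SK^\infty$-kernel $\boldsymbol{K}:\mathbb{R}^2\to\mathbb{C}$ such that for every $f\in D_T$, $(Tf)(s)=\int_{\mathbb{R}}\boldsymbol{K}(s,t)f(t)\,dt$ for almost every $s\in\mathbb{R}$.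
   Context: $L_2=L_2(\mathbb{R})$ is the Hilbert space of (equivalence classes of) measurable complex-valued functions on $\mathbb{R}$ (Lebesgue measure) with inner product $\langle f,g\rangle=\int_{\mathbb{R}} f(s)\overline{g(s)}\,ds$. For a closed densely defined operator $S$ in $\mathcal{H}$, $S^*$ (with domain $D_{S^*}$) denotes its Hilbert space adjoint. Limit spectrum: for a closed densely defined operator $A$ with domain $D_A$ in $\mathcal{H}$, a number $\lambda\in\mathbb{C}$ belongs to the limit spectrum $\sigma_c(A)$ if there is an orthonormal sequence $\{e_n\}\subset D_A$ with $\lim_{n\to\infty}\Vert(A-\lambda)e_n\Vert=0$. $\mathfrak{C}_0(\mathcal{H})$ is the set of all closed linear operators $S$ densely defined in $\mathcal{H}$ with $0\in\sigma_c(S^* )$. Integral and Carleman operators: a linear operator $T:D_T\to L_2$, with domain $D_T$ a dense linear manifold in $L_2$, is integral if there is a measurable function $\boldsymbol{T}$ on $\mathbb{R}^2$ (a kernel) such that for every $f\in D_T$, $(Tf)(s)=\int_{\mathbb{R}}\boldsymbol{T}(s,t)f(t)\,dt$ for almost every $s\in\mathbb{R}$. A kernel $\boldsymbol{T}$ is Carleman if $\boldsymbol{T}(s,\cdot)\in L_2$ for almost every fixed $s\in\mathbb{R}$; an integral operator whose kernel is Carleman is called a Carleman operator. A Carleman kernel $\boldsymbol{T}$ defines a Carleman function $\boldsymbol{t}$ from $\mathbb{R}$ to $L_2$ by $\boldsymbol{t}(s)=\overline{\boldsymbol{T}(s,\cdot)}$ for all $s$ with $\boldsymbol{T}(s,\cdot)\in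 L_2$. Function spaces: for a locally compact space $X$ and a Banach space $B$, $C(X,B)$ is the Banach space of continuous functions $f:X\to B$ vanishing at infinity (for every $\varepsilon>0$ there is a compact $X(\varepsilon,f)\subset X$ with $\Vert f(x)\Vert_B<\varepsilon$ for $x\notin X(\varepsilon,f)$), with norm $\sup_{x\in X}\Vert f(x)\Vert_B$. $SK^m$- and $SK^\infty$-kernels: for a non-negative integer $m$, a Carleman kernel $\boldsymbol{K}:\mathbb{R}^2\to\mathbb{C}$ is an $SK^m$-kernel if (i) $\boldsymbol{K}$ and all its partial derivatives on $\mathbb{R}^2$ up to order $m$ are in $C(\mathbb{R}^2,\mathbb{C})$, and (ii) the Carleman function $\boldsymbol{k}$, $\boldsymbol{k}(s)=\overline{\boldsymbol{K}(s,\cdot)}$, and all its (strong, i.e. with respect to the norm of $L_2$) derivatives on $\mathbb{R}$ up to order $m$ are in $C(\mathbb{R},L_2)$. $\boldsymbol{K}$ is an $SK^\infty$-kernel if it is an $SK^m$-kernel for every non-negative integer $m$. *)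

theory Defs
  imports "HOL-Analysis.Analysis"
begin

section \<open>Complex Hilbert spaces\<close>

class scaleC = scaleR +
  fixes scaleC :: "complex \<Rightarrow> 'a \<Rightarrow> 'a"  (infixr "*\<^sub>C" 75)
  assumes scaleR_scaleC: "r *\<^sub>R x = complex_of_real r *\<^sub>C x"

class complex_vector = scaleC + real_vector +
  assumes scaleC_add_right: "a *\<^sub>C (x + y) = a *\<^sub>C x + a *\<^sub>C y"
    and scaleC_add_left: "(a + b) *\<^sub>C x = a *\<^sub>C x + b *\<^sub>C x"
    and scaleC_scaleC: "a *\<^sub>C b *\<^sub>C x = (a * b) *\<^sub>C x"
    and scaleC_one: "1 *\<^sub>C x = x"

global_interpretation complex_vector:
  vector_space "scaleC :: complex \<Rightarrow> 'a \<Rightarrow> 'a::complex_vector"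
  defines csubspace = complex_vector.subspace
  by unfold_locales
    (simp_all add: scaleC_add_right scaleC_add_left scaleC_scaleC scaleC_one)

(* The complex inner product is linear in the first argument.  Its real part is the inner
   product of the superclass real_inner, so that norm x = sqrt (cinner x x) and the topology
   is the norm topology. *)
class complex_inner = complex_vector + real_inner +
  fixes cinner :: "'a \<Rightarrow> 'a \<Rightarrow> complex"
  assumes cinner_commute: "cinner x y = cnj (cinner y x)"
    and cinner_add_left: "cinner (x + y) z = cinner x z + cinner y z"
    and cinner_scaleC_left: "cinner (a *\<^sub>C x) y = a * cinner x y"
    and inner_eq_Re_cinner: "inner x y = Re (cinner x y)"

class chilbert_space = complex_inner + complete_space

definition orthonormal_seq :: "(nat \<Rightarrow> 'a::complex_inner) \<Rightarrow> bool" where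
  "orthonormal_seq e \<longleftrightarrow> (\<forall>m n. cinner (e m) (e n) = (if m = n then 1 else 0))"

definition unitary :: "('a::complex_inner \<Rightarrow> 'b::complex_inner) \<Rightarrow> bool" where
  "unitary U \<longleftrightarrow> Vector_Spaces.linear scaleC scaleC U \<and> surj U \<and>
     (\<forall>x y. cinner (U x) (U y) = cinner x y)"


section \<open>Unbounded operators\<close>

(* An operator is given by its domain D and a function A whose values outside D are
   irrelevant. *)
definition linear_operator :: "'a::complex_inner set \<Rightarrow> ('a \<Rightarrow> 'b::complex_inner) \<Rightarrow> bool" where
  "linear_operator D A \<longleftrightarrow> csubspace D \<and>
     (\<forall>x\<in>D. \<forall>y\<in>D. A (x + y) = A x + A y) \<and> (\<forall>c. \<forall>x\<in>D. A (c *\<^sub>C x) = c *\<^sub>C A x)"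

definition densely_defined :: "'a::complex_inner set \<Rightarrow> bool" where
  "densely_defined D \<longleftrightarrow> closure D = UNIV"

definition closed_operator :: "'a::complex_inner set \<Rightarrow> ('a \<Rightarrow> 'b::complex_inner) \<Rightarrow> bool" where
  "closed_operator D A \<longleftrightarrow> closed {(x, A x) | x. x \<in> D}"

definition adj_domain :: "'a::complex_inner set \<Rightarrow> ('a \<Rightarrow> 'b::complex_inner) \<Rightarrow> 'b set" where
  "adj_domain D A = {y. \<exists>z. \<forall>x\<in>D. cinner (A x) y = cinner x z}"

(* The vector z is unique when D is dense and y lies in adj_domain D A. *)
definition adj :: "'a::complex_inner set \<Rightarrow> ('a \<Rightarrow> 'b::complex_inner) \<Rightarrow> 'b \<Rightarrow> 'a" where
  "adj D A y = (THE z. \<forall>x\<in>D. cinner (A x) y = cinner x z)"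

definition limit_spectrum :: "'a::complex_inner set \<Rightarrow> ('a \<Rightarrow> 'a) \<Rightarrow> complex set" where
  "limit_spectrum D A = {\<mu>. \<exists>e. orthonormal_seq e \<and> (\<forall>n. e n \<in> D) \<and>
     (\<lambda>n. norm (A (e n) - \<mu> *\<^sub>C e n)) \<longlonglongrightarrow> 0}"

definition class_C0 :: "'a::complex_inner set \<Rightarrow> ('a \<Rightarrow> 'a) \<Rightarrow> bool" where
  "class_C0 D S \<longleftrightarrow> linear_operator D S \<and> closed_operator D S \<and> densely_defined D \<and>
     0 \<in> limit_spectrum (adj_domain D S) (adj D S)"


section \<open>The space \<open>L\<^sub>2(\<real>)\<close>\<close>

definition square_integrable :: "(real \<Rightarrow> complex) \<Rightarrow> bool" where
  "square_integrable f \<longleftrightarrow> f \<in> borel_measurable lebesgue \<and>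
     integrable lebesgue (\<lambda>x. (cmod (f x))\<^sup>2)"

definition L2_rel :: "(real \<Rightarrow> complex) \<Rightarrow> (real \<Rightarrow> complex) \<Rightarrow> bool" where
  "L2_rel f g \<longleftrightarrow> square_integrable f \<and> square_integrable g \<and> (AE x in lebesgue. f x = g x)"

lemma square_integrable_measurable:
  "square_integrable f \<Longrightarrow> f \<in> borel_measurable lebesgue"
  by (simp add: square_integrable_def)

lemma square_integrable_zero [simp]: "square_integrable (\<lambda>x. 0)"
  by (simp add: square_integrable_def)

lemma square_integrable_scale:
  assumes "square_integrable f"
  shows "square_integrable (\<lambda>x. c * f x)"
  using assms by (auto simp: square_integrable_def norm_mult power_mult_distrib)

lemma square_integrable_add:
  assumes f: "square_integrable f" and g: "square_integrable g"
  shows "square_integrable (\<lambda>x. f x + g x)"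
proof -
  note [measurable] = square_integrable_measurable[OF f] square_integrable_measurable[OF g]
  have int: "integrable lebesgue (\<lambda>x. 2 * (cmod (f x))\<^sup>2 + 2 * (cmod (g x))\<^sup>2)"
    using f g by (auto simp: square_integrable_def)
  have bound: "(cmod (f x + g x))\<^sup>2 \<le> 2 * (cmod (f x))\<^sup>2 + 2 * (cmod (g x))\<^sup>2" for x
  proof -
    have "(cmod (f x + g x))\<^sup>2 \<le> (cmod (f x) + cmod (g x))\<^sup>2"
      by (intro power_mono norm_triangle_ineq) auto
    also have "\<dots> \<le> 2 * (cmod (f x))\<^sup>2 + 2 * (cmod (g x))\<^sup>2"
      using sum_squares_bound[of "cmod (f x)" "cmod (g x)"] by (simp add: power2_sum)
    finally show ?thesis .
  qed
  have "integrable lebesgue (\<lambda>x. (cmod (f x + g x))\<^sup>2)"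
  proof (rule Bochner_Integration.integrable_bound[OF int])
    show "(\<lambda>x. (cmod (f x + g x))\<^sup>2) \<in> borel_measurable lebesgue" by measurable
    show "AE x in lebesgue. norm ((cmod (f x + g x))\<^sup>2) \<le> norm (2 * (cmod (f x))\<^sup>2 + 2 * (cmod (g x))\<^sup>2)"
      using bound by (intro AE_I2) simp
  qed
  then show ?thesis by (simp add: square_integrable_def)
qed

lemma square_integrable_cinner:
  assumes f: "square_integrable f" and g: "square_integrable g"
  shows "integrable lebesgue (\<lambda>x. f x * cnj (g x))"
proof -
  note [measurable] = square_integrable_measurable[OF f] square_integrable_measurable[OF g]
  have int: "integrable lebesgue (\<lambda>x. (cmod (f x))\<^sup>2 + (cmod (g x))\<^sup>2)"
    using f g by (auto simp: square_integrable_def)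
  have [measurable]: "cnj \<in> borel_measurable borel"
    by (intro borel_measurable_continuous_onI continuous_intros)
  have bound: "cmod (f x * cnj (g x)) \<le> (cmod (f x))\<^sup>2 + (cmod (g x))\<^sup>2" for x
  proof -
    have "0 \<le> cmod (f x) * cmod (g x)" by simp
    then have "cmod (f x) * cmod (g x) \<le> (cmod (f x))\<^sup>2 + (cmod (g x))\<^sup>2"
      using sum_squares_bound[of "cmod (f x)" "cmod (g x)"] unfolding mult.assoc by linarith
    then show ?thesis by (simp add: norm_mult)
  qed
  show ?thesis
  proof (rule Bochner_Integration.integrable_bound[OF int])
    show "(\<lambda>x. f x * cnj (g x)) \<in> borel_measurable lebesgue" by measurable
    show "AE x in lebesgue. norm (f x * cnj (g x)) \<le> norm ((cmod (f x))\<^sup>2 + (cmod (g x))\<^sup>2)"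
      using bound by (intro AE_I2) simp
  qed
qed

lemma L2_rel_refl [simp]: "L2_rel f f \<longleftrightarrow> square_integrable f"
  by (simp add: L2_rel_def)

quotient_type L2 = "real \<Rightarrow> complex" / partial: L2_rel
proof (rule part_equivpI)
  show "\<exists>f. L2_rel f f" unfolding L2_rel_refl using square_integrable_zero by blast
  show "symp L2_rel" by (auto intro!: sympI simp: L2_rel_def)
  show "transp L2_rel" by (auto intro!: transpI simp: L2_rel_def elim: eventually_elim2)
qed

instantiation L2 :: complex_inner
begin

lift_definition zero_L2 :: L2 is "\<lambda>x. 0" by simp

lift_definition plus_L2 :: "L2 \<Rightarrow> L2 \<Rightarrow> L2" is "\<lambda>f g x. f x + g x"
  by (auto simp: L2_rel_def intro: square_integrable_add)

lift_definition scaleC_L2 :: "complex \<Rightarrow> L2 \<Rightarrow> L2" is "\<lambda>c f x. c * f x"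
  by (auto simp: L2_rel_def intro: square_integrable_scale)

lift_definition cinner_L2 :: "L2 \<Rightarrow> L2 \<Rightarrow> complex" is
  "\<lambda>f g. LINT x|lebesgue. f x * cnj (g x)"
proof -
  fix f f' g g' assume "L2_rel f f'" "L2_rel g g'"
  then have "square_integrable f" "square_integrable f'" "square_integrable g" "square_integrable g'"
    and "AE x in lebesgue. f x = f' x" "AE x in lebesgue. g x = g' x"
    by (auto simp: L2_rel_def)
  moreover from this(5,6) have "AE x in lebesgue. f x * cnj (g x) = f' x * cnj (g' x)"
    by eventually_elim simp
  ultimately show "(LINT x|lebesgue. f x * cnj (g x)) = (LINT x|lebesgue. f' x * cnj (g' x))"
    by (simp add: integral_cong_AE borel_measurable_integrable square_integrable_cinner)
qed

definition uminus_L2 :: "L2 \<Rightarrow> L2" where "- f = (- 1) *\<^sub>C (f :: L2)"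
definition minus_L2 :: "L2 \<Rightarrow> L2 \<Rightarrow> L2" where "f - g = f + - (g :: L2)"
definition scaleR_L2 :: "real \<Rightarrow> L2 \<Rightarrow> L2" where "r *\<^sub>R f = complex_of_real r *\<^sub>C (f :: L2)"
definition inner_L2 :: "L2 \<Rightarrow> L2 \<Rightarrow> real" where "inner f g = Re (cinner f (g :: L2))"
definition norm_L2 :: "L2 \<Rightarrow> real" where "norm f = sqrt (inner f (f :: L2))"
definition sgn_L2 :: "L2 \<Rightarrow> L2" where "sgn f = inverse (norm f) *\<^sub>R (f :: L2)"
definition dist_L2 :: "L2 \<Rightarrow> L2 \<Rightarrow> real" where "dist f g = norm (f - g :: L2)"
definition uniformity_L2 :: "(L2 \<times> L2) filter" where
  "uniformity = (INF e\<in>{0 <..}. principal {(f, g :: L2). dist f g < e})"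
definition open_L2 :: "L2 set \<Rightarrow> bool" where
  "open S \<longleftrightarrow> (\<forall>f\<in>S. \<forall>\<^sub>F (f', g) in uniformity. f' = f \<longrightarrow> g \<in> (S :: L2 set))"

instance
proof
  fix f g h :: L2 and a b :: complex and r s :: real
  show addC: "f + g + h = f + (g + h)" "f + g = g + f" "0 + f = f"
    by (transfer; simp add: L2_rel_def square_integrable_add algebra_simps)+
  show add_right: "a *\<^sub>C (f + g) = a *\<^sub>C f + a *\<^sub>C g" for a and f g :: L2
    by transfer (simp add: L2_rel_def square_integrable_add square_integrable_scale algebra_simps)
  show add_left: "(a + b) *\<^sub>C f = a *\<^sub>C f + b *\<^sub>C f" for a b and f :: L2
    by transfer (simp add: L2_rel_def square_integrable_add square_integrable_scale algebra_simps)
  show scale_scale: "a *\<^sub>C b *\<^sub>C f = (a * b) *\<^sub>C f" for a b and f :: L2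
    by transfer (simp add: L2_rel_def square_integrable_scale algebra_simps)
  show one: "1 *\<^sub>C f = f" for f :: L2
    by transfer (simp add: L2_rel_def)
  have zero: "0 *\<^sub>C f = 0" for f :: L2
    by transfer (simp add: L2_rel_def)
  show "- f + f = 0"
    using add_left[of "-1" 1 f] by (simp add: uminus_L2_def one zero)
  show "f - g = f + - g" by (simp add: minus_L2_def)
  show "r *\<^sub>R f = complex_of_real r *\<^sub>C f" by (simp add: scaleR_L2_def)
  show "r *\<^sub>R (f + g) = r *\<^sub>R f + r *\<^sub>R g" "(r + s) *\<^sub>R f = r *\<^sub>R f + s *\<^sub>R f"
    "r *\<^sub>R s *\<^sub>R f = (r * s) *\<^sub>R f" "1 *\<^sub>R f = f"
    by (simp_all add: scaleR_L2_def add_right add_left scale_scale one)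
  show commute: "cinner f g = cnj (cinner g f)" for f g :: L2
    by transfer (subst Bochner_Integration.integral_cnj[symmetric], simp add: mult.commute)
  show cadd: "cinner (f + g) h = cinner f h + cinner g h"
    by transfer (simp add: distrib_right square_integrable_cinner)
  show cscale: "cinner (a *\<^sub>C f) g = a * cinner f g" for a
    by transfer (simp add: mult.assoc)
  show "inner f g = inner g f"
    using commute[of f g] by (simp add: inner_L2_def)
  show "inner (f + g) h = inner f h + inner g h"
    by (simp add: inner_L2_def cadd)
  show "inner (r *\<^sub>R f) g = r * inner f g"
    by (simp add: inner_L2_def scaleR_L2_def cscale)
  have self: "(LINT x|lebesgue. u x * cnj (u x)) = complex_of_real (LINT x|lebesgue. (cmod (u x))\<^sup>2)"
    for u :: "real \<Rightarrow> complex"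
    unfolding complex_norm_square[symmetric] by (rule integral_complex_of_real)
  show "0 \<le> inner f f"
    unfolding inner_L2_def by transfer (simp add: self del: integral_complex_of_real)
  have sq: "square_integrable (rep_L2 f)"
    using Quotient_rep_reflp[OF Quotient_L2] by simp
  have "inner f f = 0 \<longleftrightarrow> L2_rel (rep_L2 f) (\<lambda>x. 0)"
  proof -
    have "inner f f = (LINT x|lebesgue. (cmod (rep_L2 f x))\<^sup>2)"
      unfolding inner_L2_def cinner_L2_def by (simp add: self)
    also have "\<dots> = 0 \<longleftrightarrow> (AE x in lebesgue. (cmod (rep_L2 f x))\<^sup>2 = 0)"
      using sq by (intro integral_nonneg_eq_0_iff_AE) (auto simp: square_integrable_def)
    finally show ?thesis using sq by (simp add: L2_rel_def)
  qed
  also have "L2_rel (rep_L2 f) (\<lambda>x. 0) \<longleftrightarrow> f = 0"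
    using Quotient_rel[OF Quotient_L2, of "rep_L2 f" "\<lambda>x. 0"] sq
    by (simp add: zero_L2_def Quotient_abs_rep[OF Quotient_L2])
  finally show "inner f f = 0 \<longleftrightarrow> f = 0" .
qed (fact inner_L2_def norm_L2_def sgn_L2_def dist_L2_def uniformity_L2_def open_L2_def)+

end


section \<open>Function spaces\<close>

definition C0 :: "('a::topological_space \<Rightarrow> 'b::real_normed_vector) \<Rightarrow> bool" where
  "C0 f \<longleftrightarrow> continuous_on UNIV f \<and>
     (\<forall>\<epsilon>>0. \<exists>X. compact X \<and> (\<forall>x. x \<notin> X \<longrightarrow> norm (f x) < \<epsilon>))"

(* All (mixed) partial derivatives of total order at most m exist and are in C0. *)
primrec partials_C0 :: "nat \<Rightarrow> (real \<times> real \<Rightarrow> complex) \<Rightarrow> bool" where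
  "partials_C0 0 F \<longleftrightarrow> C0 F"
| "partials_C0 (Suc m) F \<longleftrightarrow> C0 F \<and> (\<exists>F1 F2.
     (\<forall>s t. ((\<lambda>x. F (x, t)) has_vector_derivative F1 (s, t)) (at s)) \<and>
     (\<forall>s t. ((\<lambda>y. F (s, y)) has_vector_derivative F2 (s, t)) (at t)) \<and>
     partials_C0 m F1 \<and> partials_C0 m F2)"

primrec derivs_C0 :: "nat \<Rightarrow> (real \<Rightarrow> 'b::real_normed_vector) \<Rightarrow> bool" where
  "derivs_C0 0 f \<longleftrightarrow> C0 f"
| "derivs_C0 (Suc m) f \<longleftrightarrow> C0 f \<and>
     (\<exists>f'. (\<forall>s. (f has_vector_derivative f' s) (at s)) \<and> derivs_C0 m f')"


section \<open>Integral operators and kernels\<close>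

definition integral_operator_with_kernel ::
  "L2 set \<Rightarrow> (L2 \<Rightarrow> L2) \<Rightarrow> (real \<times> real \<Rightarrow> complex) \<Rightarrow> bool" where
  "integral_operator_with_kernel D T K \<longleftrightarrow>
     linear_operator D T \<and> densely_defined D \<and> K \<in> borel_measurable lebesgue \<and>
     (\<forall>f\<in>D. AE s in lebesgue. integrable lebesgue (\<lambda>t. K (s, t) * rep_L2 f t) \<and>
        rep_L2 (T f) s = (LINT t|lebesgue. K (s, t) * rep_L2 f t))"

definition carleman_kernel :: "(real \<times> real \<Rightarrow> complex) \<Rightarrow> bool" where
  "carleman_kernel K \<longleftrightarrow> K \<in> borel_measurable lebesgue \<and>
     (AE s in lebesgue. square_integrable (\<lambda>t. K (s, t)))"

definition carleman_operator_with_kernel ::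
  "L2 set \<Rightarrow> (L2 \<Rightarrow> L2) \<Rightarrow> (real \<times> real \<Rightarrow> complex) \<Rightarrow> bool" where
  "carleman_operator_with_kernel D T K \<longleftrightarrow>
     integral_operator_with_kernel D T K \<and> carleman_kernel K"

(* Meaningful at those s for which K(s, .) is square integrable. *)
definition carleman_function :: "(real \<times> real \<Rightarrow> complex) \<Rightarrow> real \<Rightarrow> L2" where
  "carleman_function K s = abs_L2 (\<lambda>t. cnj (K (s, t)))"

(* Membership of the Carleman function in C(R, L2) includes that it is defined at every s. *)
definition SK_kernel :: "nat \<Rightarrow> (real \<times> real \<Rightarrow> complex) \<Rightarrow> bool" where
  "SK_kernel m K \<longleftrightarrow> carleman_kernel K \<and> partials_C0 m K \<and>
     (\<forall>s. square_integrable (\<lambda>t. K (s, t))) \<and> derivs_C0 m (carleman_function K)"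

definition SK_infinity_kernel :: "(real \<times> real \<Rightarrow> complex) \<Rightarrow> bool" where
  "SK_infinity_kernel K \<longleftrightarrow> (\<forall>m. SK_kernel m K)"

end

theory Submission
  imports Defs
begin

text \<open>
  Choose orthonormal bases \<open>f\<^sub>n\<close> of the Hilbert space and \<open>u\<^sub>n\<close> of \<open>L\<^sub>2\<close> and let
  \<open>U\<close> be the unitary operator that maps \<open>f\<^sub>n\<close> to \<open>u\<^sub>n\<close>.  If \<open>f\<^sub>n\<close> lies in the domain of the
  adjoint \<open>A\<close> of \<open>S\<close>, then the \<open>n\<close>-th coefficient of \<open>U S x\<close> is
  \<open>\<langle>S x, f\<^sub>n\<rangle> = \<langle>x, A f\<^sub>n\<rangle> = \<langle>U x, U A f\<^sub>n\<rangle>\<close>, so that \<open>U S U\<^sup>-\<^sup>1\<close> has, at least formally, the kernel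
  \<open>K(s,t) = \<Sum>\<^sub>n u\<^sub>n(s) cnj (g\<^sub>n(t))\<close> with \<open>g\<^sub>n = U A f\<^sub>n = \<Sum>\<^sub>m a\<^sub>n\<^sub>m u\<^sub>m\<close> and
  \<open>a\<^sub>n\<^sub>m = \<langle>A f\<^sub>n, f\<^sub>m\<rangle>\<close>.  The kernel and the Carleman function are smooth and vanish at infinity,
  together with all derivatives, as soon as the \<open>u\<^sub>n\<close> have this property and the series
  \<open>\<Sum>\<^sub>n \<parallel>A f\<^sub>n\<parallel> \<parallel>u\<^sub>n\<parallel>\<^sub>p\<close> and \<open>\<Sum>\<^sub>n\<^sub>,\<^sub>m |a\<^sub>n\<^sub>m| \<parallel>u\<^sub>n\<parallel>\<^sub>p \<parallel>u\<^sub>m\<parallel>\<^sub>p\<close> converge for every \<open>p\<close>, where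
  \<open>\<parallel>u\<parallel>\<^sub>p\<close> is the sum of the sup norms of the first \<open>p\<close> derivatives and of \<open>u\<close> itself.

  Both bases are built simultaneously so that these series converge (\<open>adapted_bases_exist\<close>).  Two
  supplies of small vectors are available.  In the Hilbert space there are the given orthonormal
  vectors \<open>e\<^sub>k\<close>: \<open>A e\<^sub>k\<close> tends to zero, and so does \<open>\<langle>A f\<^sub>i, e\<^sub>k\<rangle>\<close> for each of the finitely many \<open>f\<^sub>i\<close>
  that have already been chosen, since \<open>e\<^sub>k\<close> tends weakly to zero.  In \<open>L\<^sub>2\<close> there are
  the dilations of a bump to larger and larger width: they keep their norm while all their
  \<open>\<parallel>\<cdot>\<parallel>\<^sub>p\<close> tend to zero.  At an even step, \<open>u\<^sub>n\<close> comes from a Gram-Schmidt step for the next member of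
  a total sequence of test functions, so its size is arbitrary, and this is compensated by taking \<open>f\<^sub>n\<close>
  close to \<open>e\<^sub>k\<close> with a large \<open>k\<close>.  At an odd step, \<open>f\<^sub>n\<close> comes from a Gram-Schmidt step for the next
  member of a total sequence in the domain of \<open>A\<close>, and this is compensated by taking \<open>u\<^sub>n\<close> close to a
  very wide bump.  Since each step only has to beat finitely many numbers, the bounds can be made
  geometric (\<open>basis_step_exists\<close>), and Gram-Schmidt makes both bases total.

  What remains is the supporting analysis: the domain of the adjoint of a closed operator is total
  (\<open>adj_domain_total\<close>), \<open>L\<^sub>2\<close> is complete, and the bumps \<open>exp (-(\<alpha> x + \<beta>)\<^sup>2\<^sup>k)\<close> are total in \<open>L\<^sub>2\<close>
  because they converge to indicator functions of intervals
  (\<open>AE_zero_if_orthogonal_to_bumps\<close>).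
\<close>

section \<open>Complex inner product spaces\<close>

instance chilbert_space \<subseteq> banach ..

lemma cinner_add_right: "cinner x (y + z) = cinner x y + cinner x (z::'a::complex_inner)"
  by (metis cinner_add_left cinner_commute complex_cnj_add)

lemma cinner_scaleC_right: "cinner x (a *\<^sub>C y) = cnj a * cinner x (y::'a::complex_inner)"
  by (metis cinner_scaleC_left cinner_commute complex_cnj_mult)

lemma cinner_self: "cinner x x = complex_of_real ((norm x)\<^sup>2)" for x :: "'a::complex_inner"
proof -
  have "Im (cinner x x) = 0"
    using cinner_commute[of x x] by (metis complex_cnj_cancel_iff complex_eq_iff complex.sel(2) cnj.simps(2) equal_neg_zero)
  then show ?thesis
    by (simp add: complex_eq_iff power2_norm_eq_inner inner_eq_Re_cinner)
qed

lemma norm_scaleC: "norm (a *\<^sub>C x) = cmod a * norm (x::'a::complex_inner)"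
proof -
  have "complex_of_real ((norm (a *\<^sub>C x))\<^sup>2) = a * cnj a * complex_of_real ((norm x)\<^sup>2)"
    by (simp only: cinner_self[symmetric] cinner_scaleC_left cinner_scaleC_right mult.assoc mult.left_commute)
  also have "\<dots> = complex_of_real ((cmod a * norm x)\<^sup>2)"
    by (simp add: complex_norm_square[symmetric] power_mult_distrib)
  finally have "(norm (a *\<^sub>C x))\<^sup>2 = (cmod a * norm x)\<^sup>2"
    using of_real_eq_iff by blast
  then show ?thesis by (simp add: power2_eq_iff_nonneg)
qed

lemma Cauchy_Schwarz_cinner: "cmod (cinner x y) \<le> norm x * norm (y::'a::complex_inner)"
proof (cases "cinner x y = 0")
  case False
  define c where "c = cnj (cinner x y) / cmod (cinner x y)"
  have c: "cmod c = 1" using False by (simp add: c_def norm_divide)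
  have "cinner (c *\<^sub>C x) y = cmod (cinner x y)"
    using False by (simp add: cinner_scaleC_left c_def mult.commute[of "cnj _"] complex_norm_square[symmetric] power2_eq_square)
  then have "cmod (cinner x y) = inner (c *\<^sub>C x) y" by (simp add: inner_eq_Re_cinner)
  also have "\<dots> \<le> norm (c *\<^sub>C x) * norm y" by (rule norm_cauchy_schwarz)
  finally show ?thesis by (simp add: norm_scaleC c)
qed simp

lemma bounded_bilinear_cinner: "bounded_bilinear (cinner :: 'a::complex_inner \<Rightarrow> 'a \<Rightarrow> complex)"
proof
  show "\<exists>K. \<forall>a b::'a. cmod (cinner a b) \<le> norm a * norm b * K"
    by (rule exI[of _ 1]) (simp add: Cauchy_Schwarz_cinner)
qed (auto simp: cinner_add_left cinner_add_right scaleR_scaleC cinner_scaleC_left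
      cinner_scaleC_right scaleR_conv_of_real)

lemma bounded_bilinear_scaleC: "bounded_bilinear (scaleC :: complex \<Rightarrow> 'a::complex_inner \<Rightarrow> 'a)"
proof
  show "\<exists>K. \<forall>a. \<forall>b::'a. norm (a *\<^sub>C b) \<le> norm a * norm b * K"
    by (rule exI[of _ 1]) (simp add: norm_scaleC)
qed (auto simp: scaleR_scaleC scaleC_add_right scaleC_add_left scaleC_scaleC mult.commute scaleR_conv_of_real)

lemmas cinner_simps = cinner_add_left cinner_add_right cinner_scaleC_left cinner_scaleC_right
  bounded_bilinear.diff_left[OF bounded_bilinear_cinner]
  bounded_bilinear.diff_right[OF bounded_bilinear_cinner]
  bounded_bilinear.minus_left[OF bounded_bilinear_cinner]
  bounded_bilinear.minus_right[OF bounded_bilinear_cinner]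
  bounded_bilinear.sum_left[OF bounded_bilinear_cinner]
  bounded_bilinear.sum_right[OF bounded_bilinear_cinner]
  bounded_bilinear.zero_left[OF bounded_bilinear_cinner]
  bounded_bilinear.zero_right[OF bounded_bilinear_cinner]

lemmas tendsto_scaleC = bounded_bilinear.tendsto[OF bounded_bilinear_scaleC]

lemma scaleC_zero_left [simp]: "0 *\<^sub>C (x::'a::complex_inner) = 0"
  by (rule bounded_bilinear.zero_left[OF bounded_bilinear_scaleC])

lemma cinner_eq_zero_commute: "cinner x y = 0 \<longleftrightarrow> cinner y (x::'a::complex_inner) = 0"
  by (metis cinner_commute complex_cnj_zero)

lemma csubspace_sum:
  assumes "csubspace W" "\<And>i. i \<in> I \<Longrightarrow> f i \<in> W"
  shows "sum f I \<in> (W::'a::complex_vector set)"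
  using assms by (rule complex_vector.subspace_sum)

section \<open>Orthonormal sequences\<close>

definition orthonormal_below :: "(nat \<Rightarrow> 'a::complex_inner) \<Rightarrow> nat \<Rightarrow> bool" where
  "orthonormal_below f n \<longleftrightarrow> (\<forall>i<n. \<forall>j<n. cinner (f i) (f j) = (if i = j then 1 else 0))"

lemma orthonormal_seq_below: "orthonormal_seq f \<Longrightarrow> orthonormal_below f n"
  by (simp add: orthonormal_seq_def orthonormal_below_def)

lemma orthonormal_norm: "orthonormal_seq f \<Longrightarrow> norm (f n) = 1"
  by (metis cinner_self norm_ge_zero of_real_eq_1_iff one_power2 orthonormal_seq_def power2_eq_iff_nonneg zero_le_one)

definition ortho_proj :: "(nat \<Rightarrow> 'a::complex_inner) \<Rightarrow> nat \<Rightarrow> 'a \<Rightarrow> 'a" where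
  "ortho_proj f n x = (\<Sum>i<n. cinner x (f i) *\<^sub>C f i)"

lemma cinner_lincomb:
  assumes "finite I" "\<And>i. i \<in> I \<Longrightarrow> cinner (f i) (f j) = (if i = j then 1 else 0)" 
  shows "cinner (\<Sum>i\<in>I. c i *\<^sub>C f i) (f j) = (if j \<in> I then c j else 0)"
proof -
  have "cinner (\<Sum>i\<in>I. c i *\<^sub>C f i) (f j) = (\<Sum>i\<in>I. c i * (if i = j then 1 else 0))"
    unfolding cinner_simps using assms(2) by (intro sum.cong) auto
  also have "\<dots> = (if j \<in> I then c j else 0)" 
    using assms(1) by (simp add: if_distrib cong: if_cong)
  finally show ?thesis .
qed

lemma cinner_ortho_proj:
  assumes "orthonormal_below f n" "j < n"
  shows "cinner (ortho_proj f n x) (f j) = cinner x (f j)"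
  unfolding ortho_proj_def using assms
  by (subst cinner_lincomb) (auto simp: orthonormal_below_def)

lemma norm_lincomb:
  assumes "finite I" "\<And>i j. i \<in> I \<Longrightarrow> j \<in> I \<Longrightarrow> cinner (f i) (f j) = (if i = j then 1 else 0)"
  shows "(norm (\<Sum>i\<in>I. c i *\<^sub>C f i))\<^sup>2 = (\<Sum>i\<in>I. (cmod (c i))\<^sup>2)"
proof -
  have "complex_of_real ((norm (\<Sum>i\<in>I. c i *\<^sub>C f i))\<^sup>2)
      = (\<Sum>j\<in>I. cnj (c j) * cinner (\<Sum>i\<in>I. c i *\<^sub>C f i) (f j))"
    unfolding cinner_self[symmetric] bounded_bilinear.sum_right[OF bounded_bilinear_cinner]
    by (simp only: cinner_scaleC_right)
  also have "\<dots> = (\<Sum>j\<in>I. cnj (c j) * c j)"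
    using assms by (intro sum.cong) (auto simp: cinner_lincomb)
  also have "\<dots> = complex_of_real (\<Sum>i\<in>I. (cmod (c i))\<^sup>2)"
    unfolding of_real_sum complex_norm_square by (simp add: mult.commute)
  finally show ?thesis using of_real_eq_iff by blast
qed

lemma Bessel_finite:
  assumes "orthonormal_below f n"
  shows "(\<Sum>i<n. (cmod (cinner x (f i)))\<^sup>2) \<le> (norm x)\<^sup>2"
proof -
  let ?p = "ortho_proj f n x"
  have p: "(norm ?p)\<^sup>2 = (\<Sum>i<n. (cmod (cinner x (f i)))\<^sup>2)"
    unfolding ortho_proj_def using assms by (intro norm_lincomb) (auto simp: orthonormal_below_def)
  have "cinner (x - ?p) ?p = (\<Sum>i<n. cnj (cinner x (f i)) * cinner (x - ?p) (f i))"
    by (subst (2) ortho_proj_def) (simp add: cinner_simps)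
  also have "\<dots> = 0"
    using assms by (intro sum.neutral) (simp add: cinner_simps cinner_ortho_proj)
  finally have "inner (x - ?p) ?p = 0" by (simp add: inner_eq_Re_cinner)
  then have "inner x ?p = (norm ?p)\<^sup>2" by (simp add: inner_diff_left power2_norm_eq_inner)
  moreover have "0 \<le> (norm (x - ?p))\<^sup>2" by simp
  ultimately have "(norm ?p)\<^sup>2 \<le> (norm x)\<^sup>2"
    by (simp add: power2_norm_eq_inner inner_diff inner_commute)
  then show ?thesis by (simp add: p)
qed

lemma Bessel_summable:
  assumes "orthonormal_seq f"
  shows "summable (\<lambda>n. (cmod (cinner x (f n)))\<^sup>2)"
proof (rule summableI_nonneg_bounded)
  show "(\<Sum>i<n. (cmod (cinner x (f i)))\<^sup>2) \<le> (norm x)\<^sup>2" for n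
    by (intro Bessel_finite orthonormal_seq_below assms)
qed simp

lemma orthonormal_weakly_null:
  assumes "orthonormal_seq f"
  shows "(\<lambda>n. cinner x (f n)) \<longlonglongrightarrow> 0" "(\<lambda>n. cinner (f n) x) \<longlonglongrightarrow> 0"
proof -
  have "(\<lambda>n. (cmod (cinner x (f n)))\<^sup>2) \<longlonglongrightarrow> 0"
    using Bessel_summable[OF assms] by (rule summable_LIMSEQ_zero)
  then have "(\<lambda>n. sqrt ((cmod (cinner x (f n)))\<^sup>2)) \<longlonglongrightarrow> sqrt 0" by (rule tendsto_real_sqrt)
  then show a: "(\<lambda>n. cinner x (f n)) \<longlonglongrightarrow> 0" by (simp add: tendsto_norm_zero_iff)
  have "(\<lambda>n. cnj (cinner x (f n))) \<longlonglongrightarrow> cnj 0" by (intro tendsto_cnj a)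
  then show "(\<lambda>n. cinner (f n) x) \<longlonglongrightarrow> 0" by (simp flip: cinner_commute)
qed

lemma summable_orthonormal:
  fixes f :: "nat \<Rightarrow> 'a::chilbert_space"
  assumes f: "orthonormal_seq f" and c: "summable (\<lambda>n. (cmod (c n))\<^sup>2)"
  shows "summable (\<lambda>n. c n *\<^sub>C f n)"
  unfolding summable_Cauchy
proof (intro allI impI)
  fix e :: real assume "e > 0"
  then obtain N where N: "\<And>m n. m \<ge> N \<Longrightarrow> norm (\<Sum>k\<in>{m..<n}. (cmod (c k))\<^sup>2) < e\<^sup>2"
    using c unfolding summable_Cauchy by (meson zero_less_power)
  have "norm (\<Sum>k\<in>{m..<n}. c k *\<^sub>C f k) < e" if "m \<ge> N" for m n
  proof -
    have "(norm (\<Sum>k\<in>{m..<n}. c k *\<^sub>C f k))\<^sup>2 = (\<Sum>k\<in>{m..<n}. (cmod (c k))\<^sup>2)"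
      using f by (intro norm_lincomb) (auto simp: orthonormal_seq_def)
    also have "\<dots> < e\<^sup>2" using N[OF that, of n] by simp
    finally show ?thesis using \<open>e > 0\<close> by (simp add: power2_less_imp_less)
  qed
  then show "\<exists>N. \<forall>m\<ge>N. \<forall>n. norm (\<Sum>k\<in>{m..<n}. c k *\<^sub>C f k) < e" by blast
qed

lemma cinner_sums_left: "h sums x \<Longrightarrow> (\<lambda>n. cinner (h n) y) sums cinner x (y::'a::complex_inner)"
  by (rule bounded_linear.sums[OF bounded_bilinear.bounded_linear_left[OF bounded_bilinear_cinner]])

lemma cinner_sums_right: "h sums x \<Longrightarrow> (\<lambda>n. cinner y (h n)) sums cinner y (x::'a::complex_inner)"
  by (rule bounded_linear.sums[OF bounded_bilinear.bounded_linear_right[OF bounded_bilinear_cinner]])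

lemma orthonormal_sums_coeff:
  assumes f: "orthonormal_seq f" and x: "(\<lambda>n. c n *\<^sub>C f n) sums x"
  shows "cinner x (f k) = c k"
proof -
  have "(\<lambda>n. cinner (c n *\<^sub>C f n) (f k)) sums cinner x (f k)" by (rule cinner_sums_left[OF x])
  moreover have "(\<lambda>n. cinner (c n *\<^sub>C f n) (f k)) sums c k"
  proof -
    have "(\<lambda>n. cinner (c n *\<^sub>C f n) (f k)) = (\<lambda>n. if n \<in> {k} then c n else 0)"
      using f by (intro ext) (simp add: cinner_scaleC_left orthonormal_seq_def)
    then show ?thesis using sums_If_finite_set[of "{k}" c] by simp
  qed
  ultimately show ?thesis by (rule sums_unique2)
qed

definition total_seq :: "(nat \<Rightarrow> 'a::complex_inner) \<Rightarrow> bool" where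
  "total_seq f \<longleftrightarrow> (\<forall>x. (\<forall>n. cinner x (f n) = 0) \<longrightarrow> x = 0)"

lemma orthonormal_expansion:
  fixes f :: "nat \<Rightarrow> 'a::chilbert_space"
  assumes f: "orthonormal_seq f" and tot: "total_seq f"
  shows "(\<lambda>n. cinner x (f n) *\<^sub>C f n) sums x"
proof -
  obtain y where y: "(\<lambda>n. cinner x (f n) *\<^sub>C f n) sums y"
    using summable_orthonormal[OF f Bessel_summable[OF f]] by (auto simp: summable_def)
  have "cinner (x - y) (f k) = 0" for k
    using orthonormal_sums_coeff[OF f y] by (simp add: cinner_simps)
  then have "x - y = 0" using tot unfolding total_seq_def by blast
  with y show ?thesis by simp
qed

text \<open>
  Completeness of both spaces is essential here: Bessel's inequality makes the coefficients of any
  vector square summable, and completeness turns them into a vector of the other space; this gives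
  the operator in one direction and its surjectivity in the other.
\<close>
lemma unitary_between_bases:
  fixes f :: "nat \<Rightarrow> 'a::chilbert_space" and g :: "nat \<Rightarrow> 'b::chilbert_space"
  assumes f: "orthonormal_seq f" "total_seq f" and g: "orthonormal_seq g" "total_seq g"
  obtains U where "unitary U" "\<And>n. U (f n) = g n"
proof -
  have "\<exists>y. \<forall>n. cinner y (g n) = cinner x (f n)" for x
  proof -
    obtain y where "(\<lambda>n. cinner x (f n) *\<^sub>C g n) sums y"
      using summable_orthonormal[OF g(1) Bessel_summable[OF f(1), of x]] by (auto simp: summable_def)
    then show ?thesis
      using orthonormal_sums_coeff[OF g(1), where c = "\<lambda>n. cinner x (f n)"] by blast
  qed
  then obtain U where U: "\<And>x n. cinner (U x) (g n) = cinner x (f n)" by metis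
  have eq: "y = z" if "\<And>n. cinner y (g n) = cinner z (g n)" for y z
    using that g(2) by (auto simp: total_seq_def cinner_simps dest!: spec[of _ "y - z"])
  have U': "(\<lambda>n. cinner x (f n) *\<^sub>C g n) sums U x" for x
    using orthonormal_expansion[OF g, of "U x"] by (simp add: U)
  have "Vector_Spaces.linear scaleC scaleC U"
    by unfold_locales (auto intro!: eq simp: U cinner_simps)
  moreover have "surj U"
    unfolding surj_def
  proof
    fix y
    obtain x where x: "(\<lambda>n. cinner y (g n) *\<^sub>C f n) sums x"
      using summable_orthonormal[OF f(1) Bessel_summable[OF g(1), of y]] by (auto simp: summable_def)
    show "\<exists>x. y = U x"
      by (rule exI[of _ x], rule eq) (simp add: U orthonormal_sums_coeff[OF f(1) x])
  qed
  moreover have "cinner (U x) (U y) = cinner x y" for x y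
  proof (rule sums_unique2)
    show "(\<lambda>n. cinner (cinner x (f n) *\<^sub>C g n) (U y)) sums cinner (U x) (U y)"
      by (rule cinner_sums_left[OF U'])
    have "(\<lambda>n. cinner (cinner x (f n) *\<^sub>C f n) y) sums cinner x y"
      by (rule cinner_sums_left[OF orthonormal_expansion[OF f]])
    moreover have "cinner (g n) (U y) = cinner (f n) y" for n
      using U[of y n] cinner_commute by metis
    ultimately show "(\<lambda>n. cinner (cinner x (f n) *\<^sub>C g n) (U y)) sums cinner x y"
      by (simp add: cinner_scaleC_left)
  qed
  ultimately have "unitary U" by (simp add: unitary_def)
  moreover have "U (f n) = g n" for n
    by (rule eq) (use U f(1) g(1) in \<open>simp add: orthonormal_seq_def\<close>)
  ultimately show ?thesis using that by blast
qed

lemma ortho_proj_in: "csubspace W \<Longrightarrow> (\<And>i. i < n \<Longrightarrow> f i \<in> W) \<Longrightarrow> ortho_proj f n x \<in> W"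
  unfolding ortho_proj_def by (intro csubspace_sum complex_vector.subspace_scale) auto

section \<open>Extending orthonormal families by one vector\<close>

definition seminorm_on :: "'a::complex_inner set \<Rightarrow> ('a \<Rightarrow> real) \<Rightarrow> bool" where
  "seminorm_on W q \<longleftrightarrow> (\<forall>x\<in>W. \<forall>y\<in>W. q (x + y) \<le> q x + q y) \<and> (\<forall>c. \<forall>x\<in>W. q (c *\<^sub>C x) = cmod c * q x)"

lemma seminorm_on_diff_sum:
  assumes q: "seminorm_on W q" and W: "csubspace W" and "finite I" and "g \<in> W" "\<And>i. i \<in> I \<Longrightarrow> f i \<in> W"
  shows "q (g - (\<Sum>i\<in>I. c i *\<^sub>C f i)) \<le> q g + (\<Sum>i\<in>I. cmod (c i) * q (f i))"
  using assms(3,5)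
proof (induction I)
  case (insert i I)
  let ?h = "g - (\<Sum>i\<in>I. c i *\<^sub>C f i)"
  have h: "?h \<in> W" using assms insert 
    by (intro complex_vector.subspace_diff complex_vector.subspace_sum complex_vector.subspace_scale) auto
  have "g - (\<Sum>i\<in>insert i I. c i *\<^sub>C f i) = ?h + (- c i) *\<^sub>C f i"
    using insert by simp
  also have "q \<dots> \<le> q ?h + cmod (c i) * q (f i)"
    using q insert h W unfolding seminorm_on_def 
    by (metis complex_vector.subspace_scale insertI1 norm_minus_cancel)
  also have "q ?h \<le> q g + (\<Sum>i\<in>I. cmod (c i) * q (f i))" using insert by simp
  finally show ?case using insert by simp
qed simp

text \<open>
  If the \<open>g\<^sub>k\<close> are asymptotically orthogonal to the \<open>f\<^sub>i\<close>, then subtracting the projection onto the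
  span of the \<open>f\<^sub>i\<close> changes \<open>g\<^sub>k\<close> by a combination of fixed vectors with coefficients tending to zero.
  This neither destroys the smallness of the seminorms nor brings the norm close to zero, so
  normalising the difference is harmless.  The lemma serves both sides of the construction: with the
  given orthonormal sequence in the Hilbert space, and with wide bumps in \<open>L\<^sub>2\<close>.
\<close>
lemma small_orthogonal_vector:
  fixes f g :: "nat \<Rightarrow> 'a::complex_inner"
  assumes W: "csubspace W" and g: "\<And>k. g k \<in> W" "\<delta> > 0" "\<And>k. norm (g k) \<ge> \<delta>"
    and f: "orthonormal_below f n" "\<And>i. i < n \<Longrightarrow> f i \<in> W"
    and weak: "\<And>i. i < n \<Longrightarrow> (\<lambda>k. cinner (g k) (f i)) \<longlonglongrightarrow> 0"
    and Q: "finite Q" "\<And>q. q \<in> Q \<Longrightarrow> seminorm_on W q" "\<And>q. q \<in> Q \<Longrightarrow> (\<lambda>k. q (g k)) \<longlonglongrightarrow> 0"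
    and "\<epsilon> > 0"
  obtains w where "w \<in> W" "norm w = 1" "\<And>i. i < n \<Longrightarrow> cinner w (f i) = 0" "\<And>q. q \<in> Q \<Longrightarrow> q w < \<epsilon>"
proof -
  define v where "v k = g k - ortho_proj f n (g k)" for k
  have v: "v k \<in> W" for k
    unfolding v_def by (intro complex_vector.subspace_diff W g ortho_proj_in f)
  have lim: "(\<lambda>k. q (v k)) \<longlonglongrightarrow> 0" if q: "seminorm_on W q" "(\<lambda>k. q (g k)) \<longlonglongrightarrow> 0" for q
  proof (rule tendsto_sandwich[OF _ _ tendsto_const])
    have pos: "q x \<ge> 0" if "x \<in> W" for x
    proof -
      have "q (0 *\<^sub>C x) = 0" using q that unfolding seminorm_on_def by (metis norm_zero mult_zero_left)
      moreover have "q (x + (-1) *\<^sub>C x) \<le> q x + q x"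
        using q(1) that W unfolding seminorm_on_def
        by (metis complex_vector.subspace_scale mult_1 norm_minus_cancel norm_one)
      ultimately show ?thesis by simp
    qed
    show "\<forall>\<^sub>F k in sequentially. 0 \<le> q (v k)" using pos v by simp
    show "\<forall>\<^sub>F k in sequentially. q (v k) \<le> q (g k) + (\<Sum>i<n. cmod (cinner (g k) (f i)) * q (f i))"
      unfolding v_def ortho_proj_def using f by (intro always_eventually allI seminorm_on_diff_sum[OF q(1) W] g) auto
    have "(\<lambda>k. q (g k) + (\<Sum>i<n. cmod (cinner (g k) (f i)) * q (f i))) \<longlonglongrightarrow> 0 + (\<Sum>i<n. cmod 0 * q (f i))"
      by (intro tendsto_intros q weak) auto
    then show "(\<lambda>k. q (g k) + (\<Sum>i<n. cmod (cinner (g k) (f i)) * q (f i))) \<longlonglongrightarrow> 0" by simp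
  qed
  have "(\<lambda>k. ortho_proj f n (g k)) \<longlonglongrightarrow> (\<Sum>i<n. 0 *\<^sub>C f i)"
    unfolding ortho_proj_def by (intro tendsto_intros tendsto_scaleC weak) auto
  then have "(\<lambda>k. norm (ortho_proj f n (g k))) \<longlonglongrightarrow> 0" by (simp add: tendsto_norm_zero)
  then have "\<forall>\<^sub>F k in sequentially. norm (ortho_proj f n (g k)) < \<delta> / 2"
    using g(2) by (intro order_tendstoD) auto
  then have 1: "\<forall>\<^sub>F k in sequentially. norm (v k) \<ge> \<delta> / 2"
  proof eventually_elim
    case (elim k)
    then show ?case using norm_triangle_ineq2[of "g k" "ortho_proj f n (g k)"] g(3)[of k] by (simp add: v_def)
  qed
  have "\<forall>\<^sub>F k in sequentially. \<forall>q\<in>Q. q (v k) < \<epsilon> * (\<delta> / 2)"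
    using Q \<open>\<epsilon> > 0\<close> g(2) by (intro eventually_ball_finite ballI order_tendstoD(2)[OF lim]) auto
  with 1 have "\<forall>\<^sub>F k in sequentially. norm (v k) \<ge> \<delta> / 2 \<and> (\<forall>q\<in>Q. q (v k) < \<epsilon> * (\<delta> / 2))"
    by eventually_elim auto
  then obtain k where k: "norm (v k) \<ge> \<delta> / 2" "\<And>q. q \<in> Q \<Longrightarrow> q (v k) < \<epsilon> * (\<delta> / 2)"
    by (auto simp: eventually_sequentially)
  define c where "c = complex_of_real (1 / norm (v k))"
  have pos: "norm (v k) > 0" using k(1) g(2) by linarith
  show ?thesis
  proof
    show "c *\<^sub>C v k \<in> W" by (intro complex_vector.subspace_scale W v)
    show "norm (c *\<^sub>C v k) = 1" using pos unfolding zero_less_norm_iff by (simp add: norm_scaleC c_def norm_divide)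
    show "cinner (c *\<^sub>C v k) (f i) = 0" if "i < n" for i
      using that f by (simp add: cinner_simps v_def cinner_ortho_proj)
    show "q (c *\<^sub>C v k) < \<epsilon>" if "q \<in> Q" for q
    proof -
      have "q (c *\<^sub>C v k) = q (v k) / norm (v k)"
        using Q(2)[OF that] v pos by (simp add: seminorm_on_def c_def norm_divide)
      moreover have "\<epsilon> * (\<delta> / 2) \<le> \<epsilon> * norm (v k)"
        using k(1) \<open>\<epsilon> > 0\<close> by (intro mult_left_mono) auto
      ultimately show ?thesis
        using k(2)[OF that] pos_divide_less_eq[OF pos, of "q (v k)" \<epsilon>] by linarith
    qed
  qed
qed

text \<open>
  The vector \<open>w\<close> is the substitute for the case that \<open>d\<close> already lies in the span of the family.
\<close>
lemma Gram_Schmidt_step: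
  fixes f :: "nat \<Rightarrow> 'a::complex_inner"
  assumes W: "csubspace W" and f: "orthonormal_below f n" "\<And>i. i < n \<Longrightarrow> f i \<in> W" and d: "d \<in> W"
    and w: "w \<in> W" "norm w = 1" "\<And>i. i < n \<Longrightarrow> cinner w (f i) = 0"
  obtains v where "v \<in> W" "norm v = 1" "\<And>i. i < n \<Longrightarrow> cinner v (f i) = 0" 
    "d = ortho_proj f n d + cinner d v *\<^sub>C v"
proof (cases "d = ortho_proj f n d")
  case True
  have "cinner (ortho_proj f n d) w = (\<Sum>i<n. cinner d (f i) * cinner (f i) w)"
    unfolding ortho_proj_def by (simp add: cinner_simps)
  also have "\<dots> = 0"
    using w(3) by (intro sum.neutral) (simp add: cinner_eq_zero_commute[of "f _"])
  finally have "cinner d w = 0" using True by simp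
  with True w that[of w] show ?thesis by simp
next
  case False
  define r where "r = d - ortho_proj f n d"
  define c where "c = complex_of_real (1 / norm r)"
  have r: "r \<in> W" "norm r > 0"
    unfolding r_def using False by (auto intro!: complex_vector.subspace_diff W d ortho_proj_in f)
  have ro: "cinner r (f i) = 0" if "i < n" for i
    using that f by (simp add: r_def cinner_simps cinner_ortho_proj)
  have "cinner (ortho_proj f n d) r = (\<Sum>i<n. cinner d (f i) * cinner (f i) r)"
    unfolding ortho_proj_def by (simp add: cinner_simps)
  also have "\<dots> = 0"
    using ro by (intro sum.neutral) (simp add: cinner_eq_zero_commute[of "f _"])
  finally have "cinner (ortho_proj f n d + r) r = complex_of_real ((norm r)\<^sup>2)"
    by (simp add: cinner_add_left cinner_self)
  then have "cinner d r = complex_of_real ((norm r)\<^sup>2)" by (simp add: r_def)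
  then have "cinner d (c *\<^sub>C r) *\<^sub>C c *\<^sub>C r = r"
    using r by (simp add: cinner_scaleC_right scaleC_scaleC c_def scaleC_one power2_eq_square)
  moreover have "d = ortho_proj f n d + r" by (simp add: r_def)
  ultimately have "d = ortho_proj f n d + cinner d (c *\<^sub>C r) *\<^sub>C c *\<^sub>C r" by simp
  moreover have "norm (c *\<^sub>C r) = 1" using r by (simp add: norm_scaleC c_def norm_divide)
  moreover have "c *\<^sub>C r \<in> W" by (intro complex_vector.subspace_scale W r)
  ultimately show ?thesis using that[of "c *\<^sub>C r"] ro by (simp add: cinner_scaleC_left)
qed

section \<open>Adjoints of closed operators\<close>

text \<open>
  The parallelogram law makes every sequence in \<open>M\<close> that minimises the distance to \<open>x\<close> a Cauchy
  sequence; its limit is the projection.  A real inner product suffices, which allows the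
  application to the product type that contains the graph of an operator.
\<close>
lemma closed_subspace_projection:
  fixes M :: "'a::{real_inner,complete_space} set"
  assumes M: "closed M" "subspace M"
  obtains p where "p \<in> M" "\<And>m. m \<in> M \<Longrightarrow> inner (x - p) m = 0"
proof -
  define d where "d = (INF m\<in>M. norm (x - m))"
  have M0: "M \<noteq> {}" using subspace_0[OF M(2)] by auto
  have bdd: "bdd_below ((\<lambda>m. norm (x - m)) ` M)" by (rule bdd_belowI2[of _ 0]) simp
  have dle: "d \<le> norm (x - m)" if "m \<in> M" for m
    unfolding d_def by (rule cINF_lower[OF bdd that])
  have d0: "d \<ge> 0" unfolding d_def by (rule cINF_greatest[OF M0]) simp
  have "\<exists>m\<in>M. norm (x - m) < d + 1 / Suc n" for n
    using cINF_less_iff[OF M0 bdd, of "d + 1 / Suc n"] unfolding d_def by simp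
  then obtain s where s: "\<And>n. s n \<in> M" "\<And>n. norm (x - s n) < d + 1 / Suc n" by metis
  have par: "(norm (a - b))\<^sup>2 \<le> 2 * (norm (x - a))\<^sup>2 + 2 * (norm (x - b))\<^sup>2 - 4 * d\<^sup>2" 
    if "a \<in> M" "b \<in> M" for a b
  proof -
    have "d \<le> norm (x - (1/2) *\<^sub>R (a + b))"
      by (intro dle subspace_scale subspace_add M that)
    then have "d\<^sup>2 \<le> (norm (x - (1/2) *\<^sub>R (a + b)))\<^sup>2" using d0 by (rule power_mono)
    then show ?thesis
      by (simp add: power2_norm_eq_inner inner_diff inner_add inner_commute algebra_simps)
  qed
  have lim: "(\<lambda>n. d + 1 / Suc n) \<longlonglongrightarrow> d + 0" 
    by (intro tendsto_intros LIMSEQ_Suc[OF lim_1_over_n])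
  have normlim: "(\<lambda>n. norm (x - s n)) \<longlonglongrightarrow> d"
  proof (rule tendsto_sandwich[OF _ _ tendsto_const])
    show "(\<lambda>n. d + 1 / Suc n) \<longlonglongrightarrow> d" using lim by simp
    show "\<forall>\<^sub>F n in sequentially. d \<le> norm (x - s n)" using dle s(1) by simp
    show "\<forall>\<^sub>F n in sequentially. norm (x - s n) \<le> d + 1 / Suc n"
      using s(2) by (intro always_eventually allI less_imp_le)
  qed
  have "Cauchy s"
  proof (rule metric_CauchyI)
    fix e :: real assume "e > 0"
    have "(\<lambda>n. (norm (x - s n))\<^sup>2) \<longlonglongrightarrow> d\<^sup>2" by (intro tendsto_power normlim)
    moreover have "d\<^sup>2 < d\<^sup>2 + e\<^sup>2 / 4" using \<open>e > 0\<close> by simp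
    ultimately have "\<forall>\<^sub>F n in sequentially. (norm (x - s n))\<^sup>2 < d\<^sup>2 + e\<^sup>2 / 4"
      by (rule order_tendstoD)
    then obtain N where N: "\<And>n. n \<ge> N \<Longrightarrow> (norm (x - s n))\<^sup>2 < d\<^sup>2 + e\<^sup>2 / 4"
      by (auto simp: eventually_sequentially)
    have "dist (s m) (s n) < e" if "m \<ge> N" "n \<ge> N" for m n
    proof -
      have "(norm (s m - s n))\<^sup>2 < e\<^sup>2"
        using par[OF s(1) s(1), of m n] N[OF that(1)] N[OF that(2)] by (simp add: field_simps)
      then show ?thesis using \<open>e > 0\<close> by (simp add: dist_norm power2_less_imp_less)
    qed
    then show "\<exists>N. \<forall>m\<ge>N. \<forall>n\<ge>N. dist (s m) (s n) < e" by blast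
  qed
  then obtain p where p: "s \<longlonglongrightarrow> p" using Cauchy_convergent convergent_def by blast
  have pM: "p \<in> M" using closed_sequentially[OF M(1) _ p] s(1) by blast
  have "(\<lambda>n. norm (x - s n)) \<longlonglongrightarrow> norm (x - p)" by (intro tendsto_intros p)
  then have pd: "norm (x - p) = d" using normlim LIMSEQ_unique by blast
  have "inner (x - p) m = 0" if m: "m \<in> M" for m
  proof (cases "m = 0")
    case False
    define t where "t = inner (x - p) m / inner m m"
    have "d \<le> norm (x - (p + t *\<^sub>R m))"
      by (intro dle subspace_add subspace_scale M pM m)
    then have "d\<^sup>2 \<le> (norm ((x - p) - t *\<^sub>R m))\<^sup>2" 
      using d0 by (metis diff_diff_eq power_mono)
    also have "\<dots> = d\<^sup>2 - (inner (x - p) m)\<^sup>2 / inner m m"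
    proof -
      have "(norm (v - t *\<^sub>R m))\<^sup>2 = (norm v)\<^sup>2 - 2 * t * inner v m + t * t * inner m m" for v
        by (simp add: power2_norm_eq_inner inner_diff inner_commute algebra_simps)
      moreover have "t * inner m m = inner (x - p) m" using False by (simp add: t_def)
      ultimately show ?thesis
        unfolding pd[symmetric] by (simp add: t_def power2_eq_square)
    qed
    finally have "(inner (x - p) m)\<^sup>2 / inner m m \<le> 0" by simp
    moreover have "inner m m > 0" using False by simp
    ultimately show ?thesis by (simp add: divide_le_0_iff)
  qed simp
  with pM show ?thesis using that by blast
qed

lemma adj_eq:
  fixes S :: "'a::complex_inner \<Rightarrow> 'b::complex_inner"
  assumes D: "densely_defined D" and y: "y \<in> adj_domain D S" and x: "x \<in> D"
  shows "cinner (S x) y = cinner x (adj D S y)"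
proof -
  obtain z where z: "\<forall>x\<in>D. cinner (S x) y = cinner x z" using y by (auto simp: adj_domain_def)
  have "z' = z" if z': "\<forall>x\<in>D. cinner (S x) y = cinner x z'" for z'
  proof -
    have "closed {x. cinner x (z - z') = 0}"
      by (intro closed_Collect_eq continuous_intros
        linear_continuous_on[OF bounded_bilinear.bounded_linear_left[OF bounded_bilinear_cinner]])
    moreover have "D \<subseteq> {x. cinner x (z - z') = 0}" using z z' by (auto simp: cinner_simps)
    ultimately have "closure D \<subseteq> {x. cinner x (z - z') = 0}" by (rule closure_minimal[rotated])
    then have "cinner (z - z') (z - z') = 0" using D by (auto simp: densely_defined_def)
    then show ?thesis by (simp add: cinner_self)
  qed
  then have "adj D S y = z" unfolding adj_def using z by (intro the_equality) auto
  then show ?thesis using z x by simp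
qed

lemma adj_eqI:
  fixes S :: "'a::complex_inner \<Rightarrow> 'b::complex_inner"
  assumes D: "densely_defined D" and z: "\<And>x. x \<in> D \<Longrightarrow> cinner (S x) y = cinner x z"
  shows "y \<in> adj_domain D S" "adj D S y = z"
proof -
  show y: "y \<in> adj_domain D S" using z by (auto simp: adj_domain_def)
  have "closed {x. cinner x (adj D S y - z) = 0}"
    by (intro closed_Collect_eq continuous_intros
        linear_continuous_on[OF bounded_bilinear.bounded_linear_left[OF bounded_bilinear_cinner]])
  moreover have "D \<subseteq> {x. cinner x (adj D S y - z) = 0}" 
    using z adj_eq[OF D y] by (auto simp: cinner_simps)
  ultimately have "closure D \<subseteq> {x. cinner x (adj D S y - z) = 0}" by (rule closure_minimal[rotated])
  then have "cinner (adj D S y - z) (adj D S y - z) = 0" using D by (auto simp: densely_defined_def)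
  then show "adj D S y = z" by (simp add: cinner_self)
qed

lemma linear_operator_adj:
  fixes S :: "'a::complex_inner \<Rightarrow> 'b::complex_inner"
  assumes D: "densely_defined D"
  shows "linear_operator (adj_domain D S) (adj D S)"
proof -
  note e = adj_eq[OF D]
  have add: "x + y \<in> adj_domain D S \<and> adj D S (x + y) = adj D S x + adj D S y"
    if "x \<in> adj_domain D S" "y \<in> adj_domain D S" for x y
    using adj_eqI[OF D, of S "x + y" "adj D S x + adj D S y"] that by (simp add: cinner_simps e)
  have scale: "c *\<^sub>C x \<in> adj_domain D S \<and> adj D S (c *\<^sub>C x) = c *\<^sub>C adj D S x"
    if "x \<in> adj_domain D S" for x c
    using adj_eqI[OF D, of S "c *\<^sub>C x" "c *\<^sub>C adj D S x"] that by (simp add: cinner_simps e)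
  have "0 \<in> adj_domain D S"
    using adj_eqI[OF D, of S 0 0] by (simp add: cinner_simps)
  then show ?thesis
    using add scale by (auto simp: linear_operator_def complex_vector.subspace_def)
qed

text \<open>
  A vector \<open>(a, b)\<close> is orthogonal to the graph of \<open>S\<close> exactly when \<open>b\<close> lies in the domain of the
  adjoint and is mapped to \<open>-a\<close>.  If \<open>y\<close> is orthogonal to this domain, then \<open>(0, y)\<close> is orthogonal to
  the orthogonal complement of the graph; the graph being closed, it contains \<open>(0, y)\<close>, that is,
  \<open>y = S 0 = 0\<close>.
\<close>
lemma adj_domain_total:
  fixes S :: "'a::chilbert_space \<Rightarrow> 'b::chilbert_space"
  assumes lin: "linear_operator D S" and cl: "closed_operator D S" and D: "densely_defined D"
    and y: "\<And>b. b \<in> adj_domain D S \<Longrightarrow> cinner y b = 0"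
  shows "y = 0"
proof -
  define G where "G = {(x, S x) | x. x \<in> D}"
  have S0: "0 \<in> D" "S 0 = 0"
  proof -
    show "0 \<in> D" using lin by (auto simp: linear_operator_def complex_vector.subspace_def)
    then have "S (0 *\<^sub>C 0) = 0 *\<^sub>C S 0" using lin unfolding linear_operator_def by blast
    then show "S 0 = 0" by simp
  qed
  have G: "closed G" "subspace G"
  proof -
    show "closed G" using cl by (simp add: closed_operator_def G_def)
    show "subspace G"
      using lin S0 unfolding subspace_def G_def linear_operator_def complex_vector.subspace_def
      by (auto simp: scaleR_scaleC zero_prod_def)
  qed
  obtain p where p: "p \<in> G" "\<And>m. m \<in> G \<Longrightarrow> inner ((0, y) - p) m = 0"
    using closed_subspace_projection[OF G] by metis
  obtain a b where ab: "(0, y) - p = (a, b)" by (cases "(0, y) - p")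
  have re: "Re (cinner a x) + Re (cinner b (S x)) = 0" if "x \<in> D" for x
  proof -
    have "(x, S x) \<in> G" using that by (auto simp: G_def)
    from p(2)[OF this] show ?thesis by (simp add: ab inner_eq_Re_cinner)
  qed
  \<comment> \<open>The projection only gives real orthogonality; the imaginary part follows by testing with \<open>\<i> x\<close>.\<close>
  have c0: "cinner a x + cinner b (S x) = 0" if "x \<in> D" for x
  proof -
    have "\<i> *\<^sub>C x \<in> D" "S (\<i> *\<^sub>C x) = \<i> *\<^sub>C S x"
      using lin that by (auto simp: linear_operator_def complex_vector.subspace_def)
    with re[of "\<i> *\<^sub>C x"] have "Im (cinner a x) + Im (cinner b (S x)) = 0"
      by (simp add: cinner_scaleC_right)
    with re[OF that] show ?thesis by (simp add: complex_eq_iff)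
  qed
  have "cinner (S x) b = cinner x (- a)" if "x \<in> D" for x
  proof -
    have "cinner b (S x) = - cinner a x" using c0[OF that] by (simp add: add_eq_0_iff)
    then have "cnj (cinner b (S x)) = cnj (- cinner a x)" by simp
    then show ?thesis by (simp add: cinner_simps flip: cinner_commute)
  qed
  then have "b \<in> adj_domain D S" by (rule adj_eqI[OF D])
  then have "cinner y b = 0" by (rule y)
  then have "inner (a, b) (0, y) = 0"
    by (metis inner_commute inner_eq_Re_cinner inner_Pair inner_zero_left add_0 zero_complex.sel(1))
  moreover have "inner (a, b) p = 0" using p(2)[OF p(1)] by (simp add: ab)
  ultimately have "inner (a, b) ((0, y) - p) = 0" by (simp only: inner_diff_right)
  then have "(0, y) = p" by (simp add: ab[symmetric])
  then have "(0, y) \<in> G" using p(1) by simp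
  then show ?thesis using S0(2) by (auto simp: G_def)
qed

lemma separable_subset:
  fixes W :: "'a::metric_space set"
  assumes "separable_space (euclidean :: 'a topology)"
  obtains C where "countable C" "C \<subseteq> W" "W \<subseteq> closure C"
proof -
  obtain B :: "'a set" where B: "countable B" "closure B = UNIV"
    using assms by (auto simp: separable_space_def)
  define P where "P b n x \<longleftrightarrow> x \<in> W \<and> dist b x < 1 / Suc n" for b x and n :: nat
  define C where "C = (\<lambda>(b, n). SOME x. P b n x) ` {(b, n). b \<in> B \<and> (\<exists>x. P b n x)}"
  show ?thesis
  proof
    have "{(b, n). b \<in> B \<and> (\<exists>x. P b n x)} \<subseteq> B \<times> UNIV" by auto
    then show "countable C"
      unfolding C_def using B(1) by (intro countable_image) (rule countable_subset, auto)
    have "(SOME x. P b n x) \<in> W" if "\<exists>x. P b n x" for b n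
      using someI_ex[OF that] by (simp add: P_def)
    then show "C \<subseteq> W" unfolding C_def by auto
    show "W \<subseteq> closure C"
    proof
      fix x assume x: "x \<in> W"
      show "x \<in> closure C"
        unfolding closure_approachable
      proof (intro allI impI)
        fix e :: real assume "e > 0"
        then obtain n where n: "1 / Suc n < e / 2" using nat_approx_posE[of "e/2"] by auto
        obtain b where b: "b \<in> B" "dist b x < 1 / Suc n"
          using B(2) closure_approachable[of x B] by (metis UNIV_I divide_pos_pos of_nat_0_less_iff zero_less_Suc zero_less_one)
        then have ex: "\<exists>x. P b n x" using x by (auto simp: P_def)
        define z where "z = (SOME x. P b n x)"
        have "P b n z" unfolding z_def by (rule someI_ex[OF ex])
        moreover have "z \<in> C" unfolding C_def z_def using b ex by auto
        ultimately show "\<exists>z\<in>C. dist z x < e"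
          using dist_triangle[of z x b] b(2) n by (intro bexI[of _ z]) (auto simp: P_def dist_commute)
      qed
    qed
  qed
qed

lemma countable_total_subset:
  fixes W :: "'a::complex_inner set"
  assumes sep: "separable_space (euclidean :: 'a topology)" and W: "csubspace W"
    and tot: "\<And>y. (\<And>b. b \<in> W \<Longrightarrow> cinner y b = 0) \<Longrightarrow> y = 0"
  obtains d :: "nat \<Rightarrow> 'a" where "\<And>n. d n \<in> W" "total_seq d"
proof -
  obtain C where C: "countable C" "C \<subseteq> W" "W \<subseteq> closure C" using separable_subset[OF sep] by metis
  have "0 \<in> W" using W by (rule complex_vector.subspace_0)
  then have "C \<noteq> {}" using C by auto
  have rng: "range (from_nat_into C) = C" by (rule range_from_nat_into[OF \<open>C \<noteq> {}\<close> C(1)])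
  have "total_seq (from_nat_into C)"
    unfolding total_seq_def
  proof (intro allI impI)
    fix y assume y: "\<forall>n. cinner y (from_nat_into C n) = 0"
    have "closed {x. cinner y x = 0}"
      by (intro closed_Collect_eq continuous_intros
          linear_continuous_on[OF bounded_bilinear.bounded_linear_right[OF bounded_bilinear_cinner]])
    moreover have "C \<subseteq> {x. cinner y x = 0}" using y rng by (auto simp: image_iff) (metis rangeE)
    ultimately have "closure C \<subseteq> {x. cinner y x = 0}" by (rule closure_minimal[rotated])
    then show "y = 0" using C(3) by (intro tot) auto
  qed
  moreover have "from_nat_into C n \<in> W" for n using rng C by blast
  ultimately show ?thesis using that by blast
qed

section \<open>Completeness of \<open>L\<^sub>2\<close>\<close>

lemma square_integrable_diff:
  "square_integrable f \<Longrightarrow> square_integrable g \<Longrightarrow> square_integrable (\<lambda>x. f x - g x)"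
  using square_integrable_add[OF _ square_integrable_scale[of g "-1"], of f] by simp

lemma square_integrable_sum:
  "finite I \<Longrightarrow> (\<And>i. i \<in> I \<Longrightarrow> square_integrable (f i)) \<Longrightarrow> square_integrable (\<lambda>x. \<Sum>i\<in>I. f i x)"
  by (induction I rule: finite_induct) (auto intro: square_integrable_add)

lemma square_integrable_cnj:
  assumes "square_integrable f"
  shows "square_integrable (\<lambda>x. cnj (f x))"
proof -
  have "cnj \<in> borel_measurable borel"
    by (intro borel_measurable_continuous_onI continuous_intros)
  then have "(\<lambda>x. cnj (f x)) \<in> borel_measurable lebesgue"
    using assms square_integrable_measurable measurable_compose by blast
  then show ?thesis using assms by (simp add: square_integrable_def)
qed

lemma square_integrable_rep_L2: "square_integrable (rep_L2 f)"
  using Quotient_rep_reflp[OF Quotient_L2] by simp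

lemma abs_rep_L2 [simp]: "abs_L2 (rep_L2 f) = f"
  by (rule Quotient_abs_rep[OF Quotient_L2])

lemma abs_L2_eq_iff:
  assumes "square_integrable f" "square_integrable g"
  shows "abs_L2 f = abs_L2 g \<longleftrightarrow> (AE x in lebesgue. f x = g x)"
  using Quotient_rel[OF Quotient_L2, of f g] assms by (simp add: L2_rel_def)

lemma rep_abs_L2: "square_integrable f \<Longrightarrow> AE x in lebesgue. rep_L2 (abs_L2 f) x = f x"
  by (subst abs_L2_eq_iff[symmetric]) (auto simp: square_integrable_rep_L2)

lemma cinner_abs_L2:
  "square_integrable f \<Longrightarrow> square_integrable g \<Longrightarrow>
    cinner (abs_L2 f) (abs_L2 g) = (LINT x|lebesgue. f x * cnj (g x))"
  by (simp add: cinner_L2.abs_eq)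

lemma add_abs_L2:
  "square_integrable f \<Longrightarrow> square_integrable g \<Longrightarrow> abs_L2 f + abs_L2 g = abs_L2 (\<lambda>x. f x + g x)"
  by (simp add: plus_L2.abs_eq)

lemma scaleC_abs_L2: "square_integrable f \<Longrightarrow> c *\<^sub>C abs_L2 f = abs_L2 (\<lambda>x. c * f x)"
  by (simp add: scaleC_L2.abs_eq)

lemma diff_abs_L2:
  assumes "square_integrable f" "square_integrable g" 
  shows "abs_L2 f - abs_L2 g = abs_L2 (\<lambda>x. f x - g x)"
proof -
  have "abs_L2 f - abs_L2 g = abs_L2 f + abs_L2 (\<lambda>x. (-1) * g x)"
    unfolding minus_L2_def uminus_L2_def scaleC_abs_L2[OF assms(2)] ..
  also have "\<dots> = abs_L2 (\<lambda>x. f x + (-1) * g x)"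
    by (rule add_abs_L2[OF assms(1) square_integrable_scale[OF assms(2)]])
  finally show ?thesis by simp
qed

lemma sum_abs_L2:
  assumes "finite I" "\<And>i. i \<in> I \<Longrightarrow> square_integrable (f i)"
  shows "(\<Sum>i\<in>I. abs_L2 (f i)) = abs_L2 (\<lambda>x. \<Sum>i\<in>I. f i x)"
  using assms
proof (induction I rule: finite_induct)
  case empty
  then show ?case by (simp add: zero_L2_def)
qed (simp add: add_abs_L2 square_integrable_sum)

lemma norm_abs_L2: 
  assumes "square_integrable f"
  shows "(norm (abs_L2 f))\<^sup>2 = (LINT x|lebesgue. (cmod (f x))\<^sup>2)"
proof -
  have "complex_of_real ((norm (abs_L2 f))\<^sup>2) = (LINT x|lebesgue. f x * cnj (f x))"
    using assms by (simp only: cinner_self[symmetric] cinner_abs_L2)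
  also have "\<dots> = complex_of_real (LINT x|lebesgue. (cmod (f x))\<^sup>2)"
    unfolding complex_norm_square[symmetric] by (rule integral_complex_of_real)
  finally show ?thesis using of_real_eq_iff by blast
qed

lemma nn_integral_square:
  assumes "square_integrable f"
  shows "(\<integral>\<^sup>+x. ennreal ((cmod (f x))\<^sup>2) \<partial>lebesgue) = ennreal ((norm (abs_L2 f))\<^sup>2)"
  unfolding norm_abs_L2[OF assms] using assms
  by (intro nn_integral_eq_integral) (auto simp: square_integrable_def)

lemma square_integrableI_nn:
  assumes "f \<in> borel_measurable lebesgue" "(\<integral>\<^sup>+x. ennreal ((cmod (f x))\<^sup>2) \<partial>lebesgue) < \<infinity>"
  shows "square_integrable f"
  using assms unfolding square_integrable_def by (auto intro!: integrableI_nonneg)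

lemma Fatou_L2:
  assumes F: "\<And>k. square_integrable (F k)" and f: "square_integrable f"
    and h: "h \<in> borel_measurable lebesgue" "AE x in lebesgue. (\<lambda>k. F k x) \<longlonglongrightarrow> h x"
    and B: "\<forall>\<^sub>F k in sequentially. norm (abs_L2 (F k) - abs_L2 f) \<le> B"
  shows "square_integrable h \<and> norm (abs_L2 h - abs_L2 f) \<le> B"
proof -
  have Fm [measurable]: "F k \<in> borel_measurable lebesgue" for k using F by (rule square_integrable_measurable)
  have fm [measurable]: "f \<in> borel_measurable lebesgue" using f by (rule square_integrable_measurable)
  note h(1) [measurable]
  have B0: "B \<ge> 0" using eventually_happens'[OF _ B] norm_ge_zero by (meson order_trans sequentially_bot)
  have "(\<integral>\<^sup>+x. ennreal ((cmod (h x - f x))\<^sup>2) \<partial>lebesgue)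
      = (\<integral>\<^sup>+x. liminf (\<lambda>k. ennreal ((cmod (F k x - f x))\<^sup>2)) \<partial>lebesgue)"
  proof (rule nn_integral_cong_AE)
    show "AE x in lebesgue. ennreal ((cmod (h x - f x))\<^sup>2) = liminf (\<lambda>k. ennreal ((cmod (F k x - f x))\<^sup>2))"
      using h(2)
    proof eventually_elim
      case (elim x)
      have "(\<lambda>k. ennreal ((cmod (F k x - f x))\<^sup>2)) \<longlonglongrightarrow> ennreal ((cmod (h x - f x))\<^sup>2)"
        by (intro tendsto_intros elim)
      then show ?case by (rule lim_imp_Liminf[OF sequentially_bot, symmetric])
    qed
  qed
  also have "\<dots> \<le> liminf (\<lambda>k. \<integral>\<^sup>+x. ennreal ((cmod (F k x - f x))\<^sup>2) \<partial>lebesgue)"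
    by (rule nn_integral_liminf) measurable
  also have "\<dots> \<le> liminf (\<lambda>k. ennreal (B\<^sup>2))"
  proof (rule Liminf_mono)
    show "\<forall>\<^sub>F k in sequentially. (\<integral>\<^sup>+x. ennreal ((cmod (F k x - f x))\<^sup>2) \<partial>lebesgue) \<le> ennreal (B\<^sup>2)"
      using B
    proof eventually_elim
      case (elim k)
      then show ?case
        by (subst nn_integral_square) 
          (auto simp: diff_abs_L2[OF F f] intro!: square_integrable_diff F f ennreal_leI power_mono)
    qed
  qed
  also have "\<dots> = ennreal (B\<^sup>2)" by (simp add: Liminf_const)
  finally have le: "(\<integral>\<^sup>+x. ennreal ((cmod (h x - f x))\<^sup>2) \<partial>lebesgue) \<le> ennreal (B\<^sup>2)" .
  have hf: "square_integrable (\<lambda>x. h x - f x)"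
  proof (rule square_integrableI_nn)
    show "(\<integral>\<^sup>+x. ennreal ((cmod (h x - f x))\<^sup>2) \<partial>lebesgue) < \<infinity>" by (rule le_less_trans[OF le]) simp
  qed measurable
  have sq: "square_integrable h"
    using square_integrable_add[OF hf f] by simp
  moreover have "(norm (abs_L2 h - abs_L2 f))\<^sup>2 \<le> B\<^sup>2"
    using le unfolding nn_integral_square[OF hf] diff_abs_L2[OF sq f] by simp
  ultimately show ?thesis using B0 power2_le_imp_le by blast
qed

text \<open>
  Mean square limits and pointwise limits agree, by Fatou's lemma.  This is what identifies the
  pointwise sums that define the kernel with sums in \<open>L\<^sub>2\<close>.
\<close>
lemma L2_pointwise_limit:
  assumes F: "\<And>k. square_integrable (F k)" and lim: "(\<lambda>k. abs_L2 (F k)) \<longlonglongrightarrow> f"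
    and h: "AE x in lebesgue. (\<lambda>k. F k x) \<longlonglongrightarrow> h x" "h \<in> borel_measurable lebesgue"
  shows "square_integrable h \<and> abs_L2 h = f"
proof -
  have B: "square_integrable h \<and> norm (abs_L2 h - f) \<le> e" if "e > 0" for e
  proof -
    have "\<forall>\<^sub>F k in sequentially. norm (abs_L2 (F k) - abs_L2 (rep_L2 f)) \<le> e"
      using tendstoD[OF lim that] by eventually_elim (simp add: dist_norm)
    from Fatou_L2[OF F square_integrable_rep_L2 h(2,1) this] show ?thesis by simp
  qed
  have "norm (abs_L2 h - f) \<le> 0"
    by (rule field_le_epsilon) (use B in simp)
  with B[of 1] show ?thesis by simp
qed

text \<open>
  With \<open>d\<^sub>k\<close> for the successive differences, \<open>\<Sum>\<^sub>k 2\<^sup>k |d\<^sub>k|\<^sup>2\<close> has a finite integral and is therefore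
  finite almost everywhere.  By \<open>|d\<^sub>k| \<le> 2\<^sup>k |d\<^sub>k|\<^sup>2 + 2\<^sup>-\<^sup>k\<close> the differences are then absolutely
  summable; the weight \<open>2\<^sup>k\<close> takes the place of Minkowski's inequality for infinite sums.
\<close>
lemma L2_fast_Cauchy_AE:
  assumes G: "\<And>k. square_integrable (G k)"
    and fast: "\<And>k. (norm (abs_L2 (G (Suc k)) - abs_L2 (G k)))\<^sup>2 \<le> (1/8) ^ k"
  shows "AE x in lebesgue. convergent (\<lambda>k. G k x)"
proof -
  define d where "d k x = G (Suc k) x - G k x" for k x
  have d: "square_integrable (d k)" for k unfolding d_def by (intro square_integrable_diff G)
  have [measurable]: "d k \<in> borel_measurable lebesgue" for k using d by (rule square_integrable_measurable)
  have "(\<integral>\<^sup>+x. (\<Sum>k. ennreal (2 ^ k * (cmod (d k x))\<^sup>2)) \<partial>lebesgue)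
     = (\<Sum>k. \<integral>\<^sup>+x. ennreal (2 ^ k * (cmod (d k x))\<^sup>2) \<partial>lebesgue)"
    by (intro nn_integral_suminf) measurable
  also have "\<dots> \<le> (\<Sum>k. ennreal ((1/4) ^ k))"
  proof (intro suminf_le summableI)
    fix k
    have "(\<integral>\<^sup>+x. ennreal (2 ^ k * (cmod (d k x))\<^sup>2) \<partial>lebesgue) = ennreal (2 ^ k) * (\<integral>\<^sup>+x. ennreal ((cmod (d k x))\<^sup>2) \<partial>lebesgue)"
      by (subst nn_integral_cmult[symmetric]) (auto simp: ennreal_mult)
    also have "\<dots> = ennreal (2 ^ k * (norm (abs_L2 (G (Suc k)) - abs_L2 (G k)))\<^sup>2)"
    proof -
      have "d k = (\<lambda>x. G (Suc k) x - G k x)" by (simp add: d_def fun_eq_iff)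
      then show ?thesis
        using nn_integral_square[OF d, of k] unfolding diff_abs_L2[OF G G] by (simp add: ennreal_mult)
    qed
    also have "\<dots> \<le> ennreal (2 ^ k * (1/8) ^ k)"
      by (intro ennreal_leI mult_left_mono fast) auto
    also have "2 ^ k * (1/8) ^ k = ((1/4) ^ k :: real)" by (simp flip: power_mult_distrib)
    finally show "(\<integral>\<^sup>+x. ennreal (2 ^ k * (cmod (d k x))\<^sup>2) \<partial>lebesgue) \<le> ennreal ((1/4) ^ k)" .
  qed
  also have "\<dots> = ennreal (\<Sum>k. (1/4) ^ k)"
    by (intro suminf_ennreal2) auto
  finally have "(\<integral>\<^sup>+x. (\<Sum>k. ennreal (2 ^ k * (cmod (d k x))\<^sup>2)) \<partial>lebesgue) \<noteq> \<infinity>"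
    by (auto simp: top_unique)
  then have "AE x in lebesgue. (\<Sum>k. ennreal (2 ^ k * (cmod (d k x))\<^sup>2)) \<noteq> \<infinity>"
    by (intro nn_integral_PInf_AE) measurable
  then show ?thesis
  proof eventually_elim
    case (elim x)
    have s: "summable (\<lambda>k. 2 ^ k * (cmod (d k x))\<^sup>2)"
      using elim by (intro summable_suminf_not_top) auto
    have "summable (\<lambda>k. cmod (d k x))"
    proof (rule summable_comparison_test')
      show "summable (\<lambda>k. 2 ^ k * (cmod (d k x))\<^sup>2 + (1/2) ^ k)"
        by (intro summable_add s) simp
      show "norm (cmod (d k x)) \<le> 2 ^ k * (cmod (d k x))\<^sup>2 + (1/2) ^ k" if "k \<ge> 0" for k
      proof -
        have "2 * (2 ^ k * cmod (d k x)) * 1 \<le> (2 ^ k * cmod (d k x))\<^sup>2 + 1\<^sup>2"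
          by (rule sum_squares_bound)
        then have "2 ^ k * cmod (d k x) \<le> (2 ^ k * cmod (d k x))\<^sup>2 + 1"
          by (smt (verit) mult_nonneg_nonneg norm_ge_zero one_power2 zero_le_power)
        also have "\<dots> = 2 ^ k * (2 ^ k * (cmod (d k x))\<^sup>2 + (1/2) ^ k)"
          by (simp add: field_simps power2_eq_square power_one_over)
        finally show ?thesis by simp
      qed
    qed
    then have "summable (\<lambda>k. d k x)" by (rule summable_norm_cancel)
    then have "convergent (\<lambda>n. \<Sum>k<n. d k x)" by (simp add: summable_iff_convergent)
    then have "convergent (\<lambda>n. (\<Sum>k<n. d k x) + G 0 x)" by (intro convergent_add convergent_const)
    moreover have "(\<Sum>k<n. d k x) + G 0 x = G n x" for n
      unfolding d_def by (subst sum_lessThan_telescope) simp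
    ultimately show ?case by simp
  qed
qed

text \<open>
  Riesz and Fischer: a rapidly convergent subsequence has a pointwise limit almost everywhere, and
  Fatou's lemma shows that this function is also the limit in the norm.
\<close>
instance L2 :: complete_space
proof
  fix X :: "nat \<Rightarrow> L2" assume X: "Cauchy X"
  have "\<exists>N. \<forall>m\<ge>N. \<forall>n\<ge>N. (norm (X m - X n))\<^sup>2 < (1/8) ^ k" for k :: nat
  proof -
    obtain N where N: "\<And>m n. m \<ge> N \<Longrightarrow> n \<ge> N \<Longrightarrow> norm (X m - X n) < sqrt ((1/8) ^ k)"
      using CauchyD[OF X, of "sqrt ((1/8)^k)"] by auto
    have "(norm (X m - X n))\<^sup>2 < (1/8) ^ k" if "m \<ge> N" "n \<ge> N" for m n
      using power_strict_mono[OF N[OF that], of 2] by simp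
    then show ?thesis by blast
  qed
  \<comment> \<open>The rate \<open>8\<^sup>-\<^sup>k\<close> for the squares is what the pointwise lemma above asks of the subsequence.\<close>
  then obtain N where N: "\<And>k m n. m \<ge> N k \<Longrightarrow> n \<ge> N k \<Longrightarrow> (norm (X m - X n))\<^sup>2 < (1/8) ^ k" by metis
  define r where "r k = (\<Sum>i\<le>k. N i) + k" for k
  have r: "r k \<ge> N k" "r (Suc k) \<ge> r k" "r k \<ge> k" for k
    using member_le_sum[of k "{..k}" N] by (auto simp: r_def)
  define G where "G k = rep_L2 (X (r k))" for k
  have G: "square_integrable (G k)" for k unfolding G_def by (rule square_integrable_rep_L2)
  have "(norm (abs_L2 (G (Suc k)) - abs_L2 (G k)))\<^sup>2 \<le> (1/8) ^ k" for k
    using N[of k "r (Suc k)" "r k"] r(1)[of k] r(2)[of k] by (simp add: G_def)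
  from L2_fast_Cauchy_AE[OF G this] have conv: "AE x in lebesgue. convergent (\<lambda>k. G k x)" .
  have [measurable]: "G k \<in> borel_measurable lebesgue" for k using G by (rule square_integrable_measurable)
  define h where "h x = lim (\<lambda>k. G k x)" for x
  have h: "h \<in> borel_measurable lebesgue" unfolding h_def by measurable
  have lim: "AE x in lebesgue. (\<lambda>k. G k x) \<longlonglongrightarrow> h x"
    using conv by eventually_elim (simp add: h_def convergent_LIMSEQ_iff)
  have "X \<longlonglongrightarrow> abs_L2 h"
  proof (rule metric_LIMSEQ_I)
    fix e :: real assume e: "e > 0"
    obtain M where M: "\<And>m n. m \<ge> M \<Longrightarrow> n \<ge> M \<Longrightarrow> norm (X m - X n) < e / 2"
      using CauchyD[OF X, of "e/2"] e by auto
    have "dist (X n) (abs_L2 h) < e" if n: "n \<ge> M" for n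
    proof -
      have "\<forall>\<^sub>F k in sequentially. norm (abs_L2 (G k) - abs_L2 (rep_L2 (X n))) \<le> e / 2"
        using eventually_ge_at_top[of M]
      proof eventually_elim
        case (elim k)
        then show ?case using M[of "r k" n] n r(3)[of k] by (simp add: G_def)
      qed
      from Fatou_L2[OF G square_integrable_rep_L2 h lim this]
      show ?thesis using e by (simp add: dist_norm norm_minus_commute)
    qed
    then show "\<exists>no. \<forall>n\<ge>no. dist (X n) (abs_L2 h) < e" by blast
  qed
  then show "convergent X" by (auto simp: convergent_def)
qed

instance L2 :: chilbert_space ..

section \<open>Smooth functions vanishing at infinity\<close>

lemma C0_continuous: "C0 f \<Longrightarrow> continuous_on UNIV f"
  by (simp add: C0_def)

lemma C0_lim:
  fixes f :: "'a::{real_normed_vector,heine_borel} \<Rightarrow> 'b::real_normed_vector"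
  assumes "continuous_on UNIV f" "(f \<longlongrightarrow> 0) at_infinity"
  shows "C0 f"
  unfolding C0_def
proof (intro conjI allI impI)
  fix e :: real assume "e > 0"
  then have "\<forall>\<^sub>F x in at_infinity. norm (f x) < e"
    using tendstoD[OF assms(2)] by (simp add: dist_norm)
  then obtain b where b: "\<And>x. norm x \<ge> b \<Longrightarrow> norm (f x) < e"
    by (auto simp: eventually_at_infinity)
  show "\<exists>X. compact X \<and> (\<forall>x. x \<notin> X \<longrightarrow> norm (f x) < e)"
    by (rule exI[of _ "cball 0 b"]) (auto intro!: b)
qed fact

lemma C0_bounded:
  fixes f :: "'a::topological_space \<Rightarrow> 'b::real_normed_vector"
  assumes "C0 f"
  obtains B where "\<And>x. norm (f x) \<le> B"
proof -
  obtain X where X: "compact X" "\<And>x. x \<notin> X \<Longrightarrow> norm (f x) < 1"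
    using assms by (auto simp: C0_def dest!: spec[of _ "1::real"])
  have "compact (f ` X)"
    using assms X(1) by (intro compact_continuous_image) (auto simp: C0_def intro: continuous_on_subset)
  then obtain B where B: "\<And>x. x \<in> X \<Longrightarrow> norm (f x) \<le> B"
    using compact_imp_bounded bounded_iff by (metis imageI)
  have "norm (f x) \<le> max 1 B" for x
    using X(2)[of x] B[of x] by (cases "x \<in> X") auto
  then show ?thesis using that by blast
qed

lemma C0_add:
  assumes "C0 f" "C0 g"
  shows "C0 (\<lambda>x. f x + g x)"
  unfolding C0_def
proof (intro conjI allI impI)
  show "continuous_on UNIV (\<lambda>x. f x + g x)"
    using assms by (intro continuous_intros C0_continuous)
  fix e :: real assume "e > 0"
  then have e: "e / 2 > 0" by simp
  obtain X Y where XY: "compact X" "\<And>x. x \<notin> X \<Longrightarrow> norm (f x) < e / 2"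
     "compact Y" "\<And>x. x \<notin> Y \<Longrightarrow> norm (g x) < e / 2"
    using assms e unfolding C0_def by meson
  have "norm (f x + g x) < e" if "x \<notin> X \<union> Y" for x
    using XY(2)[of x] XY(4)[of x] norm_triangle_ineq[of "f x" "g x"] that by simp
  with XY(1,3) show "\<exists>X. compact X \<and> (\<forall>x. x \<notin> X \<longrightarrow> norm (f x + g x) < e)"
    by (intro exI[of _ "X \<union> Y"] conjI compact_Un) auto
qed

lemma C0_dominated:
  assumes "C0 f" "continuous_on UNIV g" "\<And>x. norm (g x) \<le> C * norm (f x)"
  shows "C0 g"
  unfolding C0_def
proof (intro conjI allI impI)
  fix e :: real assume "e > 0"
  then have "e / (\<bar>C\<bar> + 1) > 0" by (simp add: add_nonneg_pos)
  then obtain X where X: "compact X" "\<And>x. x \<notin> X \<Longrightarrow> norm (f x) < e / (\<bar>C\<bar> + 1)"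
    using assms(1) unfolding C0_def by meson
  have "norm (g x) < e" if "x \<notin> X" for x
  proof -
    have "norm (g x) \<le> (\<bar>C\<bar> + 1) * norm (f x)"
      using assms(3)[of x] by (rule order_trans) (intro mult_right_mono, auto)
    also have "\<dots> < e" using X(2)[OF that] by (simp add: field_simps add_nonneg_pos)
    finally show ?thesis .
  qed
  then show "\<exists>X. compact X \<and> (\<forall>x. x \<notin> X \<longrightarrow> norm (g x) < e)" using X(1) by blast
qed fact

lemma C0_cmult:
  fixes f :: "'a::topological_space \<Rightarrow> complex"
  assumes "C0 f"
  shows "C0 (\<lambda>x. c * f x)"
proof (rule C0_dominated[OF assms])
  show "continuous_on UNIV (\<lambda>x. c * f x)"
    by (rule continuous_on_mult_left[OF C0_continuous[OF assms]])
  show "norm (c * f x) \<le> norm c * norm (f x)" for x by (simp add: norm_mult)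
qed

primrec nth_deriv :: "nat \<Rightarrow> (real \<Rightarrow> complex) \<Rightarrow> real \<Rightarrow> complex" where
  "nth_deriv 0 \<phi> = \<phi>"
| "nth_deriv (Suc i) \<phi> = (\<lambda>x. vector_derivative (nth_deriv i \<phi>) (at x))"

definition smooth_C0 :: "(real \<Rightarrow> complex) \<Rightarrow> bool" where
  "smooth_C0 \<phi> \<longleftrightarrow> (\<forall>i. C0 (nth_deriv i \<phi>) \<and>
     (\<forall>x. (nth_deriv i \<phi> has_vector_derivative nth_deriv (Suc i) \<phi> x) (at x)))"

text \<open>
  Integrability is required because it makes bounded functions with sup norm tending to zero weakly
  null against a test function.
\<close>
definition test_function :: "(real \<Rightarrow> complex) \<Rightarrow> bool" where
  "test_function \<phi> \<longleftrightarrow> integrable lebesgue \<phi> \<and> square_integrable \<phi> \<and> smooth_C0 \<phi>"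

text \<open>
  Any sequence of functions in which each is the derivative of its predecessor must consist of the
  iterated derivatives.
\<close>
lemma smooth_C0_I:
  assumes d0: "d 0 = \<phi>" and d: "\<And>i x. (d i has_vector_derivative d (Suc i) x) (at x)" "\<And>i. C0 (d i)"
  shows "smooth_C0 \<phi>" "nth_deriv i \<phi> = d i"
proof -
  show eq: "nth_deriv i \<phi> = d i" for i
    by (induction i) (use d0 vector_derivative_at[OF d(1)] in auto)
  show "smooth_C0 \<phi>" unfolding smooth_C0_def eq using d by auto
qed

lemma smooth_C0_D:
  assumes "smooth_C0 \<phi>"
  shows "(nth_deriv i \<phi> has_vector_derivative nth_deriv (Suc i) \<phi> x) (at x)" "C0 (nth_deriv i \<phi>)"
  using assms by (auto simp: smooth_C0_def)

lemma smooth_C0_lincomb: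
  assumes f: "smooth_C0 f" and g: "smooth_C0 g"
  shows "smooth_C0 (\<lambda>x. a * f x + b * g x)"
    "nth_deriv i (\<lambda>x. a * f x + b * g x) = (\<lambda>x. a * nth_deriv i f x + b * nth_deriv i g x)"
proof -
  define d where "d i x = a * nth_deriv i f x + b * nth_deriv i g x" for i x
  have 0: "d 0 = (\<lambda>x. a * f x + b * g x)" by (simp add: d_def fun_eq_iff)
  have 1: "(d i has_vector_derivative d (Suc i) x) (at x)" for i x
    unfolding d_def using f g
    by (intro has_vector_derivative_add has_vector_derivative_mult_right smooth_C0_D)
  have 2: "C0 (d i)" for i
    unfolding d_def using f g
    by (intro C0_add C0_cmult smooth_C0_D)
  show "smooth_C0 (\<lambda>x. a * f x + b * g x)" 
    by (rule smooth_C0_I[OF 0 1 2])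
  show "nth_deriv i (\<lambda>x. a * f x + b * g x) = (\<lambda>x. a * nth_deriv i f x + b * nth_deriv i g x)"
    unfolding smooth_C0_I(2)[OF 0 1 2] by (simp add: d_def fun_eq_iff)
qed

lemma test_function_lincomb: "test_function f \<Longrightarrow> test_function g \<Longrightarrow> test_function (\<lambda>x. a * f x + b * g x)"
  unfolding test_function_def by (simp add: square_integrable_add square_integrable_scale smooth_C0_lincomb)

lemma smooth_C0_affine:
  assumes f: "smooth_C0 f" and \<alpha>: "\<alpha> \<noteq> 0"
  shows "smooth_C0 (\<lambda>x. c * f (\<beta> + \<alpha> * x))"
    "nth_deriv i (\<lambda>x. c * f (\<beta> + \<alpha> * x)) = (\<lambda>x. c * of_real (\<alpha> ^ i) * nth_deriv i f (\<beta> + \<alpha> * x))"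
proof -
  define d where "d i x = c * of_real (\<alpha> ^ i) * nth_deriv i f (\<beta> + \<alpha> * x)" for i x
  have 0: "d 0 = (\<lambda>x. c * f (\<beta> + \<alpha> * x))" by (simp add: d_def fun_eq_iff)
  have 1: "(d i has_vector_derivative d (Suc i) x) (at x)" for i x
  proof -
    have "((\<lambda>x. nth_deriv i f (\<beta> + \<alpha> * x)) has_vector_derivative \<alpha> *\<^sub>R nth_deriv (Suc i) f (\<beta> + \<alpha> * x)) (at x)"
    proof -
      have "((\<lambda>x. \<beta> + \<alpha> * x) has_vector_derivative \<alpha>) (at x)"
        by (auto intro!: derivative_eq_intros simp flip: has_real_derivative_iff_has_vector_derivative)
      from vector_diff_chain_at[OF this smooth_C0_D(1)[OF f, of i "\<beta> + \<alpha> * x"]]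
      show ?thesis by (simp add: o_def)
    qed
    from has_vector_derivative_mult_right[OF this, of "c * of_real (\<alpha> ^ i)"]
    show ?thesis by (simp add: d_def[abs_def] scaleR_conv_of_real mult_ac)
  qed
  have 2: "C0 (d i)" for i
    unfolding C0_def
  proof (intro conjI allI impI)
    have "C0 (nth_deriv i f)" using f by (rule smooth_C0_D)
    then have c: "C0 (\<lambda>x. c * of_real (\<alpha> ^ i) * nth_deriv i f x)" by (rule C0_cmult)
    show "continuous_on UNIV (d i)"
      unfolding d_def
      by (rule continuous_on_compose2[OF C0_continuous[OF c]]) (auto intro!: continuous_intros)
    fix e :: real assume "e > 0"
    then obtain X where X: "compact X" "\<And>x. x \<notin> X \<Longrightarrow> norm (c * of_real (\<alpha> ^ i) * nth_deriv i f x) < e"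
      using c unfolding C0_def by meson
    have "compact ((\<lambda>y. (y - \<beta>) / \<alpha>) ` X)"
      by (intro compact_continuous_image X continuous_intros) (use \<alpha> in auto)
    moreover have "x \<in> (\<lambda>y. (y - \<beta>) / \<alpha>) ` X" if "\<beta> + \<alpha> * x \<in> X" for x
      using that \<alpha> by (intro image_eqI[of _ _ "\<beta> + \<alpha> * x"]) auto
    ultimately show "\<exists>X. compact X \<and> (\<forall>x. x \<notin> X \<longrightarrow> norm (d i x) < e)"
      unfolding d_def using X(2) by (intro exI[of _ "(\<lambda>y. (y - \<beta>) / \<alpha>) ` X"]) blast
  qed
  show "smooth_C0 (\<lambda>x. c * f (\<beta> + \<alpha> * x))" by (rule smooth_C0_I[OF 0 1 2])
  show "nth_deriv i (\<lambda>x. c * f (\<beta> + \<alpha> * x)) = (\<lambda>x. c * of_real (\<alpha> ^ i) * nth_deriv i f (\<beta> + \<alpha> * x))"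
    unfolding smooth_C0_I(2)[OF 0 1 2] by (simp add: d_def fun_eq_iff)
qed

lemma test_function_affine:
  assumes f: "test_function f" and \<alpha>: "\<alpha> \<noteq> 0"
  shows "test_function (\<lambda>x. c * f (\<beta> + \<alpha> * x))"
  unfolding test_function_def
proof (intro conjI)
  show "integrable lebesgue (\<lambda>x. c * f (\<beta> + \<alpha> * x))"
    using f \<alpha> by (intro integrable_mult_right lebesgue_integrable_real_affine) (auto simp: test_function_def)
  show "smooth_C0 (\<lambda>x. c * f (\<beta> + \<alpha> * x))"
    using f \<alpha> by (intro smooth_C0_affine) (auto simp: test_function_def)
  have "square_integrable (\<lambda>x. f (\<beta> + \<alpha> * x))"
    unfolding square_integrable_def
  proof
    show "(\<lambda>x. f (\<beta> + \<alpha> * x)) \<in> borel_measurable lebesgue"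
      using f \<alpha> by (intro borel_measurable_integrable lebesgue_integrable_real_affine) (auto simp: test_function_def)
    show "integrable lebesgue (\<lambda>x. (cmod (f (\<beta> + \<alpha> * x)))\<^sup>2)"
      using f \<alpha> by (intro lebesgue_integrable_real_affine[of "\<lambda>x. (cmod (f x))\<^sup>2"]) (auto simp: test_function_def square_integrable_def)
  qed
  then show "square_integrable (\<lambda>x. c * f (\<beta> + \<alpha> * x))" by (rule square_integrable_scale)
qed

lemma continuous_AE_eq:
  fixes f g :: "real \<Rightarrow> complex"
  assumes "continuous_on UNIV f" "continuous_on UNIV g" "AE x in lebesgue. f x = g x"
  shows "f = g"
proof (rule ccontr)
  assume "f \<noteq> g"
  have op: "open {x. f x \<noteq> g x}" by (intro open_Collect_neq assms)
  obtain x where "f x \<noteq> g x" using \<open>f \<noteq> g\<close> by auto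
  then obtain e where e: "e > 0" "ball x e \<subseteq> {x. f x \<noteq> g x}"
    using op unfolding open_contains_ball by blast
  obtain N where N: "{x \<in> space lebesgue. f x \<noteq> g x} \<subseteq> N" "emeasure lebesgue N = 0" "N \<in> sets lebesgue"
    using assms(3) by (rule AE_E)
  have "{x<..<x+e} \<subseteq> N" using e(2) N(1) by (force simp: dist_real_def)
  then have "emeasure lebesgue {x<..<x+e} \<le> emeasure lebesgue N"
    by (rule emeasure_mono[OF _ N(3)])
  then show False using e(1) N(2) by simp
qed

lemma integrable_inverse_1_plus_square: "integrable lebesgue (\<lambda>x::real. 1 / (1 + x\<^sup>2))"
proof -
  let ?f = "\<lambda>x::real. 1 / (1 + x\<^sup>2)"
  have pos: "1 + x\<^sup>2 > 0" for x :: real by (simp add: add_pos_nonneg)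
  have [measurable]: "?f \<in> borel_measurable borel" by measurable
  have half: "(\<integral>\<^sup>+x. ennreal (?f x) * indicator {0..} x \<partial>lborel) = pi / 2 - arctan 0"
  proof (rule nn_integral_FTC_atLeast)
    show "DERIV arctan x :> ?f x" for x using DERIV_arctan[of x] by (simp add: divide_inverse)
    show "0 \<le> ?f x" for x using pos[of x] by simp
  qed (simp_all add: tendsto_arctan_at_top)
  have "(\<integral>\<^sup>+x. ennreal (?f x) * indicator {..0} x \<partial>lborel)
     = (\<integral>\<^sup>+x. ennreal (?f x) * indicator {0..} x \<partial>lborel)"
    by (subst nn_integral_real_affine[where c="-1" and t=0]) (auto intro!: nn_integral_cong simp: indicator_def)
  with half have half': "(\<integral>\<^sup>+x. ennreal (?f x) * indicator {..0} x \<partial>lborel) = pi / 2" by simp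
  have "(\<integral>\<^sup>+x. ennreal (?f x) \<partial>lborel) \<le>
      (\<integral>\<^sup>+x. ennreal (?f x) * indicator {0..} x + ennreal (?f x) * indicator {..0} x \<partial>lborel)"
    by (intro nn_integral_mono) (auto simp: indicator_def)
  also have "\<dots> = (\<integral>\<^sup>+x. ennreal (?f x) * indicator {0..} x \<partial>lborel) + (\<integral>\<^sup>+x. ennreal (?f x) * indicator {..0} x \<partial>lborel)"
    by (intro nn_integral_add) measurable
  also have "\<dots> < \<infinity>" unfolding half half' by simp
  finally have "integrable lborel ?f"
    by (intro integrableI_nonneg) (use pos in \<open>auto intro!: less_imp_le\<close>)
  then show ?thesis by (simp add: integrable_completion)
qed

section \<open>Totality of the bump functions\<close>

text \<open>
  As \<open>k\<close> grows, these functions converge to the indicator function of \<open>(-1, 1)\<close>.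
\<close>
definition bump :: "nat \<Rightarrow> real \<Rightarrow> complex" where
  "bump k x = complex_of_real (exp (- (x ^ (2 * Suc k))))"

lemma bump_eq: "bump k x = complex_of_real (exp (- ((x\<^sup>2) ^ Suc k)))"
  by (simp only: bump_def power_mult)

lemma norm_bump: "norm (bump k x) = exp (- ((x\<^sup>2) ^ Suc k))"
  unfolding bump_eq norm_of_real by simp

lemma norm_bump_le_1: "norm (bump k x) \<le> 1"
proof -
  have "0 \<le> (x\<^sup>2) ^ Suc k" by (rule zero_le_power) simp
  then show ?thesis unfolding norm_bump by (simp only: exp_le_one_iff neg_le_0_iff_le)
qed

lemma DERIV_poly_times_exp:
  "((\<lambda>x. poly p x * exp (- (x ^ m))) has_real_derivative
     poly (pderiv p - monom (of_nat m) (m - 1) * p) x * exp (- (x ^ m))) (at x)"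
proof -
  have "((\<lambda>x. exp (- (x ^ m))) has_real_derivative exp (- (x ^ m)) * - (of_nat m * x ^ (m - 1))) (at x)"
    by (auto intro!: derivative_eq_intros)
  from DERIV_mult[OF poly_DERIV this, of p]
  show ?thesis by (rule DERIV_cong) (simp add: poly_monom algebra_simps)
qed

lemma poly_exp_decay:
  "((\<lambda>x::real. poly p x * exp (- (x ^ (2 * Suc k)))) \<longlongrightarrow> 0) at_infinity"
proof -
  have mono: "((\<lambda>x::real. x ^ n * exp (- (x ^ (2 * Suc k)))) \<longlongrightarrow> 0) at_infinity" for n
  proof (rule Lim_null_comparison)
    show "((\<lambda>x::real. norm x ^ n / exp (norm x)) \<longlongrightarrow> 0) at_infinity"
      by (rule filterlim_compose[OF tendsto_power_div_exp_0 filterlim_norm_at_top])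
    have le: "norm (x ^ n * exp (- (x ^ (2 * Suc k)))) \<le> norm x ^ n / exp (norm x)"
      if "1 \<le> norm x" for x :: real
    proof -
      have "norm x \<le> norm x ^ (2 * Suc k)" using that by (intro self_le_power) auto
      also have "\<dots> = x ^ (2 * Suc k)" by (simp add: power_mult)
      finally have "exp (- (x ^ (2 * Suc k))) \<le> exp (- norm x)" by simp
      then have "norm x ^ n * exp (- (x ^ (2 * Suc k))) \<le> norm x ^ n * exp (- norm x)"
        by (rule mult_left_mono) simp
      then show ?thesis by (simp add: abs_mult power_abs exp_minus divide_inverse)
    qed
    show "\<forall>\<^sub>F x::real in at_infinity. norm (x ^ n * exp (- (x ^ (2 * Suc k)))) \<le> norm x ^ n / exp (norm x)"
      unfolding eventually_at_infinity using le by blast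
  qed
  have "((\<lambda>x::real. \<Sum>i\<le>degree p. coeff p i * (x ^ i * exp (- (x ^ (2 * Suc k))))) \<longlongrightarrow> (\<Sum>i\<le>degree p. coeff p i * 0)) at_infinity"
    by (intro tendsto_sum tendsto_mult tendsto_const mono)
  then show ?thesis by (simp add: poly_altdef sum_distrib_right mult.assoc)
qed

text \<open>
  All derivatives are polynomials times \<open>exp (-x\<^sup>m)\<close> with the even exponent \<open>m = 2 (k + 1)\<close>.
\<close>
lemma smooth_C0_bump: "smooth_C0 (bump k)"
proof -
  let ?m = "2 * Suc k"
  define P :: "nat \<Rightarrow> real poly" where
    "P = rec_nat 1 (\<lambda>_ p. pderiv p - monom (of_nat ?m) (?m - 1) * p)"
  have P: "P 0 = 1" "P (Suc i) = pderiv (P i) - monom (of_nat ?m) (?m - 1) * P i" for i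
    by (simp_all add: P_def)
  define d where "d i x = complex_of_real (poly (P i) x * exp (- (x ^ ?m)))" for i x
  show ?thesis
  proof (rule smooth_C0_I)
    show "d 0 = bump k" by (simp add: d_def bump_def P fun_eq_iff)
    show "(d i has_vector_derivative d (Suc i) x) (at x)" for i x
      using DERIV_poly_times_exp[of "P i" ?m x] unfolding d_def P(2)
      by (rule has_vector_derivative_of_real)
    show "C0 (d i)" for i
    proof (rule C0_lim)
      show "continuous_on UNIV (d i)" unfolding d_def by (intro continuous_intros)
      have "(d i \<longlongrightarrow> complex_of_real 0) at_infinity"
        unfolding d_def by (intro tendsto_of_real poly_exp_decay)
      then show "(d i \<longlongrightarrow> 0) at_infinity" by simp
    qed
  qed
qed

text \<open>
  An integrable bound that does not depend on \<open>k\<close>, as needed for dominated convergence.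
\<close>
lemma bump_le: "norm (bump k x) \<le> 2 / (1 + x\<^sup>2)"
proof -
  have pos: "1 + x\<^sup>2 > 0" by (simp add: add_pos_nonneg)
  show ?thesis
  proof (cases "\<bar>x\<bar> \<le> 1")
    case True
    then have "x\<^sup>2 \<le> 1" by (simp add: abs_square_le_1)
    then have "1 \<le> 2 / (1 + x\<^sup>2)" using pos by (simp add: field_simps)
    moreover have "norm (bump k x) \<le> 1" by (rule norm_bump_le_1)
    ultimately show ?thesis by linarith
  next
    case False
    then have "1 \<le> x\<^sup>2" by (metis abs_square_less_1 not_less linear)
    then have "x\<^sup>2 \<le> (x\<^sup>2) ^ Suc k" by (intro self_le_power) auto
    then have "1 + x\<^sup>2 \<le> exp ((x\<^sup>2) ^ Suc k)" using exp_ge_add_one_self[of "(x\<^sup>2) ^ Suc k"] by linarith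
    then have "1 / exp ((x\<^sup>2) ^ Suc k) \<le> 1 / (1 + x\<^sup>2)" using pos by (intro divide_left_mono) auto
    also have "\<dots> \<le> 2 / (1 + x\<^sup>2)" using pos by (intro divide_right_mono) auto
    also have "1 / exp ((x\<^sup>2) ^ Suc k) = norm (bump k x)"
      unfolding norm_bump by (simp add: exp_minus divide_inverse del: power_Suc)
    finally show ?thesis .
  qed
qed

lemma continuous_measurable_lebesgue:
  fixes f :: "'a::euclidean_space \<Rightarrow> 'b::topological_space"
  shows "continuous_on UNIV f \<Longrightarrow> f \<in> borel_measurable lebesgue"
proof -
  assume "continuous_on UNIV f"
  then have "f \<in> borel_measurable lborel" using borel_measurable_continuous_onI by simp
  then show ?thesis by (rule measurable_completion)
qed

lemma square_integrable_of_bounded: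
  assumes "integrable lebesgue f" "\<And>x. norm (f x) \<le> B"
  shows "square_integrable f"
  unfolding square_integrable_def
proof
  show m [measurable]: "f \<in> borel_measurable lebesgue" using assms(1) by simp
  show "integrable lebesgue (\<lambda>x. (cmod (f x))\<^sup>2)"
  proof (rule Bochner_Integration.integrable_bound)
    show "integrable lebesgue (\<lambda>x. B * norm (f x))" using assms(1) by simp
    show "AE x in lebesgue. norm ((cmod (f x))\<^sup>2) \<le> norm (B * norm (f x))"
    proof (intro AE_I2)
      fix x
      have "(cmod (f x))\<^sup>2 \<le> B * norm (f x)"
        using assms(2)[of x] by (simp add: power2_eq_square mult_right_mono)
      then show "norm ((cmod (f x))\<^sup>2) \<le> norm (B * norm (f x))" by simp
    qed
  qed measurable
qed

lemma test_function_bump: "test_function (bump k)"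
proof -
  have "continuous_on UNIV (bump k)" unfolding bump_def by (intro continuous_intros)
  then have [measurable]: "bump k \<in> borel_measurable lebesgue" by (rule continuous_measurable_lebesgue)
  have int: "integrable lebesgue (bump k)"
  proof (rule Bochner_Integration.integrable_bound)
    show "integrable lebesgue (\<lambda>x::real. 2 * (1 / (1 + x\<^sup>2)))"
      by (intro integrable_mult_right integrable_inverse_1_plus_square)
    show "AE x in lebesgue. norm (bump k x) \<le> norm (2 * (1 / (1 + x\<^sup>2)) :: real)"
      using bump_le[of k] by (auto intro: order_trans)
  qed measurable
  with norm_bump_le_1 show ?thesis
    using smooth_C0_bump square_integrable_of_bounded[of "bump k" 1] by (auto simp: test_function_def)
qed

lemma bump_lim:
  assumes "\<bar>x\<bar> \<noteq> 1"
  shows "(\<lambda>k. bump k x) \<longlonglongrightarrow> (if \<bar>x\<bar> < 1 then 1 else 0)"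
proof (cases "\<bar>x\<bar> < 1")
  case True
  then have "x\<^sup>2 < 1" by (simp add: abs_square_less_1)
  then have "(\<lambda>k. (x\<^sup>2) ^ Suc k) \<longlonglongrightarrow> 0" by (intro LIMSEQ_Suc LIMSEQ_realpow_zero) auto
  then have "(\<lambda>k. complex_of_real (exp (- ((x\<^sup>2) ^ Suc k)))) \<longlonglongrightarrow> complex_of_real (exp (- 0))"
    by (intro tendsto_intros)
  then show ?thesis using True by (simp add: bump_eq del: power_Suc)
next
  case False
  then have "1 < x\<^sup>2" using assms by (metis abs_square_le_1 linorder_neqE_linordered_idom not_less)
  then have "1 / x\<^sup>2 < 1" using divide_less_eq_1_pos[of "x\<^sup>2" 1] by linarith
  then have lim: "(\<lambda>k. (1 / x\<^sup>2) ^ Suc k) \<longlonglongrightarrow> 0" by (intro LIMSEQ_Suc LIMSEQ_realpow_zero) auto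
  have le: "norm (exp (- ((x\<^sup>2) ^ Suc k))) \<le> (1 / x\<^sup>2) ^ Suc k" for k
  proof -
    have pos: "(x\<^sup>2) ^ Suc k > 0" by (rule zero_less_power) (use \<open>1 < x\<^sup>2\<close> in linarith)
    have "(x\<^sup>2) ^ Suc k \<le> exp ((x\<^sup>2) ^ Suc k)"
      using exp_ge_add_one_self[of "(x\<^sup>2) ^ Suc k"] by linarith
    then have "inverse (exp ((x\<^sup>2) ^ Suc k)) \<le> inverse ((x\<^sup>2) ^ Suc k)"
      using pos by (rule le_imp_inverse_le)
    then show ?thesis by (simp add: exp_minus divide_inverse power_inverse del: power_Suc)
  qed
  have "(\<lambda>k. exp (- ((x\<^sup>2) ^ Suc k))) \<longlonglongrightarrow> 0"
    by (rule Lim_null_comparison[OF always_eventually[OF allI[OF le]] lim])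
  then have "(\<lambda>k. complex_of_real (exp (- ((x\<^sup>2) ^ Suc k)))) \<longlonglongrightarrow> complex_of_real 0"
    by (rule tendsto_of_real)
  then show ?thesis using False by (simp add: bump_eq del: power_Suc)
qed

text \<open>
  The affine substitution carries \<open>(a, b)\<close> to \<open>(-1, 1)\<close>, so the bumps converge to the indicator function
  of \<open>(a, b)\<close> except at the two end points.
\<close>
lemma integral_interval_zero:
  assumes f: "square_integrable f" and ab: "a < b"
    and orth: "\<And>k. (LINT x|lebesgue. f x * cnj (bump k (- (a + b) / (b - a) + 2 / (b - a) * x))) = 0"
  shows "(LINT x|lebesgue. indicator {a<..<b} x *\<^sub>R f x) = 0"
proof -
  define y where "y x = - (a + b) / (b - a) + 2 / (b - a) * x" for x
  have y: "\<bar>y x\<bar> < 1 \<longleftrightarrow> x \<in> {a<..<b}" "\<bar>y x\<bar> = 1 \<longleftrightarrow> x = a \<or> x = b" for x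
  proof -
    have e: "y x = (2 * x - (a + b)) / (b - a)"
      by (simp add: y_def add_divide_distrib diff_divide_distrib)
    have "y x < 1 \<longleftrightarrow> x < b" "y x > -1 \<longleftrightarrow> x > a" "y x = 1 \<longleftrightarrow> x = b" "y x = -1 \<longleftrightarrow> x = a"
      using ab unfolding e by (auto simp: divide_less_eq less_divide_eq divide_eq_eq)
    then show "\<bar>y x\<bar> < 1 \<longleftrightarrow> x \<in> {a<..<b}" "\<bar>y x\<bar> = 1 \<longleftrightarrow> x = a \<or> x = b" by auto
  qed
  have [measurable]: "f \<in> borel_measurable lebesgue" using f by (rule square_integrable_measurable)
  define w where "w x = complex_of_real (2 / (1 + (y x)\<^sup>2))" for x
  have wi: "integrable lebesgue w"
  proof -
    have "integrable lebesgue (\<lambda>x. 2 * (1 / (1 + (- (a + b) / (b - a) + 2 / (b - a) * x)\<^sup>2)))"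
      using ab by (intro integrable_mult_right lebesgue_integrable_real_affine[of "\<lambda>x. 1 / (1 + x\<^sup>2)"] 
          integrable_inverse_1_plus_square) auto
    then show ?thesis unfolding w_def y_def by (intro integrable_of_real) simp
  qed
  have "square_integrable w"
  proof (rule square_integrable_of_bounded[OF wi])
    show "norm (w x) \<le> 2" for x unfolding w_def norm_of_real by (simp add: add_pos_nonneg divide_le_eq abs_of_pos)
  qed
  then have "integrable lebesgue (\<lambda>x. norm (f x * cnj (w x)))"
    using f by (intro integrable_norm square_integrable_cinner)
  then have wint: "integrable lebesgue (\<lambda>x. norm (f x) * norm (w x))" by (simp add: norm_mult)
  have nb: "test_function (\<lambda>x. 1 * bump k (- (a + b) / (b - a) + 2 / (b - a) * x))" for k
    using ab by (intro test_function_affine test_function_bump) auto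
  have lim: "(\<lambda>k. LINT x|lebesgue. f x * cnj (bump k (y x))) \<longlonglongrightarrow> (LINT x|lebesgue. indicator {a<..<b} x *\<^sub>R f x)"
  proof (rule integral_dominated_convergence[OF _ _ wint])
    show "(\<lambda>x. indicator {a<..<b} x *\<^sub>R f x) \<in> borel_measurable lebesgue"
      using square_integrable_measurable[OF f]
      by (intro borel_measurable_scaleR borel_measurable_indicator) auto
    show "(\<lambda>x. f x * cnj (bump k (y x))) \<in> borel_measurable lebesgue" for k
      using square_integrable_cinner[OF f, of "\<lambda>x. bump k (y x)"] nb[of k] by (simp add: test_function_def y_def)
    show "AE x in lebesgue. (\<lambda>k. f x * cnj (bump k (y x))) \<longlonglongrightarrow> indicator {a<..<b} x *\<^sub>R f x"
    proof -
      have "AE x in lborel. x \<noteq> a \<and> x \<noteq> b" by (simp add: AE_lborel_singleton)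
      then have "AE x in lebesgue. x \<noteq> a \<and> x \<noteq> b" by (rule AE_completion)
      then show ?thesis
      proof eventually_elim
        case (elim x)
        have "(\<lambda>k. f x * cnj (bump k (y x))) \<longlonglongrightarrow> f x * cnj (if \<bar>y x\<bar> < 1 then 1 else 0)"
          using elim y(2)[of x] by (intro tendsto_mult tendsto_const tendsto_cnj bump_lim) auto
        then show ?case using y(1)[of x] by (auto simp: indicator_def)
      qed
    qed
    show "AE x in lebesgue. norm (f x * cnj (bump k (y x))) \<le> norm (f x) * norm (w x)" for k
    proof (intro AE_I2)
      fix x
      have "norm (bump k (y x)) \<le> norm (w x)"
        using bump_le[of k "y x"] unfolding w_def norm_of_real by (simp add: add_pos_nonneg abs_of_pos)
      then show "norm (f x * cnj (bump k (y x))) \<le> norm (f x) * norm (w x)"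
        by (simp add: norm_mult mult_left_mono)
    qed
  qed
  have "(\<lambda>k. LINT x|lebesgue. f x * cnj (bump k (y x))) = (\<lambda>k. 0)" using orth by (simp add: y_def)
  then show ?thesis using lim LIMSEQ_unique tendsto_const by metis
qed

text \<open>
  The intervals with rational end points form an intersection-stable generator of the Borel sets, and
  the sets over which the integral of \<open>g\<close> vanishes form a Dynkin system.
\<close>
lemma AE_zero_if_zero_on_intervals:
  fixes g :: "real \<Rightarrow> complex"
  assumes g: "integrable lebesgue g" and zero: "(LINT x|lebesgue. g x) = 0"
    and int: "\<And>a b. a \<in> \<rat> \<Longrightarrow> b \<in> \<rat> \<Longrightarrow> (LINT x|lebesgue. indicator {a<..<b} x *\<^sub>R g x) = 0"
  shows "AE x in lebesgue. g x = 0"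
proof -
  define G where "G = (\<lambda>(a, b). {a<..<b::real}) ` (\<rat> \<times> \<rat>)"
  have G: "topological_basis G" "countable G" "Int_stable G"
  proof -
    show "topological_basis G"
    proof (rule topological_basisI)
      show "open B" if "B \<in> G" for B using that by (auto simp: G_def)
      fix U :: "real set" and x assume U: "open U" "x \<in> U"
      then obtain e where e: "e > 0" "ball x e \<subseteq> U" by (meson open_contains_ball)
      obtain a b where ab: "a \<in> \<rat>" "b \<in> \<rat>" "x - e < a" "a < x" "x < b" "b < x + e"
        using Rats_dense_in_real[of "x - e" x] Rats_dense_in_real[of x "x + e"] e(1) by auto
      then have "{a<..<b} \<subseteq> U" using e(2) by (force simp: dist_real_def)
      then show "\<exists>B\<in>G. x \<in> B \<and> B \<subseteq> U"
        using ab by (intro bexI[of _ "{a<..<b}"]) (auto simp: G_def)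
    qed
    show "countable G" unfolding G_def by (intro countable_image countable_SIGMA countable_rat)
    show "Int_stable G"
      unfolding Int_stable_def G_def
      by (auto simp: Int_greaterThanLessThan image_iff max_def min_def split: if_splits)
  qed
  have borel: "sets borel = sigma_sets UNIV G"
    by (subst borel_eq_countable_basis[OF G(2,1)]) simp
  have gi: "integrable lebesgue (\<lambda>x. indicator A x *\<^sub>R g x)" if "A \<in> sets borel" for A
    using that by (intro integrable_mult_indicator g) auto
  have P: "(LINT x|lebesgue. indicator A x *\<^sub>R g x) = 0" if "A \<in> sigma_sets UNIV G" for A
    using G(3) subset_Pow_Union[of G, THEN subset_trans[OF _ Pow_mono[OF subset_UNIV]]] that
  proof (induction rule: sigma_sets_induct_disjoint)
    case (basic A)
    then show ?case using int by (auto simp: G_def)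
  next
    case (compl A)
    have "(LINT x|lebesgue. indicator (UNIV - A) x *\<^sub>R g x) = (LINT x|lebesgue. g x - indicator A x *\<^sub>R g x)"
      by (intro Bochner_Integration.integral_cong) (auto simp: indicator_def)
    also have "\<dots> = 0"
      using compl zero g gi[of A] by (subst Bochner_Integration.integral_diff) (auto simp: borel)
    finally show ?case .
  next
    case (union A)
    have A: "A i \<in> sets lebesgue" for i using union(2) borel by (auto simp: range_subsetD)
    have "set_integrable lebesgue (\<Union>i. A i) g"
      unfolding set_integrable_def using A by (intro integrable_mult_indicator g) auto
    from lebesgue_integral_countable_add[OF A _ this] union(1,3) 
    have "(LINT x:(\<Union>i. A i)|lebesgue. g x) = (\<Sum>i. LINT x:A i|lebesgue. g x)"
      by (auto simp: disjoint_family_on_def)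
    then show ?case using union(3) by (simp add: set_lebesgue_integral_def)
  qed (auto)
  have P': "(LINT x|lebesgue. indicator A x *\<^sub>R g x) = 0" if "A \<in> sets lebesgue" for A
  proof -
    obtain S N N' where S: "A = S \<union> N" "N \<subseteq> N'" "N' \<in> null_sets lborel" "S \<in> sets lborel"
      using \<open>A \<in> sets lebesgue\<close> by (rule sets_completionE)
    have "AE x in lebesgue. x \<notin> N'" using S(3) by (intro AE_completion AE_not_in)
    then have "AE x in lebesgue. indicator A x *\<^sub>R g x = indicator S x *\<^sub>R g x"
      by eventually_elim (use S in \<open>auto simp: indicator_def\<close>)
    then have "(LINT x|lebesgue. indicator A x *\<^sub>R g x) = (LINT x|lebesgue. indicator S x *\<^sub>R g x)"
      using that S g by (intro integral_cong_AE borel_measurable_integrable integrable_mult_indicator) auto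
    also have "\<dots> = 0" using S(4) borel by (intro P) auto
    finally show ?thesis .
  qed
  have "AE x in lebesgue. Re (g x) = 0" "AE x in lebesgue. Im (g x) = 0"
  proof -
    have i: "integrable lebesgue (\<lambda>x. indicator A x *\<^sub>R g x)" if "A \<in> sets lebesgue" for A
      using that by (intro integrable_mult_indicator g) auto
    show "AE x in lebesgue. Re (g x) = 0"
    proof (rule density_unique_real)
      show "(LINT x:A|lebesgue. Re (g x)) = (LINT x:A|lebesgue. 0)" if "A \<in> sets lebesgue" for A
        using integral_Re[OF i[OF that]] P'[OF that] by (simp add: set_lebesgue_integral_def)
    qed (use g in auto)
    show "AE x in lebesgue. Im (g x) = 0"
    proof (rule density_unique_real)
      show "(LINT x:A|lebesgue. Im (g x)) = (LINT x:A|lebesgue. 0)" if "A \<in> sets lebesgue" for A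
        using integral_Im[OF i[OF that]] P'[OF that] by (simp add: set_lebesgue_integral_def)
    qed (use g in auto)
  qed
  then show ?thesis by eventually_elim (simp add: complex_eq_iff)
qed

text \<open>
  Rational end points keep the family of bumps countable.  The function is cut off to bounded
  intervals because a square integrable function need not be integrable on the whole line.
\<close>
lemma AE_zero_if_orthogonal_to_bumps:
  assumes f: "square_integrable f" 
    and orth: "\<And>a b k. a \<in> \<rat> \<Longrightarrow> b \<in> \<rat> \<Longrightarrow> a < b \<Longrightarrow>
      (LINT x|lebesgue. f x * cnj (bump k (- (a + b) / (b - a) + 2 / (b - a) * x))) = 0"
  shows "AE x in lebesgue. f x = 0"
proof -
  have int: "(LINT x|lebesgue. indicator {a<..<b} x *\<^sub>R f x) = 0" if "a \<in> \<rat>" "b \<in> \<rat>" for a b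
    using integral_interval_zero[OF f, of a b] orth[OF that] by (cases "a < b") auto
  have [measurable]: "f \<in> borel_measurable lebesgue" using f by (rule square_integrable_measurable)
  have "AE x in lebesgue. indicator {- real n<..<real n} x *\<^sub>R f x = 0" for n
  proof (rule AE_zero_if_zero_on_intervals)
    let ?J = "{- real n<..<real n}"
    have ind: "square_integrable (\<lambda>x. complex_of_real (indicator ?J x))"
    proof (rule square_integrable_of_bounded[of _ 1])
      show "integrable lebesgue (\<lambda>x. complex_of_real (indicator ?J x))"
        by (intro integrable_of_real integrable_real_indicator) auto
      show "norm (complex_of_real (indicator ?J x)) \<le> 1" for x by (simp add: indicator_def)
    qed
    show "integrable lebesgue (\<lambda>x. indicator ?J x *\<^sub>R f x)"
      using square_integrable_cinner[OF f ind] by (simp add: scaleR_conv_of_real mult.commute)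
    show "(LINT x|lebesgue. indicator ?J x *\<^sub>R f x) = 0" by (intro int) auto
    fix a b :: real assume ab: "a \<in> \<rat>" "b \<in> \<rat>"
    have "(LINT x|lebesgue. indicator {a<..<b} x *\<^sub>R indicator ?J x *\<^sub>R f x)
      = (LINT x|lebesgue. indicator {max a (- real n)<..<min b (real n)} x *\<^sub>R f x)"
      by (intro Bochner_Integration.integral_cong) (auto simp: indicator_def)
    also have "\<dots> = 0" using ab by (intro int) (auto simp: max_def min_def)
    finally show "(LINT x|lebesgue. indicator {a<..<b} x *\<^sub>R indicator ?J x *\<^sub>R f x) = 0" .
  qed
  then have "AE x in lebesgue. \<forall>n. indicator {- real n<..<real n} x *\<^sub>R f x = 0"
    by (subst AE_all_countable) blast
  then show ?thesis
  proof eventually_elim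
    case (elim x)
    obtain n where "\<bar>x\<bar> < real n" using reals_Archimedean2 by blast
    then show ?case using elim[rule_format, of n] by (auto simp: indicator_def abs_less_iff)
  qed
qed

section \<open>Test functions as elements of \<open>L\<^sub>2\<close>\<close>

definition test_L2 :: "L2 set" where
  "test_L2 = abs_L2 ` Collect test_function"

text \<open>
  An equivalence class contains at most one continuous function (\<open>continuous_AE_eq\<close>), so the choice
  is unique and therefore linear.
\<close>
definition smooth_rep :: "L2 \<Rightarrow> real \<Rightarrow> complex" where
  "smooth_rep u = (SOME \<phi>. test_function \<phi> \<and> abs_L2 \<phi> = u)"

lemma test_function_D: "test_function \<phi> \<Longrightarrow> integrable lebesgue \<phi>" "test_function \<phi> \<Longrightarrow> square_integrable \<phi>" "test_function \<phi> \<Longrightarrow> smooth_C0 \<phi>"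
  by (auto simp: test_function_def)

lemma test_function_continuous: "test_function \<phi> \<Longrightarrow> continuous_on UNIV \<phi>"
  using C0_continuous smooth_C0_D(2)[of \<phi> 0] by (simp add: test_function_def)

lemma smooth_rep:
  assumes "u \<in> test_L2"
  shows "test_function (smooth_rep u)" "abs_L2 (smooth_rep u) = u"
proof -
  have "\<exists>\<phi>. test_function \<phi> \<and> abs_L2 \<phi> = u" using assms by (auto simp: test_L2_def)
  from someI_ex[OF this] show "test_function (smooth_rep u)" "abs_L2 (smooth_rep u) = u"
    by (simp_all add: smooth_rep_def)
qed

lemma test_L2I: "test_function \<phi> \<Longrightarrow> abs_L2 \<phi> \<in> test_L2"
  by (auto simp: test_L2_def)

lemma smooth_rep_abs: 
  assumes "test_function \<phi>"
  shows "smooth_rep (abs_L2 \<phi>) = \<phi>"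
proof (rule continuous_AE_eq)
  note n = smooth_rep[OF test_L2I[OF assms]]
  show "continuous_on UNIV (smooth_rep (abs_L2 \<phi>))" "continuous_on UNIV \<phi>"
    using n assms by (auto intro: test_function_continuous)
  show "AE x in lebesgue. smooth_rep (abs_L2 \<phi>) x = \<phi> x"
    using n assms abs_L2_eq_iff test_function_D by blast
qed

lemma smooth_rep_lincomb:
  assumes "u \<in> test_L2" "v \<in> test_L2"
  shows "a *\<^sub>C u + b *\<^sub>C v \<in> test_L2"
    "smooth_rep (a *\<^sub>C u + b *\<^sub>C v) = (\<lambda>x. a * smooth_rep u x + b * smooth_rep v x)"
proof -
  note n = smooth_rep[OF assms(1)] smooth_rep[OF assms(2)]
  let ?\<phi> = "\<lambda>x. a * smooth_rep u x + b * smooth_rep v x"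
  have test_function: "test_function ?\<phi>" using n by (intro test_function_lincomb)
  have "a *\<^sub>C abs_L2 (smooth_rep u) + b *\<^sub>C abs_L2 (smooth_rep v) = abs_L2 ?\<phi>"
    by (simp only: scaleC_abs_L2 add_abs_L2 square_integrable_scale test_function_D(2)[OF n(1)] test_function_D(2)[OF n(3)])
  then have eq: "a *\<^sub>C u + b *\<^sub>C v = abs_L2 ?\<phi>" using n by simp
  show "a *\<^sub>C u + b *\<^sub>C v \<in> test_L2" unfolding eq by (rule test_L2I[OF test_function])
  show "smooth_rep (a *\<^sub>C u + b *\<^sub>C v) = ?\<phi>" unfolding eq by (rule smooth_rep_abs[OF test_function])
qed

lemma csubspace_test_L2: "csubspace test_L2"
proof -
  have z: "0 \<in> test_L2"
    using smooth_rep_lincomb(1)[of "abs_L2 (bump 0)" "abs_L2 (bump 0)" 0 0] test_L2I[OF test_function_bump] by simp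
  show ?thesis
    unfolding complex_vector.subspace_def
    using z smooth_rep_lincomb(1)[of _ _ 1 1] smooth_rep_lincomb(1)[of _ _ _ 0]
    by (auto simp: scaleC_one)
qed

text \<open>
  The norm of \<open>C\<^sup>n\<close>, evaluated at the smooth representative.
\<close>
definition Cnorm :: "nat \<Rightarrow> L2 \<Rightarrow> real" where
  "Cnorm n u = (\<Sum>i\<le>n. (SUP x. cmod (nth_deriv i (smooth_rep u) x)))"

lemma bdd_above_nth_deriv:
  assumes "smooth_C0 \<phi>"
  shows "bdd_above (range (\<lambda>x. cmod (nth_deriv i \<phi> x)))"
proof -
  obtain B where "\<And>x. cmod (nth_deriv i \<phi> x) \<le> B" using C0_bounded[OF smooth_C0_D(2)[OF assms]] by metis
  then show ?thesis by (intro bdd_aboveI2)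
qed

lemma smooth_C0_smooth_rep: "u \<in> test_L2 \<Longrightarrow> smooth_C0 (smooth_rep u)"
  using smooth_rep by (simp add: test_function_def)

lemma nth_deriv_le_sup:
  assumes "u \<in> test_L2"
  shows "cmod (nth_deriv i (smooth_rep u) x) \<le> (SUP x. cmod (nth_deriv i (smooth_rep u) x))"
  using assms by (intro cSUP_upper bdd_above_nth_deriv smooth_C0_smooth_rep) auto

lemma sup_nth_deriv_nonneg: "u \<in> test_L2 \<Longrightarrow> 0 \<le> (SUP x. cmod (nth_deriv i (smooth_rep u) x))"
  by (rule order_trans[OF norm_ge_zero nth_deriv_le_sup])

lemma Cnorm_nonneg: "u \<in> test_L2 \<Longrightarrow> 0 \<le> Cnorm n u"
  unfolding Cnorm_def by (intro sum_nonneg sup_nth_deriv_nonneg)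

lemma Cnorm_mono: "u \<in> test_L2 \<Longrightarrow> m \<le> n \<Longrightarrow> Cnorm m u \<le> Cnorm n u"
  unfolding Cnorm_def by (intro sum_mono2 sup_nth_deriv_nonneg) auto

lemma nth_deriv_le_Cnorm:
  assumes "u \<in> test_L2" "i \<le> n"
  shows "cmod (nth_deriv i (smooth_rep u) x) \<le> Cnorm n u"
proof -
  have "cmod (nth_deriv i (smooth_rep u) x) \<le> (SUP x. cmod (nth_deriv i (smooth_rep u) x))"
    by (rule nth_deriv_le_sup[OF assms(1)])
  also have "\<dots> \<le> Cnorm n u"
    unfolding Cnorm_def using assms
    by (intro member_le_sum[where f="\<lambda>i. (SUP x. cmod (nth_deriv i (smooth_rep u) x))"] sup_nth_deriv_nonneg) auto
  finally show ?thesis .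
qed

lemma Cnorm_leI:
  assumes "\<And>i x. i \<le> n \<Longrightarrow> cmod (nth_deriv i (smooth_rep u) x) \<le> B i"
  shows "Cnorm n u \<le> (\<Sum>i\<le>n. B i)"
  unfolding Cnorm_def using assms by (intro sum_mono cSUP_least) auto

lemma Cnorm_lincomb:
  assumes "u \<in> test_L2" "v \<in> test_L2"
  shows "Cnorm n (a *\<^sub>C u + b *\<^sub>C v) \<le> cmod a * Cnorm n u + cmod b * Cnorm n v"
proof -
  have "Cnorm n (a *\<^sub>C u + b *\<^sub>C v) \<le> (\<Sum>i\<le>n. cmod a * (SUP x. cmod (nth_deriv i (smooth_rep u) x))
      + cmod b * (SUP x. cmod (nth_deriv i (smooth_rep v) x)))"
  proof (rule Cnorm_leI)
    fix i x
    have "cmod (nth_deriv i (smooth_rep (a *\<^sub>C u + b *\<^sub>C v)) x)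
        = cmod (a * nth_deriv i (smooth_rep u) x + b * nth_deriv i (smooth_rep v) x)"
      using assms by (simp add: smooth_rep_lincomb smooth_C0_lincomb smooth_C0_smooth_rep)
    also have "\<dots> \<le> cmod a * cmod (nth_deriv i (smooth_rep u) x) + cmod b * cmod (nth_deriv i (smooth_rep v) x)"
      by (rule norm_triangle_le) (simp add: norm_mult)
    also have "\<dots> \<le> cmod a * (SUP x. cmod (nth_deriv i (smooth_rep u) x)) + cmod b * (SUP x. cmod (nth_deriv i (smooth_rep v) x))"
      by (intro add_mono mult_left_mono nth_deriv_le_sup assms) auto
    finally show "cmod (nth_deriv i (smooth_rep (a *\<^sub>C u + b *\<^sub>C v)) x) \<le> \<dots>" .
  qed
  then show ?thesis by (simp add: Cnorm_def sum.distrib sum_distrib_left)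
qed

lemma seminorm_on_Cnorm: "seminorm_on test_L2 (Cnorm n)"
  unfolding seminorm_on_def
proof (intro conjI ballI allI)
  fix u v assume "u \<in> test_L2" "v \<in> test_L2"
  then show "Cnorm n (u + v) \<le> Cnorm n u + Cnorm n v"
    using Cnorm_lincomb[of u v n 1 1] by (simp add: scaleC_one)
next
  fix c u assume u: "u \<in> test_L2"
  have le: "Cnorm n (c *\<^sub>C u) \<le> cmod c * Cnorm n u" if "u \<in> test_L2" for c u
    using Cnorm_lincomb[OF that that, of n c 0] by simp
  show "Cnorm n (c *\<^sub>C u) = cmod c * Cnorm n u"
  proof (cases "c = 0")
    case True
    have "0 *\<^sub>C u \<in> test_L2" by (intro complex_vector.subspace_scale csubspace_test_L2 u)
    from Cnorm_nonneg[OF this, of n] le[OF u, of 0] True show ?thesis by simp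
  next
    case False
    have cu: "c *\<^sub>C u \<in> test_L2" by (intro complex_vector.subspace_scale csubspace_test_L2 u)
    have "Cnorm n u = Cnorm n ((1 / c) *\<^sub>C c *\<^sub>C u)" using False by (simp add: scaleC_scaleC scaleC_one)
    also have "\<dots> \<le> cmod (1 / c) * Cnorm n (c *\<^sub>C u)" by (rule le[OF cu])
    finally have "cmod c * Cnorm n u \<le> Cnorm n (c *\<^sub>C u)"
      using False by (simp add: norm_divide field_simps)
    with le[OF u, of c] show ?thesis by simp
  qed
qed

text \<open>
  The factor preserves the \<open>L\<^sub>2\<close> norm under the dilation by \<open>k + 1\<close>, while the sup norms of the function
  and of all its derivatives tend to zero.
\<close>
definition wide_bump :: "nat \<Rightarrow> real \<Rightarrow> complex" where
  "wide_bump k x = complex_of_real (sqrt (1 / Suc k)) * bump 0 (0 + (1 / Suc k) * x)"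

lemma test_function_wide_bump: "test_function (wide_bump k)"
  unfolding wide_bump_def by (intro test_function_affine test_function_bump) auto

lemma norm_wide_bump: "norm (abs_L2 (wide_bump k)) = norm (abs_L2 (bump 0))"
proof -
  have sq: "square_integrable (wide_bump k)" "square_integrable (bump 0)"
    using test_function_wide_bump test_function_bump by (auto intro: test_function_D)
  let ?c = "1 / real (Suc k)"
  have "(LINT x|lebesgue. (cmod (wide_bump k x))\<^sup>2) = (LINT x|lebesgue. ?c * (cmod (bump 0 (0 + ?c * x)))\<^sup>2)"
    by (intro Bochner_Integration.integral_cong refl) 
      (simp add: wide_bump_def norm_mult power_mult_distrib real_sqrt_pow2 del: of_nat_Suc)
  also have "\<dots> = \<bar>?c\<bar> *\<^sub>R (LINT x|lebesgue. (cmod (bump 0 (0 + ?c * x)))\<^sup>2)" by simp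
  also have "\<dots> = (LINT x|lebesgue. (cmod (bump 0 x))\<^sup>2)"
    by (rule lebesgue_integral_real_affine[symmetric]) simp
  finally have "(norm (abs_L2 (wide_bump k)))\<^sup>2 = (norm (abs_L2 (bump 0)))\<^sup>2"
    using sq by (simp add: norm_abs_L2)
  then show ?thesis by (simp add: power2_eq_iff_nonneg)
qed

lemma norm_abs_L2_bump: "norm (abs_L2 (bump k)) > 0"
proof -
  have "abs_L2 (bump k) \<noteq> 0"
  proof
    assume "abs_L2 (bump k) = 0"
    then have ae: "AE x in lebesgue. bump k x = 0"
      using abs_L2_eq_iff[OF test_function_D(2)[OF test_function_bump] square_integrable_zero] by (simp add: zero_L2_def)
    have "bump k = (\<lambda>x. 0)"
      by (rule continuous_AE_eq[OF test_function_continuous[OF test_function_bump] continuous_on_const ae])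
    then have "bump k 0 = 0" by simp
    then show False by (simp add: bump_def)
  qed
  then show ?thesis by simp
qed

lemma sqrt_inverse_tendsto_0: "(\<lambda>k. sqrt (1 / Suc k)) \<longlonglongrightarrow> 0"
proof -
  have "(\<lambda>k. sqrt (1 / Suc k)) \<longlonglongrightarrow> sqrt 0"
    by (intro tendsto_real_sqrt LIMSEQ_Suc[OF lim_1_over_n])
  then show ?thesis by simp
qed

lemma Cnorm_wide_bump: "(\<lambda>k. Cnorm n (abs_L2 (wide_bump k))) \<longlonglongrightarrow> 0"
proof (rule tendsto_sandwich[OF _ _ tendsto_const])
  let ?u = "abs_L2 (bump 0)"
  show "\<forall>\<^sub>F k in sequentially. 0 \<le> Cnorm n (abs_L2 (wide_bump k))"
    by (intro always_eventually allI Cnorm_nonneg test_L2I test_function_wide_bump)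
  show "\<forall>\<^sub>F k in sequentially. Cnorm n (abs_L2 (wide_bump k)) \<le> sqrt (1 / Suc k) * Cnorm n ?u"
  proof (intro always_eventually allI)
    fix k
    have "Cnorm n (abs_L2 (wide_bump k)) \<le> (\<Sum>i\<le>n. sqrt (1 / Suc k) * (SUP x. cmod (nth_deriv i (smooth_rep ?u) x)))"
    proof (rule Cnorm_leI)
      fix i x
      let ?c = "1 / real (Suc k)"
      have "cmod (nth_deriv i (smooth_rep (abs_L2 (wide_bump k))) x)
          = cmod (of_real (sqrt ?c) * of_real (?c ^ i) * nth_deriv i (bump 0) (0 + ?c * x))"
        unfolding smooth_rep_abs[OF test_function_wide_bump] wide_bump_def
        by (subst smooth_C0_affine(2)[OF smooth_C0_bump]) auto
      also have "\<dots> = sqrt ?c * (?c ^ i * cmod (nth_deriv i (bump 0) (0 + ?c * x)))"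
        unfolding norm_mult norm_of_real by (simp del: of_nat_Suc)
      also have "\<dots> \<le> sqrt ?c * (1 * cmod (nth_deriv i (bump 0) (0 + ?c * x)))"
        by (intro mult_left_mono mult_right_mono power_le_one) auto
      also have "\<dots> \<le> sqrt ?c * (SUP x. cmod (nth_deriv i (smooth_rep ?u) x))"
        unfolding mult_1 smooth_rep_abs[OF test_function_bump]
        by (intro mult_left_mono cSUP_upper bdd_above_nth_deriv smooth_C0_bump) auto
      finally show "cmod (nth_deriv i (smooth_rep (abs_L2 (wide_bump k))) x)
         \<le> sqrt ?c * (SUP x. cmod (nth_deriv i (smooth_rep ?u) x))" .
    qed
    then show "Cnorm n (abs_L2 (wide_bump k)) \<le> sqrt (1 / Suc k) * Cnorm n ?u"
      by (simp add: Cnorm_def sum_distrib_left)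
  qed
  have "(\<lambda>k. sqrt (1 / Suc k) * Cnorm n ?u) \<longlonglongrightarrow> 0 * Cnorm n ?u"
    by (intro tendsto_mult sqrt_inverse_tendsto_0 tendsto_const)
  then show "(\<lambda>k. sqrt (1 / Suc k) * Cnorm n ?u) \<longlonglongrightarrow> 0" by simp
qed

lemma wide_bump_weakly_null:
  assumes "v \<in> test_L2"
  shows "(\<lambda>k. cinner (abs_L2 (wide_bump k)) v) \<longlonglongrightarrow> 0"
proof (rule Lim_null_comparison)
  let ?\<phi> = "smooth_rep v"
  note n = smooth_rep[OF assms]
  let ?I = "LINT x|lebesgue. cmod (?\<phi> x)"
  show "\<forall>\<^sub>F k in sequentially. norm (cinner (abs_L2 (wide_bump k)) v) \<le> sqrt (1 / Suc k) * ?I"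
  proof (intro always_eventually allI)
    fix k
    have "cinner (abs_L2 (wide_bump k)) (abs_L2 ?\<phi>) = (LINT x|lebesgue. wide_bump k x * cnj (?\<phi> x))"
      by (intro cinner_abs_L2 test_function_D test_function_wide_bump n)
    also have "norm \<dots> \<le> (LINT x|lebesgue. norm (wide_bump k x * cnj (?\<phi> x)))"
      by (rule integral_norm_bound)
    also have "\<dots> \<le> (LINT x|lebesgue. sqrt (1 / Suc k) * cmod (?\<phi> x))"
    proof (rule integral_mono)
      show "integrable lebesgue (\<lambda>x. norm (wide_bump k x * cnj (?\<phi> x)))"
        by (intro integrable_norm square_integrable_cinner test_function_D test_function_wide_bump n)
      show "integrable lebesgue (\<lambda>x. sqrt (1 / Suc k) * cmod (?\<phi> x))"
        by (intro integrable_mult_right integrable_norm test_function_D n)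
      fix x
      have "norm (wide_bump k x) \<le> sqrt (1 / Suc k) * 1"
        unfolding wide_bump_def norm_mult norm_of_real by (intro mult_mono norm_bump_le_1) auto
      then show "norm (wide_bump k x * cnj (?\<phi> x)) \<le> sqrt (1 / Suc k) * cmod (?\<phi> x)"
        unfolding norm_mult complex_mod_cnj by (intro mult_right_mono) auto
    qed
    also have "\<dots> = sqrt (1 / Suc k) * ?I" by simp
    finally show "norm (cinner (abs_L2 (wide_bump k)) v) \<le> sqrt (1 / Suc k) * ?I" using n by simp
  qed
  have "(\<lambda>k. sqrt (1 / Suc k) * ?I) \<longlonglongrightarrow> 0 * ?I"
    by (intro tendsto_mult sqrt_inverse_tendsto_0 tendsto_const)
  then show "(\<lambda>k. sqrt (1 / Suc k) * ?I) \<longlonglongrightarrow> 0" by simp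
qed

lemma test_L2_total_seq:
  obtains d :: "nat \<Rightarrow> L2" where "\<And>n. d n \<in> test_L2" "total_seq d"
proof -
  define I where "I = {(a, b, k). a \<in> \<rat> \<and> b \<in> \<rat> \<and> a < (b::real)} \<inter> (\<rat> \<times> \<rat> \<times> (UNIV :: nat set))"
  define \<phi> where "\<phi> = (\<lambda>(a, b, k) x. 1 * bump k (- (a + b) / (b - a) + 2 / (b - a) * x))"
  have cI: "countable I" unfolding I_def by (intro countable_Int2 countable_SIGMA countable_rat) auto
  have "(0, 1, 0) \<in> I" by (auto simp: I_def)
  then have ne: "I \<noteq> {}" by auto
  define d where "d n = abs_L2 (\<phi> (from_nat_into I n))" for n
  have test_function: "test_function (\<phi> i)" if "i \<in> I" for i
  proof -
    obtain a b k where i: "i = (a, b, k)" by (cases i)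
    then have "a < b" using that by (simp add: I_def)
    then show ?thesis unfolding i
      using test_function_affine[OF test_function_bump, of "2 / (b - a)" 1 k "- (a + b) / (b - a)"] by (simp add: \<phi>_def)
  qed
  have "d n \<in> test_L2" for n
    unfolding d_def by (intro test_L2I test_function from_nat_into ne)
  moreover have "total_seq d"
    unfolding total_seq_def
  proof (intro allI impI)
    fix u assume u: "\<forall>n. cinner u (d n) = 0"
    have "AE x in lebesgue. rep_L2 u x = 0"
    proof (rule AE_zero_if_orthogonal_to_bumps[OF square_integrable_rep_L2])
      fix a b :: real and k assume "a \<in> \<rat>" "b \<in> \<rat>" "a < b"
      then have i: "(a, b, k) \<in> I" by (auto simp: I_def)
      then obtain n where "from_nat_into I n = (a, b, k)" using from_nat_into_surj[OF cI] by metis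
      then have "cinner u (abs_L2 (\<phi> (a, b, k))) = 0" using u by (metis d_def)
      then have "cinner (abs_L2 (rep_L2 u)) (abs_L2 (\<phi> (a, b, k))) = 0" by simp
      then show "(LINT x|lebesgue. rep_L2 u x * cnj (bump k (- (a + b) / (b - a) + 2 / (b - a) * x))) = 0"
        by (subst (asm) cinner_abs_L2[OF square_integrable_rep_L2 test_function_D(2)[OF test_function[OF i]]]) (simp add: \<phi>_def)
    qed
    then have "abs_L2 (rep_L2 u) = abs_L2 (\<lambda>x. 0)"
      by (subst abs_L2_eq_iff) (auto simp: square_integrable_rep_L2)
    then show "u = 0" by (simp add: zero_L2_def)
  qed
  ultimately show ?thesis using that by blast
qed

section \<open>Normally convergent series\<close>

lemma C0_sum:
  fixes h :: "nat \<Rightarrow> 'a::topological_space \<Rightarrow> 'b::real_normed_vector"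
  assumes "\<And>i. i < n \<Longrightarrow> C0 (h i)"
  shows "C0 (\<lambda>x. \<Sum>i<n. h i x)"
  using assms
proof (induction n)
  case 0
  then show ?case by (auto simp: C0_def intro!: exI[of _ "{}"])
qed (auto intro: C0_add)

lemma C0_series:
  fixes h :: "nat \<Rightarrow> 'a::topological_space \<Rightarrow> 'b::banach"
  assumes h: "\<And>n. C0 (h n)" and B: "\<And>n x. norm (h n x) \<le> B n" "summable B"
  shows "C0 (\<lambda>x. \<Sum>n. h n x)"
proof -
  have ul: "uniform_limit UNIV (\<lambda>n x. \<Sum>i<n. h i x) (\<lambda>x. \<Sum>n. h n x) sequentially"
    using B by (intro Weierstrass_m_test) auto
  have c: "continuous_on UNIV (\<lambda>x. \<Sum>n. h n x)"
    by (rule uniform_limit_theorem[OF always_eventually[OF allI[OF C0_continuous[OF C0_sum[OF h]]]] ul])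
      simp
  show ?thesis
    unfolding C0_def
  proof (intro conjI allI impI c)
    fix e :: real assume "e > 0"
    then have e: "e / 2 > 0" by simp
    from uniform_limitD[OF ul e] obtain n where n: "\<And>x. dist (\<Sum>i<n. h i x) (\<Sum>n. h n x) < e / 2"
      by (auto simp: eventually_sequentially)
    have "C0 (\<lambda>x. \<Sum>i<n. h i x)" by (rule C0_sum[OF h])
    with e obtain X where X: "compact X" "\<And>x. x \<notin> X \<Longrightarrow> norm (\<Sum>i<n. h i x) < e / 2"
      unfolding C0_def by meson
    have "norm (\<Sum>n. h n x) < e" if "x \<notin> X" for x
      using n[of x] X(2)[OF that] norm_triangle_sub[of "\<Sum>n. h n x" "\<Sum>i<n. h i x"]
      by (simp add: dist_norm norm_minus_commute)
    then show "\<exists>X. compact X \<and> (\<forall>x. x \<notin> X \<longrightarrow> norm (\<Sum>n. h n x) < e)" using X(1) by blast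
  qed
qed

lemma has_vector_derivative_suminf:
  fixes h :: "nat \<Rightarrow> real \<Rightarrow> 'b::banach"
  assumes d: "\<And>n x. (h n has_vector_derivative h' n x) (at x)"
    and B: "\<And>n x. norm (h' n x) \<le> B n" "summable B" and s: "\<And>x. summable (\<lambda>n. h n x)"
  shows "((\<lambda>x. \<Sum>n. h n x) has_vector_derivative (\<Sum>n. h' n x)) (at x)"
proof -
  have ul: "uniform_limit UNIV (\<lambda>n x. \<Sum>i<n. h' i x) (\<lambda>x. \<Sum>n. h' n x) sequentially"
    using B by (intro Weierstrass_m_test) auto
  have "\<exists>g. \<forall>x\<in>UNIV. (\<lambda>n. h n x) sums (g x) \<and> (g has_derivative (\<lambda>r. r *\<^sub>R (\<Sum>n. h' n x))) (at x within UNIV)"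
  proof (rule has_derivative_series[where f' = "\<lambda>n x r. r *\<^sub>R h' n x"])
    show "(h n has_derivative (\<lambda>r. r *\<^sub>R h' n x)) (at x within UNIV)" for n x
      using d by (simp add: has_vector_derivative_def)
    show "(\<lambda>n. h n x) sums (\<Sum>n. h n x)" by (rule summable_sums[OF s])
    fix e :: real assume "e > 0"
    from uniform_limitD[OF ul this]
    show "\<forall>\<^sub>F n in sequentially. \<forall>x\<in>UNIV. \<forall>r. norm ((\<Sum>i<n. r *\<^sub>R h' i x) - r *\<^sub>R (\<Sum>n. h' n x)) \<le> e * norm r"
    proof eventually_elim
      case (elim n)
      show ?case
      proof (intro ballI allI)
        fix x r
        have "norm ((\<Sum>i<n. r *\<^sub>R h' i x) - r *\<^sub>R (\<Sum>n. h' n x)) = \<bar>r\<bar> * dist (\<Sum>i<n. h' i x) (\<Sum>n. h' n x)"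
          by (simp add: dist_norm flip: scaleR_sum_right scaleR_diff_right)
        also have "\<dots> \<le> \<bar>r\<bar> * e" using elim by (intro mult_left_mono) (auto intro: less_imp_le)
        finally show "norm ((\<Sum>i<n. r *\<^sub>R h' i x) - r *\<^sub>R (\<Sum>n. h' n x)) \<le> e * norm r" by (simp add: mult.commute)
      qed
    qed
  qed auto
  then obtain g where g: "\<And>x. (\<lambda>n. h n x) sums (g x)" "\<And>x. (g has_derivative (\<lambda>r. r *\<^sub>R (\<Sum>n. h' n x))) (at x)"
    by auto
  have "g = (\<lambda>x. \<Sum>n. h n x)" using g(1) by (auto simp: sums_iff)
  then show ?thesis using g(2)[of x] by (simp add: has_vector_derivative_def)
qed

lemma derivs_C0_I:
  assumes "\<And>i. C0 (d i)" "\<And>i s. (d i has_vector_derivative d (Suc i) s) (at s)"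
  shows "derivs_C0 m (d i)"
proof (induction m arbitrary: i)
  case (Suc m)
  then show ?case using assms by (auto intro!: exI[of _ "d (Suc i)"])
qed (simp add: assms)

lemma partials_C0_I:
  assumes "\<And>i j. C0 (F i j)"
    and "\<And>i j s t. ((\<lambda>x. F i j (x, t)) has_vector_derivative F (Suc i) j (s, t)) (at s)"
    and "\<And>i j s t. ((\<lambda>y. F i j (s, y)) has_vector_derivative F i (Suc j) (s, t)) (at t)"
  shows "partials_C0 m (F i j)"
proof (induction m arbitrary: i j)
  case (Suc m)
  then show ?case 
    unfolding partials_C0.simps using assms
    by (intro conjI exI[of _ "F (Suc i) j", OF exI[of _ "F i (Suc j)"]]) auto
qed (simp add: assms)

section \<open>Simultaneous construction of the bases\<close>

lemma ortho_proj_Suc: "ortho_proj f (Suc n) x = ortho_proj f n x + cinner x (f n) *\<^sub>C f n"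
  by (simp add: ortho_proj_def)

lemma ortho_proj_cong: "(\<And>i. i < n \<Longrightarrow> f i = g i) \<Longrightarrow> ortho_proj f n x = ortho_proj g n x"
  by (simp add: ortho_proj_def)

lemma orthonormal_belowI:
  assumes "\<And>i. i < n \<Longrightarrow> norm (f i) = 1" "\<And>i j. j < i \<Longrightarrow> i < n \<Longrightarrow> cinner (f i) (f j) = 0"
  shows "orthonormal_below f n"
  unfolding orthonormal_below_def
proof (intro allI impI)
  fix i j assume "i < n" "j < n"
  then show "cinner (f i) (f j) = (if i = j then 1 else 0)"
    using assms(1)[of i] assms(2)[of i j] assms(2)[of j i] cinner_eq_zero_commute[of "f i" "f j"]
    by (cases i j rule: linorder_cases) (auto simp: cinner_self)
qed

lemma total_seq_if_ortho_proj:
  assumes d: "total_seq d" and p: "\<And>k. d k = ortho_proj f (n k) (d k)"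
  shows "total_seq f"
  unfolding total_seq_def
proof (intro allI impI)
  fix x assume x: "\<forall>n. cinner x (f n) = 0"
  have "cinner x (d k) = 0" for k
  proof -
    have "cinner x (ortho_proj f (n k) (d k)) = 0" using x by (simp add: ortho_proj_def cinner_simps)
    then show ?thesis using p[of k] by simp
  qed
  then show "x = 0" using d by (auto simp: total_seq_def)
qed

lemma seminorm_on_norm_operator:
  assumes "linear_operator W A"
  shows "seminorm_on W (\<lambda>x. norm (A x))"
  using assms by (auto simp: seminorm_on_def linear_operator_def norm_scaleC norm_triangle_ineq)

lemma seminorm_on_cinner: "seminorm_on W (\<lambda>x. cmod (cinner y x))"
  by (auto simp: seminorm_on_def cinner_simps norm_mult norm_triangle_ineq)

lemma prod3_le:
  assumes "0 \<le> a" "0 \<le> b" "0 \<le> c" "a \<le> x" "b \<le> y" "c \<le> z" "x * y * z = (r::real)"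
  shows "a * b * c \<le> r"
  using assms mult_mono[of "a * b" "x * y" c z] mult_mono[of a x b y] by auto

text \<open>
  The quantities controlled at step \<open>n\<close> are those of the two double series in which \<open>n\<close> is the larger
  index.  They are measured in the norm of order \<open>n\<close>: for fixed order \<open>p\<close> this bounds all terms with an
  index \<open>n \<ge> p\<close>.  The second of the four bounds, without the factor for \<open>u\<^sub>i\<close>, gives the
  convergence of each single row \<open>g\<^sub>i\<close>.
\<close>
definition basis_bounds :: "('h::complex_inner \<Rightarrow> 'h) \<Rightarrow> (nat \<Rightarrow> 'h) \<Rightarrow> (nat \<Rightarrow> L2) \<Rightarrow> nat \<Rightarrow> bool" where
  "basis_bounds A f u n \<longleftrightarrow> norm (A (f n)) * Cnorm n (u n) \<le> (1/4) ^ n \<and>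
     (\<forall>i\<le>n. cmod (cinner (A (f i)) (f n)) * Cnorm n (u n) \<le> (1/4) ^ n \<and>
       cmod (cinner (A (f i)) (f n)) * Cnorm n (u i) * Cnorm n (u n) \<le> (1/4) ^ n \<and>
       cmod (cinner (A (f n)) (f i)) * Cnorm n (u n) * Cnorm n (u i) \<le> (1/4) ^ n)"

text \<open>
  In every product one factor is at most \<open>\<epsilon>\<close> and the two others are at most \<open>M\<close>, and
  \<open>\<epsilon> M\<^sup>2 = 4\<^sup>-\<^sup>n\<close>.  Here \<open>M\<close> depends only on the \<open>u\<^sub>i\<close>, which are known before \<open>f\<^sub>n\<close> is chosen.
\<close>
lemma basis_bounds_small_f:
  fixes A :: "'h::complex_inner \<Rightarrow> 'h"
  assumes f: "\<And>i. i \<le> n \<Longrightarrow> norm (f i) = 1" and u: "\<And>i. i \<le> n \<Longrightarrow> u i \<in> test_L2"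
    and M: "M = 1 + (\<Sum>i\<le>n. Cnorm n (u i))" and \<epsilon>: "\<epsilon> = (1/4) ^ n / M\<^sup>2"
    and small: "norm (A (f n)) \<le> \<epsilon>" "\<And>i. i < n \<Longrightarrow> cmod (cinner (A (f i)) (f n)) \<le> \<epsilon>"
  shows "basis_bounds A f u n"
proof -
  have N0: "0 \<le> Cnorm n (u i)" if "i \<le> n" for i by (intro Cnorm_nonneg u that)
  have NM: "Cnorm n (u i) \<le> M" if "i \<le> n" for i
    unfolding M using member_le_sum[of i "{..n}" "\<lambda>i. Cnorm n (u i)"] N0 that by auto
  have "0 \<le> (\<Sum>i\<le>n. Cnorm n (u i))" using N0 by (intro sum_nonneg) auto
  then have M1: "1 \<le> M" by (simp add: M)
  have r: "\<epsilon> * M * M = (1/4) ^ n" using M1 by (simp add: \<epsilon> power2_eq_square)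
  have Sf: "cmod (cinner (A (f n)) (f i)) \<le> \<epsilon>" if "i \<le> n" for i
    using Cauchy_Schwarz_cinner[of "A (f n)" "f i"] f[OF that] small(1) by simp
  have fS: "cmod (cinner (A (f i)) (f n)) \<le> \<epsilon>" if "i \<le> n" for i
    using small(2)[of i] Sf[of n] that by (cases "i = n") auto
  note m = prod3_le[OF _ _ _ _ _ _ r]
  show ?thesis
    unfolding basis_bounds_def
  proof (intro conjI allI impI)
    show "norm (A (f n)) * Cnorm n (u n) \<le> (1/4) ^ n"
      using m[of "norm (A (f n))" "Cnorm n (u n)" 1] N0 NM M1 small(1) by simp
    fix i assume i: "i \<le> n"
    show "cmod (cinner (A (f i)) (f n)) * Cnorm n (u n) \<le> (1/4) ^ n"
      using m[of "cmod (cinner (A (f i)) (f n))" "Cnorm n (u n)" 1] N0 NM M1 fS[OF i] by simp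
    show "cmod (cinner (A (f i)) (f n)) * Cnorm n (u i) * Cnorm n (u n) \<le> (1/4) ^ n"
      using fS[OF i] i by (intro m N0 NM) auto
    show "cmod (cinner (A (f n)) (f i)) * Cnorm n (u n) * Cnorm n (u i) \<le> (1/4) ^ n"
      using Sf[OF i] i by (intro m N0 NM) auto
  qed
qed

text \<open>
  The same estimate with the roles exchanged: \<open>M\<close> depends on \<open>f\<^sub>n\<close> but not on \<open>u\<^sub>n\<close>.
\<close>
lemma basis_bounds_small_u:
  fixes A :: "'h::complex_inner \<Rightarrow> 'h"
  assumes f: "\<And>i. i \<le> n \<Longrightarrow> norm (f i) = 1" and u: "\<And>i. i \<le> n \<Longrightarrow> u i \<in> test_L2"
    and M: "M = 1 + (\<Sum>i\<le>n. norm (A (f i))) + (\<Sum>i<n. Cnorm n (u i))" and \<epsilon>: "\<epsilon> = (1/4) ^ n / M\<^sup>2"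
    and small: "Cnorm n (u n) \<le> \<epsilon>"
  shows "basis_bounds A f u n"
proof -
  have N0: "0 \<le> Cnorm n (u i)" if "i \<le> n" for i by (intro Cnorm_nonneg u that)
  have s0: "0 \<le> (\<Sum>i\<le>n. norm (A (f i)))" "0 \<le> (\<Sum>i<n. Cnorm n (u i))"
    using N0 by (auto intro!: sum_nonneg)
  then have M1: "1 \<le> M" unfolding M by simp
  have \<epsilon>1: "\<epsilon> \<le> M"
  proof -
    have "\<epsilon> \<le> 1" using M1 by (simp add: \<epsilon> divide_le_eq power_le_one order_trans[OF power_le_one one_le_power])
    with M1 show ?thesis by simp
  qed
  have AM: "norm (A (f i)) \<le> M" if "i \<le> n" for i
    unfolding M using member_le_sum[of i "{..n}" "\<lambda>i. norm (A (f i))"] s0 that by auto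
  have NM: "Cnorm n (u i) \<le> M" if "i \<le> n" for i
  proof (cases "i = n")
    case False
    then show ?thesis
      unfolding M using member_le_sum[of i "{..<n}" "\<lambda>i. Cnorm n (u i)"] N0 s0 that by auto
  qed (use small \<epsilon>1 in simp)
  have r: "M * \<epsilon> * M = (1/4) ^ n" "M * M * \<epsilon> = (1/4) ^ n" using M1 by (simp_all add: \<epsilon> power2_eq_square)
  have Sf: "cmod (cinner (A (f i)) (f j)) \<le> M" if "i \<le> n" "j \<le> n" for i j
    using Cauchy_Schwarz_cinner[of "A (f i)" "f j"] f[OF that(2)] AM[OF that(1)] by simp
  note m = prod3_le[OF _ _ _ _ _ _ r(1)] and m' = prod3_le[OF _ _ _ _ _ _ r(2)]
  show ?thesis
    unfolding basis_bounds_def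
  proof (intro conjI allI impI)
    show "norm (A (f n)) * Cnorm n (u n) \<le> (1/4) ^ n"
      using m[of "norm (A (f n))" "Cnorm n (u n)" 1] N0 AM M1 small by simp
    fix i assume i: "i \<le> n"
    show "cmod (cinner (A (f i)) (f n)) * Cnorm n (u n) \<le> (1/4) ^ n"
      using m[of "cmod (cinner (A (f i)) (f n))" "Cnorm n (u n)" 1] N0 M1 small Sf[OF i order_refl] by simp
    show "cmod (cinner (A (f i)) (f n)) * Cnorm n (u i) * Cnorm n (u n) \<le> (1/4) ^ n"
      using i small by (intro m' N0 NM Sf) auto
    show "cmod (cinner (A (f n)) (f i)) * Cnorm n (u n) * Cnorm n (u i) \<le> (1/4) ^ n"
      using i small by (intro m N0 NM Sf) auto
  qed
qed

text \<open>
  The conditions on step \<open>n\<close> involve \<open>f\<close> and \<open>u\<close> only up to the index \<open>n\<close>, which makes dependent choice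
  applicable.  The two projection equations put the members of the total sequences into the
  spans of the bases and thereby make these total.
\<close>
definition basis_step :: "('h::complex_inner \<Rightarrow> 'h) \<Rightarrow> 'h set \<Rightarrow> (nat \<Rightarrow> 'h) \<Rightarrow> (nat \<Rightarrow> L2) \<Rightarrow>
    (nat \<Rightarrow> 'h) \<Rightarrow> (nat \<Rightarrow> L2) \<Rightarrow> nat \<Rightarrow> bool" where
  "basis_step A W d \<phi> f u n \<longleftrightarrow>
     f n \<in> W \<and> norm (f n) = 1 \<and> (\<forall>i<n. cinner (f n) (f i) = 0) \<and>
     u n \<in> test_L2 \<and> norm (u n) = 1 \<and> (\<forall>i<n. cinner (u n) (u i) = 0) \<and>
     (even n \<longrightarrow> \<phi> (n div 2) = ortho_proj u (Suc n) (\<phi> (n div 2))) \<and>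
     (odd n \<longrightarrow> d (n div 2) = ortho_proj f (Suc n) (d (n div 2))) \<and>
     basis_bounds A f u n"

lemma basis_step_cong:
  assumes "\<And>i. i \<le> n \<Longrightarrow> f i = f' i" "\<And>i. i \<le> n \<Longrightarrow> u i = u' i"
  shows "basis_step A W d \<phi> f u n = basis_step A W d \<phi> f' u' n"
proof -
  have "ortho_proj f (Suc n) = ortho_proj f' (Suc n)" "ortho_proj u (Suc n) = ortho_proj u' (Suc n)"
    using assms by (auto intro!: ext ortho_proj_cong)
  then show ?thesis using assms by (simp add: basis_step_def basis_bounds_def)
qed

lemma basis_step_exists:
  fixes A :: "'h::complex_inner \<Rightarrow> 'h" and f :: "nat \<Rightarrow> 'h" and u :: "nat \<Rightarrow> L2"
  assumes A: "linear_operator W A"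
    and e: "orthonormal_seq e" "\<And>n. e n \<in> W" "(\<lambda>n. norm (A (e n))) \<longlonglongrightarrow> 0"
    and d: "\<And>n. d n \<in> W" and \<phi>: "\<And>n. \<phi> n \<in> test_L2"
    and IH: "\<And>i. i < n \<Longrightarrow> basis_step A W d \<phi> f u i"
  shows "\<exists>v w. basis_step A W d \<phi> (f(n := v)) (u(n := w)) n"
proof -
  have W: "csubspace W" using A by (simp add: linear_operator_def)
  have f: "f i \<in> W" "norm (f i) = 1" "j < i \<Longrightarrow> cinner (f i) (f j) = 0" if "i < n" for i j
    using IH[OF that] by (auto simp: basis_step_def)
  have u: "u i \<in> test_L2" "norm (u i) = 1" "j < i \<Longrightarrow> cinner (u i) (u j) = 0" if "i < n" for i j
    using IH[OF that] by (auto simp: basis_step_def)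
  have of: "orthonormal_below f n" using f by (intro orthonormal_belowI) auto
  have ou: "orthonormal_below u n" using u by (intro orthonormal_belowI) auto
  have small_f: "\<exists>v\<in>W. norm v = 1 \<and> (\<forall>i<n. cinner v (f i) = 0) \<and> norm (A v) < \<epsilon> \<and>
      (\<forall>i<n. cmod (cinner (A (f i)) v) < \<epsilon>)" if "\<epsilon> > 0" for \<epsilon>
  proof -
    let ?Q = "insert (\<lambda>x. norm (A x)) ((\<lambda>i x. cmod (cinner (A (f i)) x)) ` {..<n})"
    have lim: "(\<lambda>k. cmod (cinner (A (f i)) (e k))) \<longlonglongrightarrow> 0" for i
      using orthonormal_weakly_null(1)[OF e(1)] by (rule tendsto_norm_zero)
    obtain v where v: "v \<in> W" "norm v = 1" "\<And>i. i < n \<Longrightarrow> cinner v (f i) = 0" "\<And>q. q \<in> ?Q \<Longrightarrow> q v < \<epsilon>"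
    proof (rule small_orthogonal_vector[OF W e(2) zero_less_one _ of f(1)])
      show "1 \<le> norm (e k)" for k by (simp add: orthonormal_norm[OF e(1)])
      show "(\<lambda>k. cinner (e k) (f i)) \<longlonglongrightarrow> 0" for i by (rule orthonormal_weakly_null(2)[OF e(1)])
      show "finite ?Q" by simp
      show "seminorm_on W q" if "q \<in> ?Q" for q
        using that seminorm_on_norm_operator[OF A] seminorm_on_cinner by auto
      show "(\<lambda>k. q (e k)) \<longlonglongrightarrow> 0" if "q \<in> ?Q" for q using that e(3) lim by auto
    qed (use \<open>\<epsilon> > 0\<close> in auto)
    then show ?thesis by (intro bexI[of _ v]) auto
  qed
  have small_u: "\<exists>w\<in>test_L2. norm w = 1 \<and> (\<forall>i<n. cinner w (u i) = 0) \<and> Cnorm n w < \<epsilon>" if "\<epsilon> > 0" for \<epsilon>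
  proof -
    obtain w where w: "w \<in> test_L2" "norm w = 1" "\<And>i. i < n \<Longrightarrow> cinner w (u i) = 0" "\<And>q. q \<in> {Cnorm n} \<Longrightarrow> q w < \<epsilon>"
    proof (rule small_orthogonal_vector[OF csubspace_test_L2 _ norm_abs_L2_bump _ ou u(1)])
      show "abs_L2 (wide_bump k) \<in> test_L2" for k by (rule test_L2I[OF test_function_wide_bump])
      show "norm (abs_L2 (bump 0)) \<le> norm (abs_L2 (wide_bump k))" for k by (simp add: norm_wide_bump)
      show "(\<lambda>k. cinner (abs_L2 (wide_bump k)) (u i)) \<longlonglongrightarrow> 0" if "i < n" for i by (rule wide_bump_weakly_null[OF u(1)[OF that]])
      show "(\<lambda>k. q (abs_L2 (wide_bump k))) \<longlonglongrightarrow> 0" if "q \<in> {Cnorm n}" for q using that Cnorm_wide_bump by simp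
      show "seminorm_on test_L2 q" if "q \<in> {Cnorm n}" for q using that seminorm_on_Cnorm by simp
    qed (use \<open>\<epsilon> > 0\<close> in auto)
    then show ?thesis by (intro bexI[of _ w]) auto
  qed
  show ?thesis
  proof (cases "even n")
    case True
    obtain w0 where "w0 \<in> test_L2" "norm w0 = 1" "\<And>i. i < n \<Longrightarrow> cinner w0 (u i) = 0"
      using small_u[of 1] by auto
    then obtain w where w: "w \<in> test_L2" "norm w = 1" "\<And>i. i < n \<Longrightarrow> cinner w (u i) = 0"
        "\<phi> (n div 2) = ortho_proj u n (\<phi> (n div 2)) + cinner (\<phi> (n div 2)) w *\<^sub>C w"
      using Gram_Schmidt_step[OF csubspace_test_L2 ou u(1) \<phi>[of "n div 2"]] by metis
    let ?u = "u(n := w)"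
    \<comment> \<open>With \<open>u\<^sub>n\<close> fixed, \<open>M\<close> is known and \<open>f\<^sub>n\<close> can be chosen against it.\<close>
    define M where "M = 1 + (\<Sum>i\<le>n. Cnorm n (?u i))"
    define \<epsilon> where "\<epsilon> = (1/4) ^ n / M\<^sup>2"
    have un: "?u i \<in> test_L2" if "i \<le> n" for i using that u w by (cases "i = n") auto
    have "0 \<le> (\<Sum>i\<le>n. Cnorm n (?u i))" by (intro sum_nonneg Cnorm_nonneg un) auto
    then have "M > 0" by (simp add: M_def)
    then have "\<epsilon> > 0" by (simp add: \<epsilon>_def)
    from small_f[OF this] obtain v where v: "v \<in> W" "norm v = 1" "\<And>i. i < n \<Longrightarrow> cinner v (f i) = 0"
      "norm (A v) < \<epsilon>" "\<And>i. i < n \<Longrightarrow> cmod (cinner (A (f i)) v) < \<epsilon>" by blast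
    have "basis_bounds A (f(n := v)) ?u n"
    proof (rule basis_bounds_small_f[OF _ un M_def \<epsilon>_def])
      show "norm ((f(n := v)) i) = 1" if "i \<le> n" for i using that f v by (cases "i = n") auto
    qed (use v in \<open>auto intro: less_imp_le\<close>)
    moreover have "ortho_proj ?u n x = ortho_proj u n x" for x by (rule ortho_proj_cong) simp
    ultimately have "basis_step A W d \<phi> (f(n := v)) ?u n"
      using v w True by (simp add: basis_step_def ortho_proj_Suc)
    then show ?thesis by blast
  next
    case False
    obtain v0 where "v0 \<in> W" "norm v0 = 1" "\<And>i. i < n \<Longrightarrow> cinner v0 (f i) = 0"
      using small_f[of 1] by auto
    then obtain v where v: "v \<in> W" "norm v = 1" "\<And>i. i < n \<Longrightarrow> cinner v (f i) = 0"
        "d (n div 2) = ortho_proj f n (d (n div 2)) + cinner (d (n div 2)) v *\<^sub>C v"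
      using Gram_Schmidt_step[OF W of f(1) d[of "n div 2"]] by metis
    let ?f = "f(n := v)"
    \<comment> \<open>Now \<open>f\<^sub>n\<close> is fixed and \<open>u\<^sub>n\<close> is chosen against \<open>M\<close>.\<close>
    define M where "M = 1 + (\<Sum>i\<le>n. norm (A (?f i))) + (\<Sum>i<n. Cnorm n (u i))"
    define \<epsilon> where "\<epsilon> = (1/4) ^ n / M\<^sup>2"
    have "0 \<le> (\<Sum>i\<le>n. norm (A (?f i)))" "0 \<le> (\<Sum>i<n. Cnorm n (u i))"
      by (auto intro!: sum_nonneg Cnorm_nonneg u)
    then have "M > 0" by (simp add: M_def)
    then have "\<epsilon> > 0" by (simp add: \<epsilon>_def)
    from small_u[OF this] obtain w where w: "w \<in> test_L2" "norm w = 1" "\<And>i. i < n \<Longrightarrow> cinner w (u i) = 0"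
      "Cnorm n w < \<epsilon>" by blast
    have "basis_bounds A ?f (u(n := w)) n"
    proof (rule basis_bounds_small_u[OF _ _ _ \<epsilon>_def])
      show "norm (?f i) = 1" if "i \<le> n" for i using that f v by (cases "i = n") auto
      show "(u(n := w)) i \<in> test_L2" if "i \<le> n" for i using that u w by (cases "i = n") auto
      show "M = 1 + (\<Sum>i\<le>n. norm (A (?f i))) + (\<Sum>i<n. Cnorm n ((u(n := w)) i))" by (simp add: M_def)
    qed (use w in simp)
    moreover have "ortho_proj ?f n x = ortho_proj f n x" for x by (rule ortho_proj_cong) simp
    ultimately have "basis_step A W d \<phi> ?f (u(n := w)) n"
      using v w False by (simp add: basis_step_def ortho_proj_Suc)
    then show ?thesis by blast
  qed
qed

lemma adapted_bases_exist:
  fixes A :: "'h::complex_inner \<Rightarrow> 'h"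
  assumes A: "linear_operator W A"
    and e: "orthonormal_seq e" "\<And>n. e n \<in> W" "(\<lambda>n. norm (A (e n))) \<longlonglongrightarrow> 0"
    and d: "\<And>n. d n \<in> W" "total_seq d"
  obtains f u where "orthonormal_seq f" "total_seq f" "\<And>n. f n \<in> W"
    "orthonormal_seq u" "total_seq u" "\<And>n. u n \<in> test_L2" "\<And>n. basis_bounds A f u n"
proof -
  obtain \<phi> where \<phi>: "\<And>n. \<phi> n \<in> test_L2" "total_seq \<phi>" by (rule test_L2_total_seq) blast
  define P where "P F n r = basis_step A W d \<phi> ((fst \<circ> F)(n := fst r)) ((snd \<circ> F)(n := snd r)) n" for F n r
  have "\<exists>F. \<forall>n. P F n (F n)"
  proof (rule dependent_wellorder_choice)
    fix r :: "'h \<times> L2" and F G :: "nat \<Rightarrow> 'h \<times> L2" and n :: nat assume "\<And>i. i < n \<Longrightarrow> F i = G i"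
    then show "P F n r = P G n r" unfolding P_def by (intro basis_step_cong) auto
  next
    fix n :: nat and F :: "nat \<Rightarrow> 'h \<times> L2" assume "\<And>i. i < n \<Longrightarrow> P F i (F i)"
    then have "basis_step A W d \<phi> (fst \<circ> F) (snd \<circ> F) i" if "i < n" for i
      using that unfolding P_def by (subst basis_step_cong[of _ _ "(fst \<circ> F)(i := fst (F i))" _ "(snd \<circ> F)(i := snd (F i))"]) auto
    from basis_step_exists[OF A e d(1) \<phi>(1) this] show "\<exists>r. P F n r" unfolding P_def by auto
  qed
  then obtain F where F: "\<And>n. P F n (F n)" by blast
  define f where "f = fst \<circ> F"
  define u where "u = snd \<circ> F"
  have s: "basis_step A W d \<phi> f u n" for n
    using F[of n] unfolding P_def f_def u_def
    by (subst basis_step_cong[of _ _ "(fst \<circ> F)(n := fst (F n))" _ "(snd \<circ> F)(n := snd (F n))"]) auto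
  have below: "orthonormal_below f n" "orthonormal_below u n" for n
    using s by (auto intro!: orthonormal_belowI simp: basis_step_def)
  have ortho: "orthonormal_seq f" "orthonormal_seq u"
    unfolding orthonormal_seq_def
    using below[of "Suc (max _ _)"] unfolding orthonormal_below_def
    by (metis less_Suc_eq_le max.cobounded1 max.cobounded2)+
  have "total_seq f"
  proof (rule total_seq_if_ortho_proj[OF d(2)])
    show "d k = ortho_proj f (Suc (2 * k + 1)) (d k)" for k
      using s[of "2 * k + 1"] by (simp add: basis_step_def)
  qed
  moreover have "total_seq u"
  proof (rule total_seq_if_ortho_proj[OF \<phi>(2)])
    show "\<phi> k = ortho_proj u (Suc (2 * k)) (\<phi> k)" for k
      using s[of "2 * k"] by (simp add: basis_step_def)
  qed
  ultimately show ?thesis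
    using that[of f u] ortho s by (auto simp: basis_step_def)
qed

section \<open>The kernel attached to adapted bases\<close>

lemma unitary_D:
  assumes "unitary U"
  shows "U (x + y) = U x + U y" "U (c *\<^sub>C x) = c *\<^sub>C U x" "cinner (U x) (U y) = cinner x y" "surj U"
  using assms unfolding unitary_def Vector_Spaces.linear_def module_hom_def module_hom_axioms_def by auto

lemma norm_unitary: "unitary U \<Longrightarrow> norm (U x) = norm x"
  using unitary_D(3)[of U x x] by (simp add: cinner_self flip: of_real_power)

lemma scaleC_minus1: "(-1) *\<^sub>C x = - (x :: 'a::complex_inner)"
  using scaleR_scaleC[of "-1" x] by simp

lemma inj_unitary:
  assumes "unitary U"
  shows "inj U"
proof (rule injI)
  fix x y assume "U x = U y"
  have "norm (x - y) = norm (U (x + (-1) *\<^sub>C y))"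
    unfolding norm_unitary[OF assms] by (simp add: scaleC_minus1)
  also have "\<dots> = norm (U x + (-1) *\<^sub>C U x)"
    using \<open>U x = U y\<close> by (simp only: unitary_D[OF assms])
  also have "\<dots> = 0" by (simp add: scaleC_minus1)
  finally show "x = y" by simp
qed

lemma unitary_image_linear_operator:
  assumes U: "unitary U" and S: "linear_operator D S"
  shows "linear_operator (U ` D) (U \<circ> S \<circ> inv U)"
proof -
  have inv: "inv U (U x) = x" for x by (rule inv_f_f[OF inj_unitary[OF U]])
  note u = unitary_D(1,2)[OF U, symmetric]
  have "U 0 = 0" using unitary_D(2)[OF U, of 0 0] by simp
  then show ?thesis
    using S unfolding linear_operator_def complex_vector.subspace_def
    by (auto simp: u inv image_iff intro: exI[of _ 0])
qed

lemma unitary_image_dense: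
  assumes U: "unitary U" and D: "densely_defined D"
  shows "densely_defined (U ` D)"
  unfolding densely_defined_def
proof (intro set_eqI iffI UNIV_I)
  fix y
  obtain x where y: "y = U x" using unitary_D(4)[OF U] by (auto simp: surj_def)
  have dist: "dist (U a) (U b) = dist a b" for a b
  proof -
    have "U a - U b = U (a - b)"
      using unitary_D(1)[OF U, of a "(-1) *\<^sub>C b"] unitary_D(2)[OF U, of "-1" b] by (simp add: scaleC_minus1)
    then show ?thesis by (simp add: dist_norm norm_unitary[OF U])
  qed
  have "x \<in> closure D" using D by (simp add: densely_defined_def)
  then show "y \<in> closure (U ` D)" unfolding closure_approachable y by (auto simp: dist)
qed

lemma C0_tensor:
  fixes f :: "'a::topological_space \<Rightarrow> complex" and g :: "'b::topological_space \<Rightarrow> complex"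
  assumes f: "C0 f" and g: "C0 g"
  shows "C0 (\<lambda>x. f (fst x) * g (snd x))"
  unfolding C0_def
proof (intro conjI allI impI)
  show "continuous_on UNIV (\<lambda>x. f (fst x) * g (snd x))"
    by (intro continuous_on_mult continuous_on_compose2[OF C0_continuous[OF f]]
        continuous_on_compose2[OF C0_continuous[OF g]] continuous_intros) auto
  fix e :: real assume "e > 0"
  obtain B C where B: "\<And>x. norm (f x) \<le> B" and C: "\<And>x. norm (g x) \<le> C"
    using C0_bounded[OF f] C0_bounded[OF g] by metis
  have pos: "0 < \<bar>B\<bar> + 1" "0 < \<bar>C\<bar> + 1" by auto
  have "0 < e / (\<bar>C\<bar> + 1)" "0 < e / (\<bar>B\<bar> + 1)" using \<open>e > 0\<close> pos by auto
  then obtain X Y where X: "compact X" "\<And>x. x \<notin> X \<Longrightarrow> norm (f x) < e / (\<bar>C\<bar> + 1)"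
    and Y: "compact Y" "\<And>x. x \<notin> Y \<Longrightarrow> norm (g x) < e / (\<bar>B\<bar> + 1)"
    using f g unfolding C0_def by meson
  have "norm (f (fst z) * g (snd z)) < e" if "z \<notin> X \<times> Y" for z
  proof (cases "fst z \<in> X")
    case False
    have "norm (f (fst z) * g (snd z)) \<le> norm (f (fst z)) * (\<bar>C\<bar> + 1)"
      unfolding norm_mult using C[of "snd z"] by (intro mult_left_mono) auto
    also have "\<dots> < e" using X(2)[OF False] pos by (simp add: pos_less_divide_eq)
    finally show ?thesis .
  next
    case True
    then have "snd z \<notin> Y" using that by (cases z) auto
    have "norm (f (fst z) * g (snd z)) \<le> (\<bar>B\<bar> + 1) * norm (g (snd z))"
      unfolding norm_mult using B[of "fst z"] by (intro mult_right_mono) auto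
    also have "\<dots> < e" using Y(2)[OF \<open>snd z \<notin> Y\<close>] pos by (simp add: pos_less_divide_eq mult.commute)
    finally show ?thesis .
  qed
  then show "\<exists>X. compact X \<and> (\<forall>x. x \<notin> X \<longrightarrow> norm (f (fst x) * g (snd x)) < e)"
    using compact_Times[OF X(1) Y(1)] by blast
qed

lemma C0_cnj: "C0 f \<Longrightarrow> C0 (\<lambda>x. cnj (f x))"
  by (auto simp: C0_def intro: continuous_on_cnj)

lemma has_vector_derivative_cnj':
  "(f has_vector_derivative f') F \<Longrightarrow> ((\<lambda>x. cnj (f x)) has_vector_derivative cnj f') F"
  by (rule bounded_linear.has_vector_derivative[OF bounded_linear_cnj])

lemma L2_series:
  assumes F: "\<And>n. square_integrable (F n)" and L: "(\<lambda>n. abs_L2 (F n)) sums v"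
    and h: "\<And>x. (\<lambda>n. F n x) sums h x"
  shows "square_integrable h \<and> abs_L2 h = v"
proof (rule L2_pointwise_limit)
  show sq: "square_integrable (\<lambda>x. \<Sum>n<k. F n x)" for k by (intro square_integrable_sum F) auto
  show "(\<lambda>k. abs_L2 (\<lambda>x. \<Sum>n<k. F n x)) \<longlonglongrightarrow> v"
    using L unfolding sums_def by (simp add: sum_abs_L2 F)
  show "AE x in lebesgue. (\<lambda>k. \<Sum>n<k. F n x) \<longlonglongrightarrow> h x" using h by (simp add: sums_def)
  show "h \<in> borel_measurable lebesgue"
    by (rule borel_measurable_LIMSEQ_metric[OF square_integrable_measurable[OF sq]]) (use h in \<open>simp add: sums_def\<close>)
qed

lemma C0_scaleC:
  fixes v :: "'b::complex_inner"
  assumes "C0 h" 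
  shows "C0 (\<lambda>x. h x *\<^sub>C v)"
proof (rule C0_dominated[OF assms])
  show "continuous_on UNIV (\<lambda>x. h x *\<^sub>C v)"
    by (rule bounded_linear.continuous_on[OF bounded_bilinear.bounded_linear_left[OF bounded_bilinear_scaleC] C0_continuous[OF assms]])
  show "norm (h x *\<^sub>C v) \<le> norm v * norm (h x)" for x by (simp add: norm_scaleC mult.commute)
qed

locale adapted_bases =
  fixes A :: "'h::chilbert_space \<Rightarrow> 'h" and f :: "nat \<Rightarrow> 'h" and u :: "nat \<Rightarrow> L2" and U :: "'h \<Rightarrow> L2"
  assumes f: "orthonormal_seq f" "total_seq f" and u: "orthonormal_seq u" "total_seq u"
    and test_u: "\<And>n. u n \<in> test_L2" and bounds: "\<And>n. basis_bounds A f u n"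
    and U: "unitary U" "\<And>n. U (f n) = u n"
begin

abbreviation "N p n \<equiv> Cnorm p (u n)"
definition "a n m = cinner (A (f n)) (f m)"

definition "\<phi> n = smooth_rep (u n)"

lemma \<phi>: "smooth_C0 (\<phi> n)" "square_integrable (\<phi> n)" "abs_L2 (\<phi> n) = u n"
  using smooth_rep[OF test_u[of n]] by (auto simp: \<phi>_def test_function_def)

lemma \<phi>_le: "i \<le> p \<Longrightarrow> cmod (nth_deriv i (\<phi> n) x) \<le> N p n"
  unfolding \<phi>_def by (rule nth_deriv_le_Cnorm[OF test_u])

lemma N_nonneg: "0 \<le> N p n" by (rule Cnorm_nonneg[OF test_u])

lemma N_mono: "p \<le> q \<Longrightarrow> N p n \<le> N q n" by (rule Cnorm_mono[OF test_u])

lemma summable_norm_A: "summable (\<lambda>n. norm (A (f n)) * N p n)"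
proof (rule summable_comparison_test')
  show "summable (\<lambda>n. (1/4::real) ^ n)" by simp
  fix n assume "n \<ge> p"
  then have "norm (A (f n)) * N p n \<le> norm (A (f n)) * N n n" by (intro mult_left_mono N_mono) auto
  also have "\<dots> \<le> (1/4) ^ n" using bounds[of n] by (simp add: basis_bounds_def)
  finally show "norm (norm (A (f n)) * N p n) \<le> (1/4) ^ n" using N_nonneg by simp
qed

lemma summable_a: "summable (\<lambda>m. cmod (a n m) * N p m)"
proof (rule summable_comparison_test')
  show "summable (\<lambda>n. (1/4::real) ^ n)" by simp
  fix m assume m: "m \<ge> max n p"
  then have "cmod (a n m) * N p m \<le> cmod (a n m) * N m m" by (intro mult_left_mono N_mono) auto
  also have "\<dots> \<le> (1/4) ^ m" using bounds[of m] m by (simp add: basis_bounds_def a_def)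
  finally show "norm (cmod (a n m) * N p m) \<le> (1/4) ^ m" using N_nonneg by simp
qed

definition "G p n = (\<Sum>m. cmod (a n m) * N p m)"

text \<open>
  The bound for the larger index \<open>q\<close> is \<open>4\<^sup>-\<^sup>q\<close>, which is at most \<open>2\<^sup>-\<^sup>n 2\<^sup>-\<^sup>m\<close>; this separates the double
  series into a product of two geometric ones.
\<close>
lemma double_bound:
  assumes "p \<le> n"
  shows "N p n * (cmod (a n m) * N p m) \<le> (1/2) ^ n * (1/2) ^ m"
proof -
  define q where "q = max n m"
  have q: "p \<le> q" "n \<le> q" "m \<le> q" using assms by (auto simp: q_def)
  have "cmod (a n m) * N q n * N q m \<le> (1/4) ^ q"
  proof (cases "m \<le> n")
    case True
    then show ?thesis using bounds[of n] by (auto simp: basis_bounds_def q_def a_def max_def)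
  next
    case False
    then show ?thesis using bounds[of m] by (auto simp: basis_bounds_def q_def a_def max_def)
  qed
  moreover have "N p n * (cmod (a n m) * N p m) \<le> N q n * (cmod (a n m) * N q m)"
    using q by (intro mult_mono N_mono mult_nonneg_nonneg N_nonneg) auto
  moreover have "(1/4) ^ q \<le> (1/2) ^ n * (1/2::real) ^ m"
  proof -
    have "(1/4) ^ q = ((1/2) ^ q * (1/2) ^ q :: real)" by (simp flip: power_mult_distrib)
    also have "\<dots> \<le> (1/2) ^ n * (1/2) ^ m" using q by (intro mult_mono power_decreasing) auto
    finally show ?thesis .
  qed
  ultimately show ?thesis by (simp add: mult_ac)
qed

lemma summable_G: "summable (\<lambda>n. N p n * G p n)"
proof (rule summable_comparison_test')
  show "summable (\<lambda>n. (1/2::real) ^ n * 2)" by (intro summable_mult2) simp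
  fix n assume n: "n \<ge> p"
  have G0: "0 \<le> G p n" unfolding G_def by (intro suminf_nonneg summable_a mult_nonneg_nonneg N_nonneg) auto
  have "N p n * G p n = (\<Sum>m. N p n * (cmod (a n m) * N p m))"
    unfolding G_def by (rule suminf_mult[OF summable_a, symmetric])
  also have "\<dots> \<le> (\<Sum>m. (1/2) ^ n * (1/2) ^ m)"
    by (intro suminf_le double_bound n summable_mult summable_a) simp
  also have "\<dots> = (1/2) ^ n * 2" by (subst suminf_mult) (auto simp: suminf_geometric)
  finally show "norm (N p n * G p n) \<le> (1/2) ^ n * 2" using N_nonneg[of p n] G0 by simp
qed

text \<open>
  The derivative of order \<open>j\<close> of the smooth function that represents \<open>U (A (f n))\<close>.
\<close>
definition "g j n t = (\<Sum>m. a n m * nth_deriv j (\<phi> m) t)"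

lemma g_term_le: "j \<le> p \<Longrightarrow> norm (a n m * nth_deriv j (\<phi> m) t) \<le> cmod (a n m) * N p m"
  unfolding norm_mult by (intro mult_left_mono \<phi>_le) auto

lemma g_summable: "summable (\<lambda>m. a n m * nth_deriv j (\<phi> m) t)"
  by (rule summable_comparison_test'[OF summable_a[of n j]]) (rule g_term_le[OF order_refl])

lemma C0_g: "C0 (g j n)"
  unfolding g_def
  by (rule C0_series[OF _ g_term_le[OF order_refl] summable_a]) (intro C0_cmult smooth_C0_D \<phi>)

lemma g_deriv: "(g j n has_vector_derivative g (Suc j) n t) (at t)"
  unfolding g_def
  by (rule has_vector_derivative_suminf[OF _ g_term_le[OF order_refl] summable_a g_summable])
    (intro has_vector_derivative_mult_right smooth_C0_D \<phi>)

lemma g_le: 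
  assumes "j \<le> p"
  shows "cmod (g j n t) \<le> G p n"
  unfolding g_def G_def
  by (rule norm_suminf_le[OF g_term_le[OF assms] summable_a])

text \<open>
  The mixed partial derivative of order \<open>i\<close> in the first and \<open>j\<close> in the second variable of the kernel.
\<close>
definition kernel_deriv :: "nat \<Rightarrow> nat \<Rightarrow> real \<times> real \<Rightarrow> complex" where
  "kernel_deriv i j x = (\<Sum>n. nth_deriv i (\<phi> n) (fst x) * cnj (g j n (snd x)))"

lemma kernel_deriv_term_le:
  assumes "i \<le> p" "j \<le> p"
  shows "norm (nth_deriv i (\<phi> n) s * cnj (g j n t)) \<le> N p n * G p n"
  unfolding norm_mult complex_mod_cnj using assms by (intro mult_mono \<phi>_le g_le N_nonneg) auto

lemma kernel_deriv_summable: "summable (\<lambda>n. nth_deriv i (\<phi> n) s * cnj (g j n t))"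
  by (rule summable_comparison_test'[OF summable_G[of "max i j"]]) (rule kernel_deriv_term_le, auto)

lemma C0_kernel_deriv: "C0 (kernel_deriv i j)"
  unfolding kernel_deriv_def
  by (rule C0_series[OF _ kernel_deriv_term_le[where p = "max i j"] summable_G])
    (auto intro!: C0_tensor C0_cnj C0_g smooth_C0_D \<phi>)

lemma kernel_deriv_fst: "((\<lambda>x. kernel_deriv i j (x, t)) has_vector_derivative kernel_deriv (Suc i) j (s, t)) (at s)"
  unfolding kernel_deriv_def fst_conv snd_conv
  by (rule has_vector_derivative_suminf[OF _ kernel_deriv_term_le[where p = "max (Suc i) j"] summable_G kernel_deriv_summable])
    (auto intro!: has_vector_derivative_mult_left smooth_C0_D(1) \<phi> simp del: nth_deriv.simps)

lemma kernel_deriv_snd: "((\<lambda>y. kernel_deriv i j (s, y)) has_vector_derivative kernel_deriv i (Suc j) (s, t)) (at t)"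
  unfolding kernel_deriv_def fst_conv snd_conv
  by (rule has_vector_derivative_suminf[OF _ kernel_deriv_term_le[where p = "max i (Suc j)"] summable_G kernel_deriv_summable])
    (auto intro!: has_vector_derivative_mult_right has_vector_derivative_cnj' g_deriv simp del: nth_deriv.simps)

abbreviation "K \<equiv> kernel_deriv 0 0"

lemma sums_U: "(\<lambda>n. cinner x (f n) *\<^sub>C u n) sums U x"
proof -
  have "cinner (U x) (u n) = cinner x (f n)" for n
    using unitary_D(3)[OF U(1), of x "f n"] U(2) by simp
  then show ?thesis using orthonormal_expansion[OF u, of "U x"] by simp
qed

lemma g_L2: "square_integrable (g 0 n) \<and> abs_L2 (g 0 n) = U (A (f n))"
proof (rule L2_series)
  show "square_integrable (\<lambda>t. a n m * \<phi> m t)" for m by (intro square_integrable_scale \<phi>)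
  show "(\<lambda>m. abs_L2 (\<lambda>t. a n m * \<phi> m t)) sums U (A (f n))"
    using sums_U[of "A (f n)"] by (simp add: scaleC_abs_L2[symmetric] \<phi> a_def)
  show "(\<lambda>m. a n m * \<phi> m t) sums g 0 n t" for t
    using summable_sums[OF g_summable[of n 0 t]] by (simp add: g_def)
qed

text \<open>
  The strong derivative of order \<open>i\<close> of the Carleman function; its series converges absolutely in \<open>L\<^sub>2\<close>.
\<close>
definition carleman_deriv :: "nat \<Rightarrow> real \<Rightarrow> L2" where
  "carleman_deriv i s = (\<Sum>n. cnj (nth_deriv i (\<phi> n) s) *\<^sub>C U (A (f n)))"

lemma carleman_deriv_term_le: "norm (cnj (nth_deriv i (\<phi> n) s) *\<^sub>C U (A (f n))) \<le> norm (A (f n)) * N i n"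
  unfolding norm_scaleC norm_unitary[OF U(1)] complex_mod_cnj mult.commute[of "norm (A _)"]
  by (intro mult_right_mono \<phi>_le) auto

lemma carleman_deriv_summable: "summable (\<lambda>n. cnj (nth_deriv i (\<phi> n) s) *\<^sub>C U (A (f n)))"
  by (rule summable_comparison_test'[OF summable_norm_A[of i]]) (rule carleman_deriv_term_le)

lemma C0_carleman_deriv: "C0 (carleman_deriv i)"
  unfolding carleman_deriv_def
  by (rule C0_series[OF _ carleman_deriv_term_le summable_norm_A]) (intro C0_scaleC C0_cnj smooth_C0_D \<phi>)

lemma carleman_deriv_has_derivative: "(carleman_deriv i has_vector_derivative carleman_deriv (Suc i) s) (at s)"
  unfolding carleman_deriv_def
  by (rule has_vector_derivative_suminf[OF _ carleman_deriv_term_le summable_norm_A carleman_deriv_summable])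
    (intro bounded_linear.has_vector_derivative[OF bounded_bilinear.bounded_linear_left[OF bounded_bilinear_scaleC]]
       has_vector_derivative_cnj' smooth_C0_D \<phi>)

lemma K_section: "square_integrable (\<lambda>t. cnj (K (s, t))) \<and> abs_L2 (\<lambda>t. cnj (K (s, t))) = carleman_deriv 0 s"
proof (rule L2_series)
  show "square_integrable (\<lambda>t. cnj (\<phi> n s) * g 0 n t)" for n using g_L2 by (intro square_integrable_scale) auto
  show "(\<lambda>n. abs_L2 (\<lambda>t. cnj (\<phi> n s) * g 0 n t)) sums carleman_deriv 0 s"
    using summable_sums[OF carleman_deriv_summable[of 0 s]] g_L2 by (simp add: scaleC_abs_L2[symmetric] carleman_deriv_def)
  show "(\<lambda>n. cnj (\<phi> n s) * g 0 n t) sums cnj (K (s, t))" for t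
  proof -
    have "(\<lambda>n. cnj (\<phi> n s * cnj (g 0 n t))) sums cnj (K (s, t))"
      using summable_sums[OF kernel_deriv_summable[of 0 s 0 t]] unfolding sums_cnj by (simp add: kernel_deriv_def)
    then show ?thesis by simp
  qed
qed

lemma square_integrable_K: "square_integrable (\<lambda>t. K (s, t))"
  using square_integrable_cnj[of "\<lambda>t. cnj (K (s, t))"] K_section by simp

lemma carleman_kernel_K: "carleman_kernel K"
  unfolding carleman_kernel_def
  using continuous_measurable_lebesgue[OF C0_continuous[OF C0_kernel_deriv]] square_integrable_K by auto

lemma SK_infinity_K: "SK_infinity_kernel K"
  unfolding SK_infinity_kernel_def SK_kernel_def
proof (intro allI conjI carleman_kernel_K square_integrable_K)
  fix m
  show "partials_C0 m K" by (rule partials_C0_I[where F = kernel_deriv, OF C0_kernel_deriv kernel_deriv_fst kernel_deriv_snd])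
  have "carleman_function K = carleman_deriv 0" using K_section by (auto simp: carleman_function_def)
  then show "derivs_C0 m (carleman_function K)" by (simp add: derivs_C0_I[where d = carleman_deriv, OF C0_carleman_deriv carleman_deriv_has_derivative])
qed

text \<open>
  The coefficients of \<open>U y\<close> are those of the expansion of \<open>\<langle>U x, k(s)\<rangle>\<close>, where \<open>k\<close> is the Carleman function.
  The partial sums converge to \<open>U y\<close> in \<open>L\<^sub>2\<close> and to this inner product for every \<open>s\<close>.
\<close>
lemma K_represents:
  assumes adj: "\<And>n. cinner y (f n) = cinner x (A (f n))"
  shows "AE s in lebesgue. integrable lebesgue (\<lambda>t. K (s, t) * rep_L2 (U x) t) \<and>
    rep_L2 (U y) s = (LINT t|lebesgue. K (s, t) * rep_L2 (U x) t)"
proof -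
  have int: "integrable lebesgue (\<lambda>t. K (s, t) * rep_L2 (U x) t)" for s
    using square_integrable_cinner[OF square_integrable_rep_L2[of "U x"] conjunct1[OF K_section[of s]]]
    by (simp add: mult.commute)
  have c: "cinner (U x) (carleman_deriv 0 s) = (LINT t|lebesgue. K (s, t) * rep_L2 (U x) t)" for s
    using cinner_abs_L2[OF square_integrable_rep_L2[of "U x"] conjunct1[OF K_section[of s]]] K_section[of s]
    by (simp add: mult.commute)
  have L: "square_integrable (\<lambda>s. cinner (U x) (carleman_deriv 0 s)) \<and> abs_L2 (\<lambda>s. cinner (U x) (carleman_deriv 0 s)) = U y"
  proof (rule L2_series)
    show "square_integrable (\<lambda>s. cinner y (f n) * \<phi> n s)" for n by (intro square_integrable_scale \<phi>)
    show "(\<lambda>n. abs_L2 (\<lambda>s. cinner y (f n) * \<phi> n s)) sums U y"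
      using sums_U[of y] by (simp add: scaleC_abs_L2[symmetric] \<phi>)
    show "(\<lambda>n. cinner y (f n) * \<phi> n s) sums cinner (U x) (carleman_deriv 0 s)" for s
    proof -
      have "(\<lambda>n. cinner (U x) (cnj (\<phi> n s) *\<^sub>C U (A (f n)))) sums cinner (U x) (carleman_deriv 0 s)"
        using cinner_sums_right[OF summable_sums[OF carleman_deriv_summable[of 0 s]]] by (simp add: carleman_deriv_def)
      then show ?thesis
        by (simp add: cinner_scaleC_right unitary_D(3)[OF U(1)] adj mult.commute)
    qed
  qed
  then have "AE s in lebesgue. rep_L2 (U y) s = cinner (U x) (carleman_deriv 0 s)"
    using rep_abs_L2 by metis
  then show ?thesis by eventually_elim (simp add: int c)
qed

end

theorem mainTheorem1:
  fixes D :: "'h::chilbert_space set" and S :: "'h \<Rightarrow> 'h"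
  assumes "separable_space (euclidean :: 'h topology)"
    and "class_C0 D S"
  shows "\<exists>U :: 'h \<Rightarrow> L2. unitary U \<and>
           (\<exists>K. SK_infinity_kernel K \<and>
                carleman_operator_with_kernel (U ` D) (U \<circ> S \<circ> inv U) K)"
proof -
  let ?A = "adj D S" and ?W = "adj_domain D S"
  have lin: "linear_operator D S" and cl: "closed_operator D S" and dense: "densely_defined D"
    and "0 \<in> limit_spectrum ?W ?A"
    using assms(2) by (auto simp: class_C0_def)
  then obtain e where e: "orthonormal_seq e" "\<And>n. e n \<in> ?W" "(\<lambda>n. norm (?A (e n))) \<longlonglongrightarrow> 0"
    by (auto simp: limit_spectrum_def)
  have A: "linear_operator ?W ?A" by (rule linear_operator_adj[OF dense])
  have W: "csubspace ?W" using A by (simp add: linear_operator_def)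
  obtain d where d: "\<And>n. d n \<in> ?W" "total_seq d"
    using countable_total_subset[OF assms(1) W adj_domain_total[OF lin cl dense]] by metis
  obtain f u where f: "orthonormal_seq f" "total_seq f" and fW: "\<And>n. f n \<in> ?W"
    and u: "orthonormal_seq u" "total_seq u" "\<And>n. u n \<in> test_L2" "\<And>n. basis_bounds ?A f u n"
    using adapted_bases_exist[OF A e d] by metis
  obtain U where U: "unitary U" "\<And>n. U (f n) = u n"
    using unitary_between_bases[OF f u(1,2)] by metis
  interpret adapted_bases ?A f u U
    by unfold_locales (use f u U in auto)
  have inv: "inv U (U x) = x" for x by (rule inv_f_f[OF inj_unitary[OF U(1)]])
  have "integral_operator_with_kernel (U ` D) (U \<circ> S \<circ> inv U) K"
    unfolding integral_operator_with_kernel_def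
  proof (intro conjI ballI unitary_image_linear_operator unitary_image_dense U lin dense)
    show "K \<in> borel_measurable lebesgue" using carleman_kernel_K by (simp add: carleman_kernel_def)
    fix v assume "v \<in> U ` D"
    then obtain x where x: "x \<in> D" "v = U x" by auto
    show "AE s in lebesgue. integrable lebesgue (\<lambda>t. K (s, t) * rep_L2 v t) \<and>
        rep_L2 ((U \<circ> S \<circ> inv U) v) s = (LINT t|lebesgue. K (s, t) * rep_L2 v t)"
      using K_represents[of "S x" x] adj_eq[OF dense fW x(1)] by (simp add: x inv)
  qed
  then have "carleman_operator_with_kernel (U ` D) (U \<circ> S \<circ> inv U) K"
    by (simp add: carleman_operator_with_kernel_def carleman_kernel_K)
  then show ?thesis using U(1) SK_infinity_K by blast
qed
end
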